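(* Let $X$ be a Polish ultrametric space. If every FD family $\mathcal{B}$ in $X$ can be strengthened to an FD family $\mathcal{B}'$ in $X$ such that $X$ has the $\mathcal{B}'$-extremality property, then $\mathrm{Iso}(X)$ has a neighborhood basis at the identity consisting of open subgroups with ample generics. Otherwise (that is, if there is an FD family that cannot be strengthened to an FD family $\mathcal{B}'$ such that $X$ has the $\mathcal{B}'$-extremality property), no open subgroup $V \leq \mathrm{Iso}(X)$ has a comeager conjugacy class.
   Context: A metric space $(X,d)$ is ultrametric if $d(x,z)\le \max\{d(x,y),d(y,z)\}$ for all $x,y,z$; it is Polish if it is separable and complete. $\mathrm{Iso}(X)$ is the group of all distance-preserving bijections of $X$, with the topology of pointwise convergence; for Polish $X$ it is a Polish group. A ball of radius $r>0$ in $X$ is a set $\{x'\in X: d(x,x')<r\}$; a ball is considered together with its radius (balls of different radii may be equal as sets), and for $g\in\mathrm{Iso}(X)$ the image $g[C]$ is a ball of the same radius as $C$. An FD family is a finite (possibly empty) family of pairwise disjoint balls. For an FD family $\mathcal{B}$ and $g\in \mathrm{Iso}(X)$, $\tau(g,\mathcal{B})=\{g'\in\mathrm{Iso}(X): g'[B]=g[B]\text{ for each }B\in\mathcal{B}\}$; these sets form a basis of the topology of $\mathrm{Iso}(X)$. An FD family $\mathcal{B}'$ strengthens $\mathcal{B}$ if $\tau(Id,\mathcal{B}')\subseteq\tau(Id,\mathcal{B})$. For a ball $C$, $\mathcal{O}^{\mathcal{B}}(C)=\{g[C]: g\in\tau(Id,\mathcal{B})\}$. $X$ has the $\mathcal{B}$-extremality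 property if for every ball $C$ in $X$ the family $\mathcal{O}^{\mathcal{B}}(C)$ is infinite or a singleton. A Polish group $G$ has ample generics if for every $n\in\mathbb{N}$ (including $n=0$) the diagonal conjugation action of $G$ on $G^{n+1}$, $g.(g_0,\ldots,g_n)=(gg_0g^{-1},\ldots,gg_ng^{-1})$, has a comeager orbit. An open subgroup $V$ has a comeager conjugacy class if some conjugacy class of the group $V$ is comeager in $V$. *)

theory Defs
  imports "HOL-Analysis.Analysis" "HOL-Algebra.Group_Action"
begin

section \<open>Baire category\<close>

definition nowhere_dense_in :: "'a topology \<Rightarrow> 'a set \<Rightarrow> bool" where
  "nowhere_dense_in T S \<longleftrightarrow> S \<subseteq> topspace T \<and> T interior_of (T closure_of S) = {}"

definition meager_in :: "'a topology \<Rightarrow> 'a set \<Rightarrow> bool" where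
  "meager_in T S \<longleftrightarrow> (\<exists>\<N>. countable \<N> \<and> (\<forall>N\<in>\<N>. nowhere_dense_in T N) \<and> S = \<Union>\<N>)"

definition comeager_in :: "'a topology \<Rightarrow> 'a set \<Rightarrow> bool" where
  "comeager_in T S \<longleftrightarrow> S \<subseteq> topspace T \<and> meager_in T (topspace T - S)"


section \<open>Conjugation and ample generics\<close>

text \<open>
  A topological group is given by a group \<open>G\<close> together with a topology \<open>T\<close> on its carrier.
  Elements of \<open>G\<^sup>n\<^sup>+\<^sup>1\<close> are the functions on the index set \<open>{0, \<dots>, n}\<close>, extended by
  \<open>undefined\<close>, so that the space of such tuples is the carrier of the product topology.
  The property \<open>ample_generics\<close> is meant for Polish groups; that \<open>G\<close> is one is not part
  of the definition.
\<close>

definition diag_conj :: "('a, 'b) monoid_scheme \<Rightarrow> nat \<Rightarrow> 'a \<Rightarrow> (nat \<Rightarrow> 'a) \<Rightarrow> (nat \<Rightarrow> 'a)" where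
  "diag_conj G n g x = (\<lambda>i\<in>{..n}. g \<otimes>\<^bsub>G\<^esub> x i \<otimes>\<^bsub>G\<^esub> inv\<^bsub>G\<^esub> g)"

definition ample_generics :: "('a, 'b) monoid_scheme \<Rightarrow> 'a topology \<Rightarrow> bool" where
  "ample_generics G T \<longleftrightarrow>
    (\<forall>n. \<exists>x \<in> {..n} \<rightarrow>\<^sub>E carrier G.
       comeager_in (product_topology (\<lambda>_. T) {..n}) (orbit G (diag_conj G n) x))"

definition conj_class :: "('a, 'b) monoid_scheme \<Rightarrow> 'a \<Rightarrow> 'a set" where
  "conj_class G x = orbit G (\<lambda>g h. g \<otimes>\<^bsub>G\<^esub> h \<otimes>\<^bsub>G\<^esub> inv\<^bsub>G\<^esub> g) x"

definition has_comeager_conj_class :: "('a, 'b) monoid_scheme \<Rightarrow> 'a topology \<Rightarrow> bool" where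
  "has_comeager_conj_class G T \<longleftrightarrow> (\<exists>x \<in> carrier G. comeager_in T (conj_class G x))"


section \<open>The isometry group\<close>

definition Isom :: "('a::metric_space \<Rightarrow> 'a) set" where
  "Isom = {g. bij g \<and> (\<forall>x y. dist (g x) (g y) = dist x y)}"

definition Isom_group :: "('a::metric_space \<Rightarrow> 'a) monoid" where
  "Isom_group = \<lparr>carrier = Isom, mult = (\<circ>), one = id\<rparr>"

text \<open>The canonical topology on a function type is the product topology, i.e. that of
  pointwise convergence.\<close>

definition Isom_topology :: "('a::metric_space \<Rightarrow> 'a) topology" where
  "Isom_topology = top_of_set Isom"

definition open_subgroup :: "('a::metric_space \<Rightarrow> 'a) set \<Rightarrow> bool" where
  "open_subgroup V \<longleftrightarrow> subgroup V Isom_group \<and> openin Isom_topology V"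

abbreviation subgroup_group :: "('a::metric_space \<Rightarrow> 'a) set \<Rightarrow> ('a \<Rightarrow> 'a) monoid" where
  "subgroup_group V \<equiv> Isom_group\<lparr>carrier := V\<rparr>"

abbreviation subgroup_topology :: "('a::metric_space \<Rightarrow> 'a) set \<Rightarrow> ('a \<Rightarrow> 'a) topology" where
  "subgroup_topology V \<equiv> subtopology Isom_topology V"


section \<open>Ultrametric spaces and families of balls\<close>

definition ultrametric :: "'a::metric_space itself \<Rightarrow> bool" where
  "ultrametric _ \<longleftrightarrow> (\<forall>x y z :: 'a. dist x z \<le> max (dist x y) (dist y z))"

text \<open>A ball is considered together with its radius; balls of different radii are different
  even if they are equal as sets.\<close>

type_synonym 'a rball = "'a set \<times> real"

definition rballs :: "'a::metric_space rball set" where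
  "rballs = {(ball x r, r) | x r. r > 0}"

definition ball_image :: "('a \<Rightarrow> 'a) \<Rightarrow> 'a rball \<Rightarrow> 'a rball" where
  "ball_image g C = (g ` fst C, snd C)"

definition FD_family :: "'a::metric_space rball set \<Rightarrow> bool" where
  "FD_family \<B> \<longleftrightarrow> finite \<B> \<and> \<B> \<subseteq> rballs \<and> pairwise (\<lambda>B C. disjnt (fst B) (fst C)) \<B>"

definition \<tau> :: "('a::metric_space \<Rightarrow> 'a) \<Rightarrow> 'a rball set \<Rightarrow> ('a \<Rightarrow> 'a) set" where
  "\<tau> g \<B> = {g' \<in> Isom. \<forall>B\<in>\<B>. ball_image g' B = ball_image g B}"

definition strengthens :: "'a::metric_space rball set \<Rightarrow> 'a rball set \<Rightarrow> bool" where
  "strengthens \<B>' \<B> \<longleftrightarrow> \<tau> id \<B>' \<subseteq> \<tau> id \<B>"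

definition ball_orbit :: "'a::metric_space rball set \<Rightarrow> 'a rball \<Rightarrow> 'a rball set" where
  "ball_orbit \<B> C = {ball_image g C | g. g \<in> \<tau> id \<B>}"

definition extremality :: "'a::metric_space rball set \<Rightarrow> bool" where
  "extremality \<B> \<longleftrightarrow> (\<forall>C\<in>rballs. infinite (ball_orbit \<B> C) \<or> is_singleton (ball_orbit \<B> C))"

end

theory Submission
  imports Defs "HOL-Combinatorics.Permutations"
begin

text \<open>
  A finite family of balls is given by centers and radii, and only its stabilizer matters. Isometries
  of an ultrametric space can be changed freely on disjoint balls: if \<open>m\<close> moves \<open>x\<close> by \<open>e\<close>, there is
  an isometry exchanging the \<open>e\<close>-balls of \<open>x\<close> and \<open>m x\<close> and fixing everything else.
  So every finite partial isometry that pointwise agrees with isometries of the space extends to one.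

  Suppose that the extremal families are cofinal. Finite partial isometries extend to isometries with
  a common finite invariant set, and unions of extremal families are extremal; so the tuples that
  normalize the stabilizer of some small extremal family \<open>Q\<close> are dense. Over such \<open>Q\<close>, two tuples in
  the same coset can be amalgamated after one of them has been moved by an element of the stabilizer
  of \<open>Q\<close> that displaces finitely many points far enough. Hence generic tuples have locally dense orbits,
  and a back-and-forth argument shows that they are all conjugate.

  If \<open>Q\<close> has no extremal strengthening, there are infinitely many balls with finite nontrivial orbits
  under the stabilizer of \<open>Q\<close>. The signs of the permutations of these orbits are characters which
  remain nontrivial near every element. As they are constant on conjugacy classes, the latter are
  nowhere dense in the stabilizer of \<open>Q\<close>, and a class of an open subgroup meets it in a countable
  union of such classes.
\<close>

section \<open>Isometries\<close>

text \<open>Amalgamating \<open>h\<close> with \<open>k = h u\<close>, where \<open>u\<close>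
  stabilizes \<open>Q\<close>, asks for an \<open>f\<close> that equals \<open>h\<close> on a finite
  set \<open>R\<close> and the conjugate of \<open>k\<close> by \<open>w\<close> on the image of
  \<open>R\<close> under \<open>w\<close>. By gluing, the only condition is
  \<open>dist (h x) (w (k y)) = dist x (w y)\<close> on \<open>R\<close>. If a ball invariant under
  the stabilizer separates \<open>x\<close> from \<open>y\<close>, neither \<open>u\<close> nor
  \<open>w\<close> affects the distances. If none does, \<open>h\<close> has to respect the
  displacement by \<open>w\<close>. Since \<open>h\<close> normalizes the stabilizer, it permutes
  the classes of unseparated points, and one displacement can be chosen for each orbit of classes.
  So normalizing tuples must be dense; for this a family may have only finitely many translates
  under a group containing the tuple, hence the finite invariant set of centers. Extremality is used
  to send a point off a finite set: when a class is displaced, and when extremality is proved for a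
  union. In the negative part every sign is locally constant, so a single one decides nothing near a
  given element. The balls must be found away from any given finite set, and this is what infinitely
  many of them provide.\<close>

text \<open>The notation \<open>inv\<close> is taken by group inverses.\<close>

abbreviation iv :: "('a \<Rightarrow> 'b) \<Rightarrow> 'b \<Rightarrow> 'a" where
  "iv g \<equiv> inv_into UNIV g"

lemma Isom_I:
  assumes "\<And>x y. dist (g x) (g y) = dist x y" "\<And>y. \<exists>x. g x = y"
  shows "g \<in> Isom"
proof -
  have "inj g" by (metis assms(1) dist_eq_0_iff injI)
  moreover have "surj g" by (metis assms(2) surjI)
  ultimately show ?thesis using assms(1) by (simp add: Isom_def bij_def)
qed

lemma bij_Isom: "g \<in> Isom \<Longrightarrow> bij g"
  by (simp add: Isom_def)

lemma dist_Isom [simp]: "g \<in> Isom \<Longrightarrow> dist (g x) (g y) = dist x y"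
  by (simp add: Isom_def)

lemma Isom_inv_right [simp]: "g \<in> Isom \<Longrightarrow> g (iv g x) = x"
  by (rule surj_f_inv_f[OF bij_is_surj[OF bij_Isom]])

lemma Isom_inv_left [simp]: "g \<in> Isom \<Longrightarrow> iv g (g x) = x"
  by (rule inv_f_f[OF bij_is_inj[OF bij_Isom]])

lemma id_Isom [simp]: "id \<in> Isom"
  by (rule Isom_I) auto

lemma comp_Isom [simp]: "g \<in> Isom \<Longrightarrow> h \<in> Isom \<Longrightarrow> g \<circ> h \<in> Isom"
  by (rule Isom_I) (auto, metis Isom_inv_right)

lemma inv_Isom [simp]:
  assumes "g \<in> Isom"
  shows "iv g \<in> Isom"
proof (rule Isom_I)
  show "dist (iv g x) (iv g y) = dist x y" for x y
    by (metis assms dist_Isom Isom_inv_right)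
  show "\<exists>x. iv g x = y" for y
    using assms Isom_inv_left by blast
qed

lemma inv_comp_Isom [simp]:
  "g \<in> Isom \<Longrightarrow> iv g \<circ> g = id" "g \<in> Isom \<Longrightarrow> g \<circ> iv g = id"
  by (rule ext, simp)+

lemma inv_inv_Isom [simp]: "g \<in> Isom \<Longrightarrow> iv (iv g) = g"
  by (rule inv_inv_eq[OF bij_Isom])

lemma inv_comp_distrib_Isom: "g \<in> Isom \<Longrightarrow> h \<in> Isom \<Longrightarrow> iv (g \<circ> h) = iv h \<circ> iv g"
  by (rule o_inv_distrib[OF bij_Isom bij_Isom])

lemma dist_inv_left: "g \<in> Isom \<Longrightarrow> dist (iv g x) y = dist x (g y)"
  by (metis dist_Isom Isom_inv_right)

lemma dist_inv_right: "g \<in> Isom \<Longrightarrow> dist x (iv g y) = dist (g x) y"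
  by (metis dist_Isom Isom_inv_right)

lemma inj_Isom: "g \<in> Isom \<Longrightarrow> g x = g y \<longleftrightarrow> x = y"
  by (metis Isom_inv_left)

lemma image_ball_Isom:
  assumes "g \<in> Isom"
  shows "g ` ball x r = ball (g x) r"
proof
  show "g ` ball x r \<subseteq> ball (g x) r" using assms by auto
  show "ball (g x) r \<subseteq> g ` ball x r"
  proof
    fix y assume "y \<in> ball (g x) r"
    then have "iv g y \<in> ball x r" using assms by (simp add: dist_inv_right)
    then show "y \<in> g ` ball x r" using Isom_inv_right[OF assms, of y] by (metis imageI)
  qed
qed

section \<open>Gluing isometries along balls of an ultrametric space\<close>

locale ultrametric_type =
  fixes ty :: "'a::metric_space itself"
  assumes ultra: "ultrametric TYPE('a)"
begin

lemma ultra_le: "dist (x::'a) z \<le> max (dist x y) (dist y z)"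
  using ultra by (simp add: ultrametric_def)

lemma ultra_less: "dist (x::'a) y < r \<Longrightarrow> dist y z < r \<Longrightarrow> dist x z < r"
  using ultra_le[of x z y] by auto

lemma ultra_leI: "dist (x::'a) y \<le> r \<Longrightarrow> dist y z \<le> r \<Longrightarrow> dist x z \<le> r"
  using ultra_le[of x z y] by auto

lemma ultra_eq: "dist (x::'a) y < dist y z \<Longrightarrow> dist x z = dist y z"
  using ultra_le[of x z y] ultra_le[of y z x] by (auto simp: dist_commute max_def split: if_splits)

lemma ultra_eq2: "dist (x::'a) x' < r \<Longrightarrow> dist y y' < r \<Longrightarrow> r \<le> dist x y \<Longrightarrow> dist x' y' = dist x y"
  by (metis ultra_eq dist_commute order_less_le_trans)

text \<open>A point outside both balls has the same distance to all points in them, and points of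
  different balls are at distance \<open>e\<close>; so exchanging the balls preserves distances. The
  map is an involution, hence onto. For \<open>e = 0\<close> the balls are empty and
  \<open>f\<close> is the identity.\<close>

lemma ball_swap:
  assumes m: "m \<in> Isom" and e: "e = dist (x::'a) (m x)"
  obtains f where "f \<in> Isom" "\<And>y. dist x y < e \<Longrightarrow> f y = m y"
    "\<And>y. dist (m x) y < e \<Longrightarrow> f y = iv m y"
    "\<And>y. e \<le> dist x y \<Longrightarrow> e \<le> dist (m x) y \<Longrightarrow> f y = y"
proof -
  define f where "f y = (if dist x y < e then m y else if dist (m x) y < e then iv m y else y)" for y
  have disj: "dist x y < e \<Longrightarrow> \<not> dist (m x) y < e" for y
    using ultra_less[of x y e "m x"] e by (auto simp: dist_commute)
  have f1: "dist x y < e \<Longrightarrow> f y = m y" for y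
    by (simp add: f_def)
  have f2: "dist (m x) y < e \<Longrightarrow> f y = iv m y" for y
    using disj f_def by auto
  have f3: "e \<le> dist x y \<Longrightarrow> e \<le> dist (m x) y \<Longrightarrow> f y = y" for y
    using f_def by auto
  have b1: "dist (m x) (f y) < e" if "dist x y < e" for y
    using that m by (simp add: f1)
  have b2: "dist x (f y) < e" if "dist (m x) y < e" for y
    using that m by (simp add: f2 dist_inv_right)
  have ff: "f (f y) = y" for y
  proof -
    consider "dist x y < e" | "dist (m x) y < e" | "e \<le> dist x y" "e \<le> dist (m x) y" by linarith
    then show ?thesis
      by cases (use b1 b2 f1 f2 f3 m in auto)
  qed
  have b12: "dist (f y) (f z) = dist y z" if y: "dist x y < e" and z: "dist (m x) z < e" for y z
  proof -
    have "dist y z = e" using ultra_eq2[of x y e "m x" z] y z e by simp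
    moreover have "dist (f z) (f y) = e"
      using ultra_eq2[of x "f z" e "m x" "f y"] b1[OF y] b2[OF z] e by simp
    ultimately show ?thesis by (simp add: dist_commute)
  qed
  have b13: "dist (f y) (f z) = dist y z" if y: "dist x y < e" and z: "e \<le> dist x z" "e \<le> dist (m x) z" for y z
  proof -
    have 1: "dist y z = dist x z" using ultra_eq[of y x z] y z by (simp add: dist_commute)
    have 2: "dist (f y) z = dist (m x) z"
      using ultra_eq[of "f y" "m x" z] b1[OF y] z by (simp add: dist_commute)
    have "dist (m x) z = dist x z"
      using ultra_le[of x z "m x"] ultra_le[of "m x" z x] z e by (auto simp: dist_commute)
    with 1 2 f3[OF z] show ?thesis by simp
  qed
  have b23: "dist (f y) (f z) = dist y z" if y: "dist (m x) y < e" and z: "e \<le> dist x z" "e \<le> dist (m x) z" for y z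
    using b13[OF b2[OF y] z] ff[of y] f3[OF z] by simp
  have "dist (f y) (f z) = dist y z" for y z
  proof -
    consider "dist x y < e" | "dist (m x) y < e" | "e \<le> dist x y" "e \<le> dist (m x) y" by linarith
    then show ?thesis
    proof cases
      case 1
      consider "dist x z < e" | "dist (m x) z < e" | "e \<le> dist x z" "e \<le> dist (m x) z" by linarith
      then show ?thesis
        by cases (use 1 b12 b13 m f1 in auto)
    next
      case 2
      consider "dist x z < e" | "dist (m x) z < e" | "e \<le> dist x z" "e \<le> dist (m x) z" by linarith
      then show ?thesis
        by cases (use 2 b12[of z y] b23 m f2 in \<open>auto simp: dist_commute\<close>)
    next
      case 3
      consider "dist x z < e" | "dist (m x) z < e" | "e \<le> dist x z" "e \<le> dist (m x) z" by linarith
      then show ?thesis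
        by cases (use 3 b13[of z y] b23[of z y] f3 in \<open>auto simp: dist_commute\<close>)
    qed
  qed
  then have "f \<in> Isom" using ff by (intro Isom_I) metis+
  then show ?thesis using that f1 f2 f3 by blast
qed

text \<open>\<open>m\<close> preserves the \<open>t\<close>-ball of \<open>x\<close>, and an outside
  point has the same distance to all points of that ball.\<close>

lemma ball_restrict:
  assumes m: "m \<in> Isom" and x: "dist (x::'a) (m x) < t"
  obtains f where "f \<in> Isom" "\<And>y. dist x y < t \<Longrightarrow> f y = m y" "\<And>y. t \<le> dist x y \<Longrightarrow> f y = y"
proof -
  define f where "f y = (if dist x y < t then m y else y)" for y
  have b: "dist x (m y) < t \<longleftrightarrow> dist x y < t" for y
    using ultra_less[of x "m x" t "m y"] ultra_less[of "m x" x t "m y"] x m by (auto simp: dist_commute)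
  have *: "dist (m y) z = dist y z" if "dist x y < t" "t \<le> dist x z" for y z
    using ultra_eq[of "m y" x z] ultra_eq[of y x z] that b[of y] by (simp add: dist_commute)
  have "dist (f y) (f z) = dist y z" for y z
    using *[of y z] *[of z y] m by (auto simp: f_def dist_commute)
  moreover have "\<exists>z. f z = y" for y
  proof (cases "dist x y < t")
    case True
    then have "dist x (iv m y) < t" using b[of "iv m y"] m by simp
    then have "f (iv m y) = y" using m by (simp add: f_def)
    then show ?thesis by blast
  next
    case False
    then have "f y = y" by (simp add: f_def)
    then show ?thesis by blast
  qed
  ultimately have "f \<in> Isom" by (rule Isom_I)
  then show ?thesis by (rule that) (auto simp: f_def)
qed

text \<open>A pair \<open>(x, m)\<close> prescribes the value \<open>m x\<close>. The isometry
  \<open>m\<close> certifies that some isometry of the space takes \<open>x\<close> there, as the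
  group need not be transitive.\<close>

lemma extend_Isom:
  assumes "finite J" and "\<And>x m. (x, m) \<in> J \<Longrightarrow> m \<in> Isom"
    and "\<And>x m y k. (x, m) \<in> J \<Longrightarrow> (y, k) \<in> J \<Longrightarrow> dist (m x) (k y) = dist (x::'a) y"
  obtains f where "f \<in> Isom" "\<And>x m. (x, m) \<in> J \<Longrightarrow> f x = m x"
  using assms
proof (induction J arbitrary: thesis rule: finite_induct)
  case empty
  show ?case by (rule empty(1)[OF id_Isom]) auto
next
  case (insert p J)
  obtain x m where p: "p = (x, m)" by fastforce
  obtain f where f: "f \<in> Isom" "\<And>y k. (y, k) \<in> J \<Longrightarrow> f y = k y"
    using insert.IH insert.prems by (metis insertCI)
  have m: "m \<in> Isom" using insert.prems p by blast
  \<comment> \<open>The new value is pulled back by \<open>f\<close>; it remains to move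
    \<open>x\<close> to \<open>k x\<close> while fixing the points treated before.\<close>
  define k where "k = iv f \<circ> m"
  have k: "k \<in> Isom" using f m by (simp add: k_def)
  obtain u where u: "u \<in> Isom" "\<And>y. dist x y < dist x (k x) \<Longrightarrow> u y = k y"
    "\<And>y. dist (k x) y < dist x (k x) \<Longrightarrow> u y = iv k y"
    "\<And>y. dist x (k x) \<le> dist x y \<Longrightarrow> dist x (k x) \<le> dist (k x) y \<Longrightarrow> u y = y"
    using ball_swap[OF k refl] by blast
  have ux: "u x = k x" using u(2)[of x] u(4)[of x] by (cases "x = k x") (auto simp: dist_commute)
  \<comment> \<open>Such a \<open>y\<close> is equidistant from \<open>x\<close> and
    \<open>k x\<close>, so by the ultrametric inequality it is outside both balls of the
    swap.\<close>
  have uy: "u y = y" if "(y, l) \<in> J" for y l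
  proof -
    have "dist (k x) y = dist (m x) (l y)"
      using f that by (metis dist_inv_left k_def o_apply)
    then have e: "dist (k x) y = dist x y" using insert.prems that p by auto
    have "dist x (k x) \<le> dist x y" using ultra_le[of x "k x" y] e by (simp add: dist_commute)
    then show ?thesis using u(4) e by simp
  qed
  have "f \<circ> u \<in> Isom" using f u by simp
  moreover have "(f \<circ> u) y = l y" if "(y, l) \<in> insert p J" for y l
    using that ux uy f p m by (auto simp: k_def)
  ultimately show ?case using insert.prems(1) by blast
qed

end

section \<open>Extending partial isometries to a finite invariant set\<close>

text \<open>In each color \<open>D\<close> and its image under \<open>j\<close> use up equally many
  points of \<open>A\<close>, so the leftover points can be matched.\<close>

lemma extend_partial_permutation:
  fixes A :: "'b set" and c :: "'b \<Rightarrow> 'c"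
  assumes A: "finite A" and D: "D \<subseteq> A" and j: "inj_on j D" "j ` D \<subseteq> A"
    and c: "\<And>x. x \<in> D \<Longrightarrow> c (j x) = c x"
  obtains \<pi> where "bij_betw \<pi> A A" "\<And>x. x \<in> D \<Longrightarrow> \<pi> x = j x" "\<And>x. x \<in> A \<Longrightarrow> c (\<pi> x) = c x"
proof -
  have "\<exists>\<beta>. bij_betw \<beta> {x \<in> A - D. c x = k} {x \<in> A - j ` D. c x = k}" for k
  proof -
    have fin: "finite D" using A D finite_subset by blast
    have e1: "{x \<in> A - D. c x = k} = {x \<in> A. c x = k} - {x \<in> D. c x = k}"
      and e2: "{x \<in> A - j ` D. c x = k} = {x \<in> A. c x = k} - j ` {x \<in> D. c x = k}"
      using c by auto
    have "card {x \<in> A - D. c x = k} = card {x \<in> A. c x = k} - card {x \<in> D. c x = k}"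
      unfolding e1 using fin D by (intro card_Diff_subset) auto
    moreover have "card {x \<in> A - j ` D. c x = k} = card {x \<in> A. c x = k} - card (j ` {x \<in> D. c x = k})"
      unfolding e2 using fin j(2) c by (intro card_Diff_subset) auto
    moreover have "card (j ` {x \<in> D. c x = k}) = card {x \<in> D. c x = k}"
      by (rule card_image) (use j(1) in \<open>auto simp: inj_on_def\<close>)
    ultimately show ?thesis using A by (intro finite_same_card_bij) auto
  qed
  then obtain \<beta> where \<beta>: "\<And>k. bij_betw (\<beta> k) {x \<in> A - D. c x = k} {x \<in> A - j ` D. c x = k}"
    by metis
  define \<pi> where "\<pi> x = (if x \<in> D then j x else \<beta> (c x) x)" for x
  have \<beta>': "\<beta> (c x) x \<in> A - j ` D" "c (\<beta> (c x) x) = c x" if "x \<in> A - D" for x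
    using bij_betwE[OF \<beta>[of "c x"]] that by auto
  have inA: "\<pi> ` A \<subseteq> A" using \<beta>' j(2) by (auto simp: \<pi>_def)
  have "inj_on \<pi> A"
  proof (rule inj_onI)
    fix x y assume xy: "x \<in> A" "y \<in> A" "\<pi> x = \<pi> y"
    consider "x \<in> D" "y \<in> D" | "x \<in> D" "y \<in> A - D" | "y \<in> D" "x \<in> A - D" | "x \<in> A - D" "y \<in> A - D"
      using xy by blast
    then show "x = y"
    proof cases
      case 1 then show ?thesis using xy j(1) by (auto simp: \<pi>_def inj_on_def)
    next
      case 2 then show ?thesis using xy \<beta>'(1)[of y] by (auto simp: \<pi>_def) (metis imageI)
    next
      case 3 then show ?thesis using xy \<beta>'(1)[of x] by (auto simp: \<pi>_def)
    next
      case 4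
      then have e: "\<beta> (c x) x = \<beta> (c y) y" using xy by (auto simp: \<pi>_def)
      then have "c x = c y" using 4 \<beta>'(2) by metis
      with e 4 show ?thesis using bij_betw_imp_inj_on[OF \<beta>[of "c x"]] by (auto simp: inj_on_def)
    qed
  qed
  then have "bij_betw \<pi> A A" using inA A by (simp add: bij_betw_def endo_inj_surj)
  moreover have "\<pi> x = j x" if "x \<in> D" for x using that by (simp add: \<pi>_def)
  moreover have "c (\<pi> x) = c x" if "x \<in> A" for x using that c \<beta>' by (simp add: \<pi>_def)
  ultimately show ?thesis using that by blast
qed

context ultrametric_type
begin

text \<open>The balls of radius \<open>s\<close> that meet \<open>Z\<close> are grouped into classes; \<open>b z\<close> is a base point of
  the class of \<open>z\<close> and \<open>\<theta> z\<close> transports the ball of \<open>b z\<close> to that of \<open>z\<close>. The transports are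
  chosen so that pulling back to the base ball always loses points.\<close>

lemma pullback_loses_points:
  assumes Z: "finite (Z :: 'a set)" and zz: "z1 \<in> Z" "z2 \<in> Z" "s \<le> dist z1 z2" and s: "s > 0"
  obtains \<theta> :: "'a \<Rightarrow> 'a \<Rightarrow> 'a" and b :: "'a \<Rightarrow> 'a" where
    "\<And>z. z \<in> Z \<Longrightarrow> \<theta> z \<in> Isom"
    "\<And>z. z \<in> Z \<Longrightarrow> dist (\<theta> z (b z)) z < s"
    "\<And>z z'. \<lbrakk>z \<in> Z; z' \<in> Z; dist z z' < s\<rbrakk> \<Longrightarrow> \<theta> z = \<theta> z' \<and> b z = b z'"
    "\<And>a z. \<lbrakk>a \<in> Isom; z \<in> Z; a z \<in> Z\<rbrakk> \<Longrightarrow> b (a z) = b z"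
    "\<And>z. z \<in> Z \<Longrightarrow> card ((\<lambda>w. iv (\<theta> w) w) ` {w \<in> Z. b w = b z}) < card Z"
proof (cases "\<exists>a z. a \<in> Isom \<and> z \<in> Z \<and> a z \<in> Z \<and> s \<le> dist z (a z)")
  \<comment> \<open>No isometry takes a point of \<open>Z\<close> into another \<open>s\<close>-ball
    meeting \<open>Z\<close>. So every ball is its own class with the identity as transport, and it
    misses \<open>z1\<close> or \<open>z2\<close>.\<close>
  case False
  define b where "b z = (SOME w. w \<in> Z \<and> dist w z < s)" for z
  have b: "b z \<in> Z \<and> dist (b z) z < s" if "z \<in> Z" for z
    unfolding b_def by (rule someI[of _ z]) (use that s in auto)
  \<comment> \<open>The choice in \<open>b\<close> uses a predicate that is the same for all points
    of an \<open>s\<close>-ball, so the chosen points agree. The same device recurs for all later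
    representatives and transports.\<close>
  have beq: "b z = b z'" if "dist z z' < s" for z z'
  proof -
    have "(\<lambda>w. w \<in> Z \<and> dist w z < s) = (\<lambda>w. w \<in> Z \<and> dist w z' < s)"
      using that ultra_less[of _ z s z'] ultra_less[of _ z' s z] by (auto simp: fun_eq_iff dist_commute)
    then show ?thesis by (simp add: b_def)
  qed
  have iv: "iv (id :: 'a \<Rightarrow> 'a) w = w" for w by (metis Isom_inv_right id_Isom id_apply)
  have "card ((\<lambda>w. iv id w) ` {w \<in> Z. b w = b z}) < card Z" if "z \<in> Z" for z
  proof -
    have "{w \<in> Z. b w = b z} \<noteq> Z"
    proof
      assume "{w \<in> Z. b w = b z} = Z"
      with zz have "z1 \<in> {w \<in> Z. b w = b z}" "z2 \<in> {w \<in> Z. b w = b z}" by auto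
      then have "b z1 = b z2" by simp
      then show False using b[of z1] b[of z2] zz ultra_less[of z1 "b z1" s z2] by (auto simp: dist_commute)
    qed
    then show ?thesis using Z by (auto simp: iv intro: psubset_card_mono)
  qed
  moreover have "b (a z) = b z" if "a \<in> Isom" "z \<in> Z" "a z \<in> Z" for a z
    using False that beq[of z "a z"] by force
  ultimately show ?thesis using that[of "\<lambda>_. id" b] b beq by auto
next
  case True
  then obtain a0 z0 where a0: "a0 \<in> Isom" "z0 \<in> Z" "a0 z0 \<in> Z" "s \<le> dist z0 (a0 z0)" by blast
  define R where "R z w \<longleftrightarrow> (\<exists>a\<in>Isom. dist (a z) w < s)" for z w :: 'a
  have Rrefl: "R z z" for z using s by (auto simp: R_def intro!: bexI[of _ id])
  have Rsym: "R w z" if "R z w" for z w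
    using that unfolding R_def by (metis inv_Isom dist_inv_left dist_commute)
  have Rtrans: "R x z" if "R x y" "R y z" for x y z
  proof -
    obtain a a' where a: "a \<in> Isom" "a' \<in> Isom" "dist (a x) y < s" "dist (a' y) z < s"
      using \<open>R x y\<close> \<open>R y z\<close> by (auto simp: R_def)
    then have "dist ((a' \<circ> a) x) z < s" using ultra_less[of "a' (a x)" "a' y" s z] by simp
    then show ?thesis using a unfolding R_def by (meson comp_Isom)
  qed
  define b where "b z = (if R z0 z then z0 else SOME w. w \<in> Z \<and> R w z)" for z
  \<comment> \<open>The class of \<open>z0\<close> has base point \<open>z0\<close>, and its
    transports to the balls of \<open>z0\<close> and \<open>a0 z0\<close> are the identity and
    \<open>a0\<close>. So these two points of \<open>Z\<close> have the same pullback, and this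
    class loses a point; the other classes miss \<open>z0\<close>.\<close>
  define \<theta> where "\<theta> z = (if dist z (a0 z0) < s then a0 else if dist z z0 < s then id
    else SOME a. a \<in> Isom \<and> dist (a (b z)) z < s)" for z
  have bR: "R (b z) z" "b z \<in> Z" if "z \<in> Z" for z
    using someI[of "\<lambda>w. w \<in> Z \<and> R w z" z] that Rrefl a0 by (auto simp: b_def)
  have Rb: "b z = b z'" if "R z z'" for z z'
  proof -
    have "(\<lambda>w. w \<in> Z \<and> R w z) = (\<lambda>w. w \<in> Z \<and> R w z')" "R z0 z = R z0 z'"
      using that Rsym Rtrans by blast+
    then show ?thesis by (simp add: b_def)
  qed
  have b0: "b z = z0" if "R z0 z" for z using that by (simp add: b_def)
  have R0: "R z0 z" if "dist z (a0 z0) < s \<or> dist z z0 < s" for z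
    using that a0 unfolding R_def by (metis dist_commute id_Isom id_apply)
  have \<theta>: "\<theta> z \<in> Isom \<and> dist (\<theta> z (b z)) z < s" if "z \<in> Z" for z
  proof -
    have "\<exists>a. a \<in> Isom \<and> dist (a (b z)) z < s" using bR(1)[OF that] by (auto simp: R_def)
    from someI_ex[OF this] show ?thesis
      using a0 R0[of z] b0[of z] by (auto simp: \<theta>_def dist_commute)
  qed
  have dR: "R z z'" if "dist z z' < s" for z z'
    using that by (auto simp: R_def intro!: bexI[of _ id])
  have \<theta>b: "\<theta> z = \<theta> z' \<and> b z = b z'" if "dist z z' < s" for z z'
  proof -
    have eq: "dist u z < s \<longleftrightarrow> dist u z' < s" for u
      using that ultra_less[of u z s z'] ultra_less[of u z' s z] by (auto simp: dist_commute)
    have "b z = b z'" by (rule Rb[OF dR[OF that]])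
    then show ?thesis unfolding \<theta>_def by (simp add: eq dist_commute[of z] dist_commute[of z'])
  qed
  have "card ((\<lambda>w. iv (\<theta> w) w) ` {w \<in> Z. b w = b z}) < card Z" if z: "z \<in> Z" for z
  proof (cases "b z = z0")
    case True
    define W where "W = {w \<in> Z. b w = z0}"
    have W: "finite W" "W \<subseteq> Z" using Z by (auto simp: W_def)
    have in0: "z0 \<in> W" "a0 z0 \<in> W"
      using a0 b0[OF R0[of z0]] b0[OF R0[of "a0 z0"]] s by (auto simp: W_def)
    have "\<theta> z0 = id" "\<theta> (a0 z0) = a0" using a0 s by (auto simp: \<theta>_def dist_commute)
    then have e: "iv (\<theta> z0) z0 = iv (\<theta> (a0 z0)) (a0 z0)"
      using a0 Isom_inv_left[OF id_Isom, of z0] by simp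
    have "(\<lambda>w. iv (\<theta> w) w) ` W = (\<lambda>w. iv (\<theta> w) w) ` (W - {z0})"
    proof
      show "(\<lambda>w. iv (\<theta> w) w) ` W \<subseteq> (\<lambda>w. iv (\<theta> w) w) ` (W - {z0})"
      proof
        fix y assume "y \<in> (\<lambda>w. iv (\<theta> w) w) ` W"
        then obtain w where w: "w \<in> W" "y = iv (\<theta> w) w" by blast
        have "a0 z0 \<in> W - {z0}" using in0 a0 s by auto
        then show "y \<in> (\<lambda>w. iv (\<theta> w) w) ` (W - {z0})"
          using w e by (cases "w = z0") auto
      qed
    qed auto
    then have "card ((\<lambda>w. iv (\<theta> w) w) ` W) \<le> card (W - {z0})"
      using W by (simp add: card_image_le)
    also have "\<dots> < card Z" using W in0 Z by (metis card_Diff1_less card_mono order_less_le_trans)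
    finally show ?thesis by (simp add: True W_def)
  next
    case False
    have "z0 \<notin> {w \<in> Z. b w = b z}" using False b0[OF R0[of z0]] s by auto
    then have "card {w \<in> Z. b w = b z} < card Z" using Z a0 by (intro psubset_card_mono) auto
    moreover have "card ((\<lambda>w. iv (\<theta> w) w) ` {w \<in> Z. b w = b z}) \<le> card {w \<in> Z. b w = b z}"
      using Z by (intro card_image_le) auto
    ultimately show ?thesis by linarith
  qed
  moreover have "b (a z) = b z" if "a \<in> Isom" "z \<in> Z" "a z \<in> Z" for a z
  proof -
    have "R z (a z)" using that s by (auto simp: R_def intro!: bexI[of _ a])
    then show ?thesis using Rb by metis
  qed
  ultimately show ?thesis using that[of \<theta> b] \<theta> \<theta>b by blast
qed

text \<open>Let \<open>s\<close> be the diameter of \<open>Z\<close>; points of \<open>Z\<close> in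
  different open \<open>s\<close>-balls are at distance exactly \<open>s\<close>. The pullback of a
  class to its base ball has fewer points, so induction gives a finite set there, and the copies of
  it along the transports form \<open>Z'\<close>. A partial isometry induces a partial injection of
  the balls, which extends to a permutation within classes; inside the balls it acts through the
  base ball.\<close>

lemma finite_extension_property:
  assumes "finite (Z :: 'a set)"
  obtains Z' where "finite Z'" "Z \<subseteq> Z'"
    "\<And>p F. \<lbrakk>p \<in> Isom; F \<subseteq> Z; p ` F \<subseteq> Z\<rbrakk> \<Longrightarrow> \<exists>g\<in>Isom. (\<forall>x\<in>F. g x = p x) \<and> g ` Z' = Z'"
  using assms
proof (induction "card Z" arbitrary: Z thesis rule: less_induct)
  case less
  show ?case
  proof (cases "\<exists>z1\<in>Z. \<exists>z2\<in>Z. z1 \<noteq> z2")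
    case False
    have "\<exists>g\<in>Isom. (\<forall>x\<in>F. g x = p x) \<and> g ` Z = Z" if "F \<subseteq> Z" "p ` F \<subseteq> Z" for p F
      by (rule bexI[of _ id]) (use that False in auto)
    then show ?thesis using less.prems(1)[OF less.prems(2) subset_refl] by presburger
  next
    case True
    define D where "D = (\<lambda>(x, y). dist x y) ` (Z \<times> Z)"
    have finD: "finite D" using less.prems by (simp add: D_def)
    define s where "s = Max D"
    have inD: "dist x y \<in> D" if "x \<in> Z" "y \<in> Z" for x y
      using that by (force simp: D_def)
    have le_s: "dist x y \<le> s" if "x \<in> Z" "y \<in> Z" for x y
      using inD[OF that] finD by (simp add: s_def)
    have s: "s > 0" using True le_s by (metis zero_less_dist_iff order_less_le_trans)
    have "s \<in> D" unfolding s_def by (rule Max_in[OF finD]) (use True inD in blast)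
    then obtain z1 z2 where zz: "z1 \<in> Z" "z2 \<in> Z" "s \<le> dist z1 z2" by (auto simp: D_def)
    obtain \<theta> :: "'a \<Rightarrow> 'a \<Rightarrow> 'a" and b :: "'a \<Rightarrow> 'a" where \<theta>: "\<And>z. z \<in> Z \<Longrightarrow> \<theta> z \<in> Isom"
      and \<theta>b: "\<And>z. z \<in> Z \<Longrightarrow> dist (\<theta> z (b z)) z < s"
      and eqs: "\<And>z z'. \<lbrakk>z \<in> Z; z' \<in> Z; dist z z' < s\<rbrakk> \<Longrightarrow> \<theta> z = \<theta> z' \<and> b z = b z'"
      and b_inv: "\<And>a z. \<lbrakk>a \<in> Isom; z \<in> Z; a z \<in> Z\<rbrakk> \<Longrightarrow> b (a z) = b z"
      and small: "\<And>z. z \<in> Z \<Longrightarrow> card ((\<lambda>w. iv (\<theta> w) w) ` {w \<in> Z. b w = b z}) < card Z"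
      by (rule pullback_loses_points[OF less.prems(2) zz s]) (rule that)
    define P where "P \<beta> = (\<lambda>w. iv (\<theta> w) w) ` {w \<in> Z. b w = \<beta>}" for \<beta>
    have "\<exists>E. finite E \<and> P \<beta> \<subseteq> E \<and> (\<forall>p F. p \<in> Isom \<and> F \<subseteq> P \<beta> \<and> p ` F \<subseteq> P \<beta> \<longrightarrow>
        (\<exists>g\<in>Isom. (\<forall>x\<in>F. g x = p x) \<and> g ` E = E))" if "\<beta> \<in> b ` Z" for \<beta>
    proof -
      have "card (P \<beta>) < card Z" "finite (P \<beta>)" using that small less.prems by (auto simp: P_def)
      show ?thesis
        by (rule less.hyps[OF \<open>card (P \<beta>) < card Z\<close> _ \<open>finite (P \<beta>)\<close>])
          (intro exI conjI, assumption, assumption, blast)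
    qed
    then obtain E where E: "\<And>\<beta>. \<beta> \<in> b ` Z \<Longrightarrow> finite (E \<beta>) \<and> P \<beta> \<subseteq> E \<beta>"
      and Eg: "\<And>\<beta> p F. \<lbrakk>\<beta> \<in> b ` Z; p \<in> Isom; F \<subseteq> P \<beta>; p ` F \<subseteq> P \<beta>\<rbrakk> \<Longrightarrow>
        \<exists>g\<in>Isom. (\<forall>x\<in>F. g x = p x) \<and> g ` E \<beta> = E \<beta>"
      by metis
    \<comment> \<open>Cutting down to the base ball keeps every copy inside its own
      \<open>s\<close>-ball.\<close>
    define E' where "E' \<beta> = E \<beta> \<inter> ball \<beta> s" for \<beta>
    have pull: "iv (\<theta> z) z \<in> P (b z) \<and> dist (b z) (iv (\<theta> z) z) < s" if "z \<in> Z" for z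
      using that \<theta> \<theta>b by (auto simp: P_def dist_inv_right)
    have P_ball: "dist \<beta> y < s" if "y \<in> P \<beta>" for y \<beta>
      using that pull by (auto simp: P_def)
    define Z' where "Z' = (\<Union>z\<in>Z. \<theta> z ` E' (b z))"
    have near: "dist (\<theta> z y) z < s" if "z \<in> Z" "y \<in> E' (b z)" for z y
      using ultra_less[of "\<theta> z y" "\<theta> z (b z)" s z] that \<theta> \<theta>b by (auto simp: E'_def dist_commute)
    have finZ': "finite Z'" using less.prems E by (auto simp: Z'_def E'_def)
    have ZZ': "Z \<subseteq> Z'"
    proof
      fix z assume z: "z \<in> Z"
      then have "iv (\<theta> z) z \<in> E' (b z)" using pull[OF z] E[of "b z"] by (auto simp: E'_def)
      moreover have "\<theta> z (iv (\<theta> z) z) = z" using \<theta>[OF z] by simp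
      ultimately show "z \<in> Z'" using z unfolding Z'_def by (metis UN_I imageI)
    qed
    define \<rho> where "\<rho> x = (SOME w. w \<in> Z \<and> dist w x < s)" for x
    have \<rho>: "\<rho> x \<in> Z \<and> dist (\<rho> x) x < s" if "z \<in> Z" "dist z x < s" for x z
      unfolding \<rho>_def by (rule someI[of _ z]) (use that in auto)
    have \<rho>eq: "\<rho> x = \<rho> y" if "dist x y < s" for x y
    proof -
      have "(\<lambda>w. w \<in> Z \<and> dist w x < s) = (\<lambda>w. w \<in> Z \<and> dist w y < s)"
        using that ultra_less[of _ x s y] ultra_less[of _ y s x] by (auto simp: fun_eq_iff dist_commute)
      then show ?thesis by (simp add: \<rho>_def)
    qed
    have \<rho>Z: "\<rho> z \<in> Z" "dist (\<rho> z) z < s" if "z \<in> Z" for z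
      using \<rho>[of z z] that s by auto
    have \<rho>Z': "\<rho> x \<in> \<rho> ` Z \<and> \<rho> x \<in> Z \<and> dist (\<rho> x) x < s \<and> iv (\<theta> (\<rho> x)) x \<in> E' (b (\<rho> x))" if "x \<in> Z'" for x
    proof -
      obtain z y where z: "z \<in> Z" "y \<in> E' (b z)" "x = \<theta> z y" using \<open>x \<in> Z'\<close> by (auto simp: Z'_def)
      then have d: "dist z x < s" using near by (simp add: dist_commute)
      then have r: "\<rho> x = \<rho> z" using \<rho>eq by (metis dist_commute)
      then have "\<theta> (\<rho> x) = \<theta> z \<and> b (\<rho> x) = b z" using eqs \<rho>Z z by metis
      then show ?thesis using r z d \<rho>[OF z(1) d] \<theta> by auto
    qed
    have \<rho>sep: "dist x y = s" if "x \<in> \<rho> ` Z" "y \<in> \<rho> ` Z" "x \<noteq> y" for x y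
    proof -
      obtain u v where u: "u \<in> Z" "v \<in> Z" "x = \<rho> u" "y = \<rho> v"
        using \<open>x \<in> \<rho> ` Z\<close> \<open>y \<in> \<rho> ` Z\<close> by blast
      have "\<rho> x = x" "\<rho> y = y" using u \<rho>eq \<rho>Z by metis+
      then have "\<not> dist x y < s" using that \<rho>eq by metis
      then show ?thesis using le_s[of x y] u \<rho>Z by force
    qed
    have ext: "\<exists>g\<in>Isom. (\<forall>x\<in>F. g x = p x) \<and> g ` Z' = Z'" if p: "p \<in> Isom" "F \<subseteq> Z" "p ` F \<subseteq> Z" for p F
    proof -
      have pZ: "f \<in> Z" "p f \<in> Z" if "f \<in> F" for f using that p by auto
      define j where "j r = \<rho> (p (SOME f. f \<in> F \<and> \<rho> f = r))" for r
      have j: "j (\<rho> f) = \<rho> (p f)" if f: "f \<in> F" for f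
      proof -
        define f' where "f' = (SOME f'. f' \<in> F \<and> \<rho> f' = \<rho> f)"
        have f': "f' \<in> F \<and> \<rho> f' = \<rho> f" unfolding f'_def by (rule someI[of _ f]) (use f in auto)
        then have "dist f' f < s"
          using \<rho>Z(2)[of f] \<rho>Z(2)[of f'] pZ f ultra_less[of f' "\<rho> f" s f] by (auto simp: dist_commute)
        then have "\<rho> (p f') = \<rho> (p f)" using p by (intro \<rho>eq) auto
        then show ?thesis by (simp add: j_def f'_def)
      qed
      have jinj: "inj_on j (\<rho> ` F)"
      proof (rule inj_onI)
        fix x y assume "x \<in> \<rho> ` F" "y \<in> \<rho> ` F" "j x = j y"
        then obtain f f' where f: "f \<in> F" "f' \<in> F" "x = \<rho> f" "y = \<rho> f'" "\<rho> (p f) = \<rho> (p f')" using j by auto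
        then have "dist (p f) (p f') < s"
          using \<rho>Z(2)[of "p f"] \<rho>Z(2)[of "p f'"] pZ ultra_less[of "p f" "\<rho> (p f)" s "p f'"] by (auto simp: dist_commute)
        then show "x = y" using f p \<rho>eq by auto
      qed
      have jb: "b (j x) = b x" if "x \<in> \<rho> ` F" for x
      proof -
        obtain f where f: "f \<in> F" "x = \<rho> f" using \<open>x \<in> \<rho> ` F\<close> by blast
        have "b (\<rho> (p f)) = b (p f)" "b (\<rho> f) = b f" using eqs \<rho>Z pZ f by blast+
        then show ?thesis using b_inv[of p f] f p pZ j by simp
      qed
      have fin\<rho>: "finite (\<rho> ` Z)" using less.prems by simp
      have sub\<rho>: "\<rho> ` F \<subseteq> \<rho> ` Z" using p by blast
      have j\<rho>: "j ` \<rho> ` F \<subseteq> \<rho> ` Z" using j pZ by auto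
      \<comment> \<open>Balls are permuted within their classes, so that a ball and its image share
        the base point and carry copies of the same \<open>E'\<close>.\<close>
      obtain \<pi> where \<pi>: "bij_betw \<pi> (\<rho> ` Z) (\<rho> ` Z)" "\<And>x. x \<in> \<rho> ` F \<Longrightarrow> \<pi> x = j x"
        "\<And>x. x \<in> \<rho> ` Z \<Longrightarrow> b (\<pi> x) = b x"
        by (rule extend_partial_permutation[where c = b, OF fin\<rho> sub\<rho> jinj j\<rho>]) (rule jb, assumption, rule that)
      have \<pi>Z: "\<pi> r \<in> \<rho> ` Z" "\<pi> r \<in> Z" if "r \<in> \<rho> ` Z" for r
      proof -
        show "\<pi> r \<in> \<rho> ` Z" by (rule bij_betw_apply[OF \<pi>(1) that])
        then show "\<pi> r \<in> Z" using \<rho>Z(1) by auto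
      qed
      have "\<exists>h. h \<in> Isom \<and> h ` E' (b r) = E' (b r) \<and>
          (\<forall>f\<in>F. \<rho> f = r \<longrightarrow> \<theta> (\<pi> r) (h (iv (\<theta> r) f)) = p f)" if r: "r \<in> \<rho> ` Z" for r
      proof (cases "\<exists>f\<in>F. \<rho> f = r")
        case False
        then show ?thesis by (intro exI[of _ id]) auto
      next
        case True
        then obtain f0 where f0: "f0 \<in> F" "\<rho> f0 = r" by blast
        define G where "G = iv (\<theta> r) ` {f \<in> F. \<rho> f = r}"
        \<comment> \<open>The action of \<open>p\<close> on the ball of \<open>r\<close>, read in
          the base ball.\<close>
        define q where "q = iv (\<theta> (\<pi> r)) \<circ> p \<circ> \<theta> r"
        have rZ: "r \<in> Z" using r \<rho>Z by blast
        have q: "q \<in> Isom" using \<theta> rZ \<pi>Z[OF r] p by (simp add: q_def)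
        have f1: "\<theta> f = \<theta> r \<and> b f = b r \<and> \<theta> (p f) = \<theta> (\<pi> r) \<and> b (p f) = b r" if "f \<in> F" "\<rho> f = r" for f
        proof -
          have "\<pi> r = \<rho> (p f)" using \<pi>(2)[of r] j that by auto
          then have "\<theta> (p f) = \<theta> (\<pi> r) \<and> b (p f) = b (\<pi> r)" "\<theta> f = \<theta> r \<and> b f = b r"
            using eqs \<rho>Z pZ that by metis+
          then show ?thesis using \<pi>(3)[OF r] by simp
        qed
        have GP: "iv (\<theta> r) f \<in> P (b r)" "q (iv (\<theta> r) f) \<in> P (b r)" if "f \<in> F" "\<rho> f = r" for f
        proof -
          show "iv (\<theta> r) f \<in> P (b r)" using pull[of f] f1[OF that] pZ that by auto
          show "q (iv (\<theta> r) f) \<in> P (b r)" using pull[of "p f"] f1[OF that] pZ that \<theta>[OF rZ] by (auto simp: q_def)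
        qed
        obtain h where h: "h \<in> Isom" "\<forall>x\<in>G. h x = q x" "h ` E (b r) = E (b r)"
          using Eg[of "b r" q G] q GP rZ by (auto simp: G_def image_subset_iff)
        have hf: "h (iv (\<theta> r) f) = q (iv (\<theta> r) f)" if "f \<in> F" "\<rho> f = r" for f
          using h(2) that by (auto simp: G_def)
        \<comment> \<open>\<open>h\<close> takes one point of the base ball, the pullback of
          \<open>f0\<close>, into the base ball; so it preserves the ball.\<close>
        have "dist (h (b r)) (b r) < s"
        proof -
          have "dist (h (b r)) (h (iv (\<theta> r) f0)) < s" using P_ball[OF GP(1)[OF f0]] h by simp
          moreover have "dist (h (iv (\<theta> r) f0)) (b r) < s"
            using P_ball[OF GP(2)[OF f0]] hf[OF f0] by (simp add: dist_commute)
          ultimately show ?thesis by (rule ultra_less)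
        qed
        then have "ball (h (b r)) s = ball (b r) s"
          using ultra_less[of "b r" "h (b r)" s] ultra_less[of "h (b r)" "b r" s] by (auto simp: dist_commute)
        then have "h ` ball (b r) s = ball (b r) s" using h(1) by (simp add: image_ball_Isom)
        then have "h ` E' (b r) = E' (b r)"
          unfolding E'_def using h(3) by (simp add: image_Int[OF bij_is_inj[OF bij_Isom[OF h(1)]]])
        moreover have "\<theta> (\<pi> r) (h (iv (\<theta> r) f)) = p f" if "f \<in> F" "\<rho> f = r" for f
          using hf[OF that] \<theta>[OF rZ] \<theta>[OF \<pi>Z(2)[OF r]] by (simp add: q_def)
        ultimately show ?thesis using h(1) by blast
      qed
      then obtain h where h: "\<And>r. r \<in> \<rho> ` Z \<Longrightarrow> h r \<in> Isom" "\<And>r. r \<in> \<rho> ` Z \<Longrightarrow> h r ` E' (b r) = E' (b r)"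
        "\<And>r f. \<lbrakk>r \<in> \<rho> ` Z; f \<in> F; \<rho> f = r\<rbrakk> \<Longrightarrow> \<theta> (\<pi> r) (h r (iv (\<theta> r) f)) = p f"
        by metis
      \<comment> \<open>Pull back to the base ball, apply the isometry found there, push forward to
        the ball given by \<open>\<pi>\<close>. Within a ball this is a single isometry; between
        different balls all distances are \<open>s\<close> before and after.\<close>
      define M where "M x = \<theta> (\<pi> (\<rho> x)) \<circ> h (\<rho> x) \<circ> iv (\<theta> (\<rho> x))" for x
      have M: "M x \<in> Isom" "M x x \<in> \<theta> (\<pi> (\<rho> x)) ` E' (b (\<pi> (\<rho> x)))" "M x x \<in> Z'"
        "dist (M x x) (\<pi> (\<rho> x)) < s" if "x \<in> Z'" for x
      proof -
        note r = \<rho>Z'[OF that]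
        show "M x \<in> Isom" using r \<pi>Z[of "\<rho> x"] \<theta> h(1) by (auto simp: M_def)
        have "h (\<rho> x) (iv (\<theta> (\<rho> x)) x) \<in> E' (b (\<pi> (\<rho> x)))"
          using r h(2)[of "\<rho> x"] \<pi>(3)[of "\<rho> x"] by auto
        then show *: "M x x \<in> \<theta> (\<pi> (\<rho> x)) ` E' (b (\<pi> (\<rho> x)))" by (auto simp: M_def)
        then show "M x x \<in> Z'" "dist (M x x) (\<pi> (\<rho> x)) < s"
          using \<pi>Z[of "\<rho> x"] r near by (auto simp: Z'_def)
      qed
      have dM: "dist (M x x) (M y y) = dist x y" if "x \<in> Z'" "y \<in> Z'" for x y
      proof (cases "\<rho> x = \<rho> y")
        case True
        then have "M x = M y" by (simp add: M_def)
        then show ?thesis using M that by simp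
      next
        case False
        note r = \<rho>Z'[OF that(1)] \<rho>Z'[OF that(2)]
        have "dist (\<rho> x) (\<rho> y) = s" using r False \<rho>sep by blast
        then have 1: "dist x y = s" using ultra_eq2[of "\<rho> x" x s "\<rho> y" y] r by simp
        have neq: "\<pi> (\<rho> x) \<noteq> \<pi> (\<rho> y)"
          using False inj_onD[OF bij_betw_imp_inj_on[OF \<pi>(1)] _ conjunct1[OF r(1)] conjunct1[OF r(2)]] by blast
        have "dist (\<pi> (\<rho> x)) (\<pi> (\<rho> y)) = s"
          by (rule \<rho>sep[OF \<pi>Z(1)[OF conjunct1[OF r(1)]] \<pi>Z(1)[OF conjunct1[OF r(2)]] neq])
        then show ?thesis
          using 1 ultra_eq2[of "\<pi> (\<rho> x)" "M x x" s "\<pi> (\<rho> y)" "M y y"] M(4)[OF that(1)] M(4)[OF that(2)]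
          by (simp add: dist_commute)
      qed
      obtain g where g: "g \<in> Isom" "\<And>x m. (x, m) \<in> (\<lambda>x. (x, M x)) ` Z' \<Longrightarrow> g x = m x"
        by (rule extend_Isom[of "(\<lambda>x. (x, M x)) ` Z'"]) (use finZ' M(1) dM in \<open>auto simp del: dist_Isom\<close>)
      have gM: "g x = M x x" if "x \<in> Z'" for x using g(2)[of x "M x"] that by blast
      have "g ` Z' \<subseteq> Z'" using gM M by auto
      moreover have "inj_on g Z'" using g(1) by (auto simp: inj_on_def inj_Isom)
      ultimately have "g ` Z' = Z'" using finZ' by (simp add: endo_inj_surj)
      moreover have "g f = p f" if f: "f \<in> F" for f
        using gM[of f] ZZ' pZ[OF f] h(3)[of "\<rho> f" f] f by (auto simp: M_def)
      ultimately show ?thesis using g(1) by blast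
    qed
    show ?thesis by (rule less.prems(1)[OF finZ' ZZ' ext])
  qed
qed

end

section \<open>Stabilizers of finite families of balls\<close>

text \<open>A finite family of balls is represented by the set of its pairs of center and radius.\<close>

definition bfam :: "('a \<times> real) set \<Rightarrow> bool" where
  "bfam P \<longleftrightarrow> finite P \<and> (\<forall>(x, r)\<in>P. 0 < r)"

definition stab :: "('a::metric_space \<times> real) set \<Rightarrow> ('a \<Rightarrow> 'a) set" where
  "stab P = {g \<in> Isom. \<forall>(x, r)\<in>P. dist (g x) x < r}"

definition fixes_ball :: "('a::metric_space \<Rightarrow> 'a) set \<Rightarrow> 'a \<Rightarrow> real \<Rightarrow> bool" where
  "fixes_ball H x r \<longleftrightarrow> (\<forall>g\<in>H. dist (g x) x < r)"

text \<open>Both halves of the extremality property, in terms of the center \<open>x\<close>: for a group \<open>H\<close> of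
  isometries of an ultrametric space, the orbit of the ball of radius \<open>r\<close> around \<open>x\<close> is infinite
  iff no finite set of balls of radius \<open>r\<close> covers the orbit of \<open>x\<close>.\<close>

definition finite_orbit :: "('a::metric_space \<Rightarrow> 'a) set \<Rightarrow> 'a \<Rightarrow> real \<Rightarrow> bool" where
  "finite_orbit H x r \<longleftrightarrow> (\<exists>W. finite W \<and> (\<forall>g\<in>H. \<exists>w\<in>W. dist (g x) w < r))"

definition extr :: "('a::metric_space \<Rightarrow> 'a) set \<Rightarrow> bool" where
  "extr H \<longleftrightarrow> (\<forall>x r. 0 < r \<and> finite_orbit H x r \<longrightarrow> fixes_ball H x r)"

lemma stab_Isom: "g \<in> stab P \<Longrightarrow> g \<in> Isom"
  by (simp add: stab_def)

lemma stab_dist: "g \<in> stab P \<Longrightarrow> (x, r) \<in> P \<Longrightarrow> dist (g x) x < r"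
  by (auto simp: stab_def)

lemma stabI: "g \<in> Isom \<Longrightarrow> (\<And>x r. (x, r) \<in> P \<Longrightarrow> dist (g x) x < r) \<Longrightarrow> g \<in> stab P"
  by (auto simp: stab_def)

lemma stab_id: "bfam P \<Longrightarrow> id \<in> stab P"
  by (auto simp: bfam_def stab_def)

lemma stab_inv: "g \<in> stab P \<Longrightarrow> iv g \<in> stab P"
  by (rule stabI) (simp add: stab_Isom, metis dist_inv_left stab_Isom stab_dist dist_commute)

lemma stab_Un: "stab (P \<union> Q) = stab P \<inter> stab Q"
  by (auto simp: stab_def)

lemma stab_antimono: "P \<subseteq> Q \<Longrightarrow> stab Q \<subseteq> stab P"
  by (auto simp: stab_def)

lemma bfam_Un: "bfam P \<Longrightarrow> bfam Q \<Longrightarrow> bfam (P \<union> Q)"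
  by (auto simp: bfam_def)

lemma extr_cases:
  assumes "extr H" "0 < r" "finite W"
  obtains "fixes_ball H x r" | g where "g \<in> H" "\<And>w. w \<in> W \<Longrightarrow> r \<le> dist (g x) w"
  using assms unfolding extr_def finite_orbit_def by (meson not_le)

definition normalizes :: "('a \<Rightarrow> 'a) \<Rightarrow> ('a \<Rightarrow> 'a) set \<Rightarrow> bool" where
  "normalizes a H \<longleftrightarrow> (\<forall>g\<in>H. a \<circ> g \<circ> iv a \<in> H \<and> iv a \<circ> g \<circ> a \<in> H)"

context ultrametric_type
begin

lemma stab_comp:
  assumes "g \<in> stab (P :: ('a \<times> real) set)" "h \<in> stab P"
  shows "g \<circ> h \<in> stab P"
proof (rule stabI)
  show "g \<circ> h \<in> Isom" using assms by (simp add: stab_Isom)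
  show "dist ((g \<circ> h) x) x < r" if "(x, r) \<in> P" for x r
    using ultra_less[of "g (h x)" "g x" r x] stab_dist[OF assms(1) that] stab_dist[OF assms(2) that]
    by (simp add: stab_Isom[OF assms(1)])
qed

lemma fixes_ball_cong: "dist (x::'a) y < r \<Longrightarrow> H \<subseteq> Isom \<Longrightarrow> fixes_ball H x r \<longleftrightarrow> fixes_ball H y r"
proof -
  have "fixes_ball H y r" if d: "dist x y < r" and H: "H \<subseteq> Isom" and f: "fixes_ball H x r" for x y
    unfolding fixes_ball_def
  proof
    fix g assume g: "g \<in> H"
    then have "dist (g y) (g x) < r" "dist (g x) x < r"
      using d H f by (auto simp: fixes_ball_def dist_commute)
    then have "dist (g y) x < r" by (rule ultra_less)
    then show "dist (g y) y < r" using d by (rule ultra_less)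
  qed
  from this[of x y] this[of y x] show "dist x y < r \<Longrightarrow> H \<subseteq> Isom \<Longrightarrow> ?thesis"
    by (auto simp: dist_commute)
qed

lemma fixes_ball_normalizes:
  assumes a: "a \<in> Isom" "normalizes a H" and H: "H \<subseteq> Isom" and f: "fixes_ball H x r"
  shows "fixes_ball H (a x) r"
  unfolding fixes_ball_def
proof
  fix g assume "g \<in> H"
  then have "iv a \<circ> g \<circ> a \<in> H" using a by (simp add: normalizes_def)
  then have "dist ((iv a \<circ> g \<circ> a) x) x < r" using f unfolding fixes_ball_def by blast
  then show "dist (g (a x)) (a x) < r" using a by (simp add: dist_inv_left)
qed

subsection \<open>Unions of extremal families\<close>

text \<open>A finite orbit of a ball that is not invariant is refuted by an element of
  \<open>stab Q\<close> that carries \<open>x\<close> away from the finite set covering the orbit.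
  It is found in some \<open>stab (A p)\<close> and then localized near \<open>x\<close> so that it
  respects all of \<open>Q\<close>.\<close>

lemma extr_Union:
  assumes Q: "bfam (Q :: ('a \<times> real) set)" "Q \<noteq> {}"
    and A: "\<And>p. p \<in> Q \<Longrightarrow> p \<in> A p \<and> A p \<subseteq> Q \<and> extr (stab (A p))"
  shows "extr (stab Q)"
  unfolding extr_def
proof (intro allI impI, elim conjE, rule ccontr)
  fix x :: 'a and r :: real
  assume r: "0 < r" and fo: "finite_orbit (stab Q) x r" and nf: "\<not> fixes_ball (stab Q) x r"
  define \<delta> where "\<delta> = (\<lambda>(a, \<rho>). max (dist x a) \<rho>)"
  have finQ: "finite Q" using Q by (simp add: bfam_def)
  \<comment> \<open>A ball of \<open>Q\<close> centered closer than \<open>t\<close> to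
    \<open>x\<close> has radius at least \<open>t\<close>; so \<open>Q\<close> imposes nothing below
    this scale.\<close>
  define t where "t = Min (\<delta> ` Q)"
  have t_le: "t \<le> max (dist x a) \<rho>" if "(a, \<rho>) \<in> Q" for a \<rho>
  proof -
    have "t \<le> \<delta> (a, \<rho>)" unfolding t_def using that finQ by (intro Min_le) auto
    then show ?thesis by (simp add: \<delta>_def)
  qed
  have "t \<in> \<delta> ` Q" unfolding t_def using Q finQ by (intro Min_in) auto
  then obtain p0 where p0: "p0 \<in> Q" "\<delta> p0 = t" by auto
  have stab_sub: "stab Q \<subseteq> stab (A p)" if "p \<in> Q" for p
    using A[OF that] by (intro stab_antimono) auto
  \<comment> \<open>Otherwise the ball \<open>p0\<close> would lie inside the \<open>r\<close>-ball
    of \<open>x\<close>, which would then be invariant as well.\<close>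
  have rt: "r \<le> t"
  proof (rule ccontr)
    assume "\<not> r \<le> t"
    obtain a \<rho> where a: "p0 = (a, \<rho>)" by fastforce
    then have d: "dist x a < r" "\<rho> < r" using p0 \<open>\<not> r \<le> t\<close> by (auto simp: \<delta>_def)
    have "fixes_ball (stab Q) a r"
      unfolding fixes_ball_def using stab_dist[of _ Q a \<rho>] p0 a d by fastforce
    then show False using nf fixes_ball_cong[of a x r "stab Q"] d stab_Isom by (auto simp: dist_commute)
  qed
  have t: "t > 0" using rt r by simp
  show False
  proof (cases "\<exists>p\<in>Q. fixes_ball (stab (A p)) x t")
    \<comment> \<open>The elements of \<open>stab (A p)\<close> can be restricted to the
      \<open>t\<close>-ball of \<open>x\<close>, and the restrictions respect \<open>Q\<close> by
      the choice of \<open>t\<close>.\<close>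
    case True
    then obtain p where p: "p \<in> Q" "fixes_ball (stab (A p)) x t" by blast
    obtain W where W: "finite W" "\<And>g. g \<in> stab Q \<Longrightarrow> \<exists>w\<in>W. dist (g x) w < r"
      using fo by (auto simp: finite_orbit_def)
    consider "fixes_ball (stab (A p)) x r" | g where "g \<in> stab (A p)" "\<And>w. w \<in> W \<Longrightarrow> r \<le> dist (g x) w"
      using extr_cases[of "stab (A p)" r W x] A[OF p(1)] r W(1) by blast
    then show False
    proof cases
      case 1
      then show False using nf stab_sub[OF p(1)] by (auto simp: fixes_ball_def)
    next
      case 2
      have d: "dist x (g x) < t" using p 2 by (auto simp: fixes_ball_def dist_commute)
      obtain f where f: "f \<in> Isom" "\<And>y. dist x y < t \<Longrightarrow> f y = g y" "\<And>y. t \<le> dist x y \<Longrightarrow> f y = y"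
        using ball_restrict[OF stab_Isom[OF 2(1)] d] by blast
      have "f \<in> stab Q"
      proof (rule stabI[OF f(1)])
        fix b \<sigma> assume b: "(b, \<sigma>) \<in> Q"
        then have \<sigma>: "0 < \<sigma>" using Q by (auto simp: bfam_def)
        show "dist (f b) b < \<sigma>"
        proof (cases "dist x b < t")
          case True
          then have "t \<le> \<sigma>" using t_le[OF b] by auto
          moreover have "dist (g b) b < t"
            using fixes_ball_cong[OF True, of "stab (A p)"] p 2 stab_Isom by (auto simp: fixes_ball_def)
          ultimately show ?thesis using f(2)[OF True] by simp
        next
          case False
          then show ?thesis using f(3) \<sigma> by simp
        qed
      qed
      then show False using W(2)[of f] f(2)[of x] t 2(2) by fastforce
    qed
  next
    \<comment> \<open>An element of \<open>stab (A p0)\<close> moves \<open>x\<close> by at least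
      \<open>t\<close>, and by exactly \<open>t\<close> because \<open>p0\<close> attains the
      minimum. The swap of the two \<open>t\<close>-balls is the element wanted.\<close>
    case False
    obtain a \<rho> where a: "p0 = (a, \<rho>)" by fastforce
    obtain W where W: "finite W" "\<And>g. g \<in> stab Q \<Longrightarrow> \<exists>w\<in>W. dist (g x) w < r"
      using fo by (auto simp: finite_orbit_def)
    define W' where "W' = insert x (W \<union> fst ` Q)"
    have W': "finite W'" using W finQ by (simp add: W'_def)
    obtain g where g: "g \<in> stab (A p0)" "\<And>w. w \<in> W' \<Longrightarrow> t \<le> dist (g x) w"
      using extr_cases[of "stab (A p0)" t W' x] A[OF p0(1)] t W' False p0(1) by blast
    have ga: "dist (g a) a < \<rho>" using stab_dist[OF g(1)] A[OF p0(1)] a by simp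
    have gI: "g \<in> Isom" using g(1) by (rule stab_Isom)
    have at: "dist x a \<le> t" "\<rho> \<le> t" using p0(2) a by (auto simp: \<delta>_def)
    have gxa: "dist (g x) a \<le> t"
      using ultra_leI[of "g x" "g a" t a] gI at ga by simp
    have e: "dist x (g x) = t"
      using g(2)[of x] ultra_leI[of x a t "g x"] at gxa by (auto simp: W'_def dist_commute)
    obtain f where f: "f \<in> Isom" "\<And>y. dist x y < t \<Longrightarrow> f y = g y"
      "\<And>y. dist (g x) y < t \<Longrightarrow> f y = iv g y" "\<And>y. t \<le> dist x y \<Longrightarrow> t \<le> dist (g x) y \<Longrightarrow> f y = y"
      using ball_swap[OF gI e[symmetric]] by blast
    have "f \<in> stab Q"
    proof (rule stabI[OF f(1)])
      fix b \<sigma> assume b: "(b, \<sigma>) \<in> Q"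
      then have \<sigma>: "0 < \<sigma>" using Q by (auto simp: bfam_def)
      have gb: "t \<le> dist (g x) b" using g(2)[of b] b by (force simp: W'_def)
      show "dist (f b) b < \<sigma>"
      proof (cases "dist x b < t")
        case True
        \<comment> \<open>A ball of \<open>Q\<close> of radius \<open>t\<close> around
          \<open>b\<close> would be the \<open>t\<close>-ball of \<open>x\<close>, fixed by its own
          subfamily. So \<open>\<sigma>\<close> exceeds \<open>t\<close>, while \<open>b\<close> is
          moved by at most \<open>t\<close>.\<close>
        have "\<sigma> \<noteq> t"
        proof
          assume "\<sigma> = t"
          have "fixes_ball (stab (A (b, \<sigma>))) b t"
            unfolding fixes_ball_def using stab_dist[of _ "A (b, \<sigma>)" b \<sigma>] A[OF b] \<open>\<sigma> = t\<close> by blast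
          then have "fixes_ball (stab (A (b, \<sigma>))) x t"
            using fixes_ball_cong[of b x t "stab (A (b, \<sigma>))"] True stab_Isom by (auto simp: dist_commute)
          then show False using False b by blast
        qed
        then have "t < \<sigma>" using t_le[OF b] True by auto
        moreover have "dist (g b) b \<le> t"
          using ultra_leI[of "g b" "g x" t b] ultra_leI[of "g x" x t b] True e gI by (simp add: dist_commute)
        ultimately show ?thesis using f(2)[OF True] by simp
      next
        case False
        then show ?thesis using f(4)[of b] gb \<sigma> by simp
      qed
    qed
    then show False using W(2)[of f] f(2)[of x] t g(2) rt by (fastforce simp: W'_def)
  qed
qed

end

section \<open>Amalgamation over an extremal family\<close>

text \<open>No invariant ball of \<open>H\<close> contains exactly one of the two points.\<close>

definition unsep :: "('a::metric_space \<Rightarrow> 'a) set \<Rightarrow> 'a \<Rightarrow> 'a \<Rightarrow> bool" where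
  "unsep H x y \<longleftrightarrow> (\<forall>r>0. fixes_ball H x r \<or> fixes_ball H y r \<longrightarrow> dist x y < r)"

lemma unsep_refl [simp]: "unsep H x x"
  by (simp add: unsep_def)

lemma unsep_sym: "unsep H x y \<Longrightarrow> unsep H y x"
  by (auto simp: unsep_def dist_commute)

lemma normalizes_iv: "a \<in> Isom \<Longrightarrow> normalizes a H \<Longrightarrow> normalizes (iv a) H"
  by (simp add: normalizes_def)

lemma stab_subset_Isom: "stab Q \<subseteq> Isom"
  using stab_Isom by blast

context ultrametric_type
begin

lemma unsep_fixes: "unsep H (x::'a) y \<Longrightarrow> 0 < r \<Longrightarrow> H \<subseteq> Isom \<Longrightarrow> fixes_ball H x r \<longleftrightarrow> fixes_ball H y r"
  unfolding unsep_def using fixes_ball_cong[of x y r H] by blast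

lemma unsep_trans: "unsep H (x::'a) y \<Longrightarrow> unsep H y z \<Longrightarrow> H \<subseteq> Isom \<Longrightarrow> unsep H x z"
  using unsep_fixes[of H x y] unsep_fixes[of H y z] ultra_less[of x y _ z]
  unfolding unsep_def by metis

lemma unsep_stab: "u \<in> stab Q \<Longrightarrow> unsep (stab Q) y (u (y::'a))"
  using stab_inv[of u Q] stab_Isom[of u Q]
  unfolding unsep_def fixes_ball_def by (metis dist_commute Isom_inv_left)

lemma unsep_normalizes:
  assumes a: "a \<in> Isom" "normalizes a H" and H: "H \<subseteq> Isom" and xy: "unsep H (x::'a) y"
  shows "unsep H (a x) (a y)"
proof -
  have "fixes_ball H (a z) r \<Longrightarrow> fixes_ball H z r" for z r
    using fixes_ball_normalizes[OF inv_Isom[OF a(1)] normalizes_iv[OF a] H, of "a z" r] a by simp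
  then show ?thesis using xy a by (simp add: unsep_def)
qed

text \<open>An invariant ball around one of the points misses the other, and moving a point within a
  ball does not change its distance to a point outside.\<close>

lemma dist_separated:
  assumes xy: "\<not> unsep (stab Q) (x::'a) y" and g: "g \<in> stab Q" "h \<in> stab Q"
  shows "dist (g x) (h y) = dist x y"
proof -
  define k where "k = iv g \<circ> h"
  have k: "k \<in> stab Q" unfolding k_def by (intro stab_comp stab_inv g)
  have gI: "g \<in> Isom" using g by (simp add: stab_Isom)
  have e: "dist (g x) (h y) = dist x (k y)" using gI by (simp add: k_def dist_inv_right)
  obtain r where r: "fixes_ball (stab Q) x r \<or> fixes_ball (stab Q) y r" "r \<le> dist x y"
    using xy unfolding unsep_def by (metis not_le)
  show ?thesis
  proof (cases "fixes_ball (stab Q) x r")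
    case True
    then have "dist (iv k x) x < r" using stab_inv[OF k] by (simp add: fixes_ball_def)
    then have "dist (iv k x) y = dist x y" using r ultra_eq[of "iv k x" x y] by simp
    then show ?thesis using e stab_Isom[OF k] by (simp add: dist_inv_left)
  next
    case False
    then have "fixes_ball (stab Q) y r" using r by blast
    then have "dist (k y) y < r" using k by (simp add: fixes_ball_def)
    then show ?thesis using e r ultra_eq[of "k y" y x] by (simp add: dist_commute)
  qed
qed

text \<open>At each center of \<open>P\<close> the swap agrees with \<open>m\<close>, its inverse or
  the identity, and all three preserve the balls of \<open>P\<close>.\<close>

lemma swap_in_stab:
  assumes m: "m \<in> stab P" and e: "e = dist (x::'a) (m x)" and P: "bfam P"
  obtains f where "f \<in> stab P" "\<And>y. dist x y < e \<Longrightarrow> f y = m y"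
    "\<And>y. dist (m x) y < e \<Longrightarrow> f y = iv m y"
    "\<And>y. e \<le> dist x y \<Longrightarrow> e \<le> dist (m x) y \<Longrightarrow> f y = y"
proof -
  have mI: "m \<in> Isom" using m by (rule stab_Isom)
  obtain f where f: "f \<in> Isom" "\<And>y. dist x y < e \<Longrightarrow> f y = m y"
    "\<And>y. dist (m x) y < e \<Longrightarrow> f y = iv m y"
    "\<And>y. e \<le> dist x y \<Longrightarrow> e \<le> dist (m x) y \<Longrightarrow> f y = y"
    using ball_swap[OF mI e] by blast
  have "f \<in> stab P"
  proof (rule stabI[OF f(1)])
    fix q \<rho> assume q: "(q, \<rho>) \<in> P"
    then have "\<rho> > 0" using P by (auto simp: bfam_def)
    then show "dist (f q) q < \<rho>"
      using stab_dist[OF m q] stab_dist[OF stab_inv[OF m] q] f(2)[of q] f(3)[of q] f(4)[of q]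
      by (metis dist_self not_le)
  qed
  then show ?thesis using that f by blast
qed

text \<open>For a single class this is Neumann's lemma: a group all of whose orbits are infinite moves
  every finite set off itself.\<close>

lemma move_class_apart:
  assumes Q: "bfam Q" "extr (stab Q)" and W: "finite (W :: 'a set)"
    and un: "\<And>x y. x \<in> W \<Longrightarrow> y \<in> W \<Longrightarrow> unsep (stab Q) x y"
  obtains v c where "v \<in> stab Q" "\<And>x y. x \<in> W \<Longrightarrow> y \<in> W \<Longrightarrow> dist x (v y) = c"
proof (cases "\<exists>w\<in>W. \<exists>u>0. \<not> fixes_ball (stab Q) w u")
  \<comment> \<open>All balls around points of \<open>W\<close> are invariant, so unseparated points
    coincide and \<open>W\<close> has at most one element.\<close>
  case False
  then have "dist x y < u" if "x \<in> W" "y \<in> W" "u > 0" for x y u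
    using un[OF that(1,2)] that by (auto simp: unsep_def)
  then have "dist x y = 0" if "x \<in> W" "y \<in> W" for x y
    using that by (metis less_irrefl zero_less_dist_iff dist_eq_0_iff)
  then show ?thesis using that[of id 0] stab_id[OF Q(1)] by simp
next
  case True
  then obtain w0 u0 where w0: "w0 \<in> W" "u0 > 0" "\<not> fixes_ball (stab Q) w0 u0" by blast
  define H where "H = stab Q"
  have H: "H \<subseteq> Isom" by (simp add: H_def stab_subset_Isom)
  define D where "D = (\<lambda>(x, y). dist x y) ` (W \<times> W)"
  have D: "finite D" "dist w0 w0 \<in> D" using W w0 by (auto simp: D_def image_iff)
  have leM: "dist x y \<le> Max D" if "x \<in> W" "y \<in> W" for x y
    using that D by (intro Max_ge) (auto simp: D_def image_iff)
  \<comment> \<open>A bound for the distances in \<open>W\<close> at which no ball around a point of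
    \<open>W\<close> is invariant: the diameter if it is positive, because two points at that
    distance are unseparated, and otherwise \<open>u0\<close>.\<close>
  obtain u where u: "u > 0" "\<And>x. x \<in> W \<Longrightarrow> \<not> fixes_ball H x u" "\<And>x y. x \<in> W \<Longrightarrow> y \<in> W \<Longrightarrow> dist x y \<le> u"
  proof (cases "Max D > 0")
    case True
    have "Max D \<in> D" using D by (intro Max_in) auto
    then obtain x0 y0 where xy: "x0 \<in> W" "y0 \<in> W" "dist x0 y0 = Max D" by (auto simp: D_def)
    have "\<not> fixes_ball H x (Max D)" if "x \<in> W" for x
    proof
      assume "fixes_ball H x (Max D)"
      then have "fixes_ball H x0 (Max D)"
        using unsep_fixes[OF un[OF that xy(1)] True stab_subset_Isom] by (simp add: H_def)
      then show False using un[OF xy(1,2)] xy True by (auto simp: unsep_def H_def)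
    qed
    then show ?thesis using that True leM by blast
  next
    case False
    have "\<not> fixes_ball H x u0" if "x \<in> W" for x
      using unsep_fixes[OF un[OF that w0(1)] w0(2) stab_subset_Isom] w0 by (simp add: H_def)
    moreover have "dist x y \<le> u0" if "x \<in> W" "y \<in> W" for x y
      using leM[OF that] False w0 by linarith
    ultimately show ?thesis using that w0 by blast
  qed
  have "\<exists>v\<in>H. \<forall>y\<in>W. \<forall>x\<in>W. u \<le> dist x (v y)"
  proof (cases "\<exists>z\<in>W. \<exists>h\<in>H. u < dist z (h z)")
    \<comment> \<open>A displacement above \<open>u\<close> of one point carries off all of
      \<open>W\<close>, whose diameter is at most \<open>u\<close>.\<close>
    case True
    then obtain z h where z: "z \<in> W" "h \<in> H" "u < dist z (h z)" by blast
    have "u \<le> dist x (h y)" if "x \<in> W" "y \<in> W" for x y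
    proof (rule ccontr)
      assume "\<not> u \<le> dist x (h y)"
      then have "dist z (h y) \<le> u" using ultra_leI[of z x u "h y"] u(3)[of z x] that z by simp
      moreover have "dist (h y) (h z) \<le> u" using u(3)[of y z] that z H by auto
      ultimately show False using ultra_leI[of z "h y" u "h z"] z by simp
    qed
    then show ?thesis using z by blast
  next
    \<comment> \<open>No displacement exceeds \<open>u\<close>, and the points are moved off one at
      a time. By extremality some \<open>g\<close> takes \<open>z\<close> away from \<open>W\<close>
      and from the image of \<open>W\<close> under \<open>v\<close>; the \<open>u\<close>-balls of
      \<open>v z\<close> and \<open>g z\<close> are then swapped.\<close>
    case False
    have "\<exists>v\<in>H. \<forall>y\<in>T. \<forall>x\<in>W. u \<le> dist x (v y)" if "T \<subseteq> W" for T
      using finite_subset[OF that W] that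
    proof (induction T rule: finite_induct)
      case empty
      then show ?case using stab_id[OF Q(1)] by (auto simp: H_def)
    next
      case (insert z T)
      then obtain v where v: "v \<in> H" "\<And>y x. y \<in> T \<Longrightarrow> x \<in> W \<Longrightarrow> u \<le> dist x (v y)" by blast
      have zW: "z \<in> W" using insert by simp
      show ?case
      proof (cases "\<forall>x\<in>W. u \<le> dist x (v z)")
        case True
        then show ?thesis using v by blast
      next
        case F: False
        then obtain x1 where x1: "x1 \<in> W" "dist x1 (v z) < u" by auto
        obtain g where g: "g \<in> H" "\<And>w. w \<in> W \<union> v ` W \<Longrightarrow> u \<le> dist (g z) w"
        proof (rule extr_cases[OF Q(2) u(1), of "W \<union> v ` W" z])
          show "finite (W \<union> v ` W)" using W by simp
        qed (use u(2)[OF zW] in \<open>auto simp: H_def\<close>)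
        define m where "m = g \<circ> iv v"
        have m: "m \<in> stab Q" using g v by (auto simp: m_def H_def intro: stab_comp stab_inv)
        have vI: "v \<in> Isom" "g \<in> Isom" using v g H by auto
        have mv: "m (v y) = g y" for y using vI by (simp add: m_def)
        have "dist z (v z) \<le> u" "dist z (g z) \<le> u" using False zW v g by force+
        then have "dist (v z) (g z) \<le> u" using ultra_leI[of "v z" z u "g z"] by (simp add: dist_commute)
        moreover have "u \<le> dist (v z) (g z)" using g(2)[of "v z"] zW by (simp add: dist_commute)
        \<comment> \<open>At most \<open>u\<close> since both points are within \<open>u\<close> of
          \<open>z\<close>, at least \<open>u\<close> by the choice of \<open>g\<close>.\<close>
        ultimately have e: "u = dist (v z) (m (v z))" by (simp add: mv)
        obtain f where f: "f \<in> stab Q" "\<And>y. dist (v z) y < u \<Longrightarrow> f y = m y"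
          "\<And>y. u \<le> dist (v z) y \<Longrightarrow> u \<le> dist (m (v z)) y \<Longrightarrow> f y = y"
          using swap_in_stab[OF m e Q(1)] by metis
        have "f \<circ> v \<in> H" using f v by (auto simp: H_def intro: stab_comp)
        moreover have "u \<le> dist x ((f \<circ> v) y)" if y: "y \<in> insert z T" and x: "x \<in> W" for x y
        proof (cases "y = z")
          case True
          then show ?thesis using f(2)[of "v z"] u(1) g(2)[of x] x by (simp add: mv dist_commute)
        next
          case False
          then have yT: "y \<in> T" "y \<in> W" using y insert.prems by auto
          \<comment> \<open>The \<open>u\<close>-ball of \<open>v z\<close> contains the point
            \<open>x1\<close> of \<open>W\<close>, and \<open>v y\<close> is already away from
            \<open>W\<close>; so the swap leaves \<open>v y\<close> in place.\<close>
          have "u \<le> dist (v z) (v y)"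
            using v(2)[OF yT(1) x1(1)] x1(2) ultra_less[of x1 "v z" u "v y"] by force
          moreover have "u \<le> dist (g z) (v y)" using g(2)[of "v y"] yT by simp
          ultimately have "f (v y) = v y" using f(3) by (simp add: mv)
          then show ?thesis using v(2)[OF yT(1) x] by simp
        qed
        ultimately show ?thesis by blast
      qed
    qed
    then show ?thesis by blast
  qed
  then obtain v where v: "v \<in> H" "\<And>x y. x \<in> W \<Longrightarrow> y \<in> W \<Longrightarrow> u \<le> dist x (v y)" by blast
  have vI: "v \<in> Isom" using v H by blast
  \<comment> \<open>Distances between \<open>W\<close> and its image are at least \<open>u\<close>
    and those within each of the two sets at most \<open>u\<close>; hence the former are all
    equal.\<close>
  have le: "dist x (v y) \<le> dist x' (v y')" if "x \<in> W" "y \<in> W" "x' \<in> W" "y' \<in> W" for x y x' y'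
  proof -
    have "dist x (v y') \<le> dist x' (v y')"
      using ultra_leI[of x x' "dist x' (v y')" "v y'"] u(3)[of x x'] v(2)[of x' y'] that by force
    moreover have "dist (v y') (v y) \<le> dist x' (v y')"
      using u(3)[of y' y] v(2)[of x' y'] that vI by force
    ultimately show ?thesis using ultra_leI by blast
  qed
  have "dist x (v y) = dist w0 (v w0)" if "x \<in> W" "y \<in> W" for x y
    using le[OF that w0(1) w0(1)] le[OF w0(1) w0(1) that] by simp
  then show ?thesis using that v by (simp add: H_def)
qed

text \<open>The displacement must be the same on all classes that the isometries normalizing
  \<open>stab Q\<close> carry to each other. So it is chosen on one class of each orbit of classes and then
  transported.\<close>

lemma move_apart:
  assumes Q: "bfam Q" "extr (stab Q)" and S: "finite (S :: 'a set)"
  obtains w where "w \<in> stab Q"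
    "\<And>x y x' y' a. \<lbrakk>x \<in> S; y \<in> S; x' \<in> S; y' \<in> S; unsep (stab Q) x y; unsep (stab Q) x' y';
      a \<in> Isom; normalizes a (stab Q); unsep (stab Q) (a x) x'\<rbrakk> \<Longrightarrow> dist x (w y) = dist x' (w y')"
proof -
  define H where "H = stab Q"
  have H: "H \<subseteq> Isom" by (simp add: H_def stab_subset_Isom)
  define N where "N = {a \<in> Isom. normalizes a H}"
  have Nid: "id \<in> N" using Isom_inv_left[OF id_Isom] by (auto simp: N_def normalizes_def fun_eq_iff o_def)
  have Ninv: "iv a \<in> N" if "a \<in> N" for a using that normalizes_iv by (auto simp: N_def)
  have Ncomp: "a \<circ> a' \<in> N" if "a \<in> N" "a' \<in> N" for a a'
    using that unfolding N_def normalizes_def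
    by (auto simp: inv_comp_distrib_Isom comp_assoc[symmetric]) (metis comp_assoc)+
  \<comment> \<open>Points whose classes are in the same orbit under the normalizer of
    \<open>H\<close>.\<close>
  define R where "R x y \<longleftrightarrow> (\<exists>a\<in>N. unsep H (a x) y)" for x y :: 'a
  have Nun: "unsep H (a x) (a y)" if "a \<in> N" "unsep H x y" for a x y
    using that unsep_normalizes[OF _ _ H] by (auto simp: N_def)
  have Rrefl: "R x x" for x using Nid by (auto simp: R_def intro!: bexI[of _ id])
  have Rsym: "R y x" if "R x y" for x y
  proof -
    obtain a where a: "a \<in> N" "unsep H (a x) y" using \<open>R x y\<close> by (auto simp: R_def)
    then have "unsep H (iv a (a x)) (iv a y)" using Nun Ninv by blast
    then have "unsep H (iv a y) x" using a by (auto simp: N_def unsep_sym)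
    then show ?thesis using a Ninv by (auto simp: R_def)
  qed
  have Rtrans: "R x z" if xy: "R x y" and yz: "R y z" for x y z
  proof -
    obtain a b where a: "a \<in> N" "unsep H (a x) y" and b: "b \<in> N" "unsep H (b y) z"
      using xy yz by (auto simp: R_def)
    have "unsep H (b (a x)) z" using Nun[OF b(1) a(2)] b(2) unsep_trans H by blast
    then show ?thesis using Ncomp[OF b(1) a(1)] by (auto simp: R_def intro!: bexI[of _ "b \<circ> a"])
  qed
  define b where "b x = (SOME z. R z x)" for x
  have bR: "R (b x) x" for x unfolding b_def by (rule someI[of _ x]) (rule Rrefl)
  have beq: "b x = b y" if "R x y" for x y
  proof -
    have "(\<lambda>z. R z x) = (\<lambda>z. R z y)" using that Rsym Rtrans by blast
    then show ?thesis by (simp add: b_def)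
  qed
  \<comment> \<open>A transport from the class of the base point to the class of \<open>x\<close>;
    it depends only on the class of \<open>x\<close>.\<close>
  define A where "A x = (SOME a. a \<in> N \<and> unsep H (a (b x)) x)" for x
  have A: "A x \<in> N \<and> unsep H (A x (b x)) x" for x
    unfolding A_def by (rule someI_ex[of "\<lambda>a. a \<in> N \<and> unsep H (a (b x)) x"]) (use bR[of x] in \<open>unfold R_def, blast\<close>)
  have un_eq: "b x = b y \<and> A x = A y" if "unsep H x y" for x y
  proof -
    have "b x = b y" using that Nid by (intro beq) (auto simp: R_def intro!: bexI[of _ id])
    moreover have "(\<lambda>a. a \<in> N \<and> unsep H (a (b x)) x) = (\<lambda>a. a \<in> N \<and> unsep H (a (b x)) y)"
      using that unsep_trans H unsep_sym by blast
    ultimately show ?thesis by (simp add: A_def)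
  qed
  \<comment> \<open>The centers of \<open>Q\<close> are included so that the prescribed values put
    \<open>w\<close> into \<open>stab Q\<close>.\<close>
  define S' where "S' = S \<union> fst ` Q"
  have S': "finite S'" "S \<subseteq> S'" "\<And>q r. (q, r) \<in> Q \<Longrightarrow> q \<in> S'"
    using S Q by (force simp: S'_def bfam_def)+
  \<comment> \<open>The classes in one orbit are pulled back to a single class and displaced there
    together, which yields the common constant \<open>c \<beta>\<close>.\<close>
  define P where "P \<beta> = (\<lambda>x. iv (A x) x) ` {x \<in> S'. b x = \<beta>}" for \<beta>
  have AI: "A x \<in> Isom" for x using A by (auto simp: N_def)
  have Pun: "unsep H x \<beta>" if "x \<in> P \<beta>" for x \<beta>
  proof -
    obtain y where y: "y \<in> S'" "b y = \<beta>" "x = iv (A y) y" using \<open>x \<in> P \<beta>\<close> by (auto simp: P_def)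
    then have "unsep H (iv (A y) (A y \<beta>)) (iv (A y) y)" using A[of y] Nun Ninv by blast
    then show ?thesis using y AI by (simp add: unsep_sym)
  qed
  have "\<exists>v c. v \<in> H \<and> (\<forall>x\<in>P \<beta>. \<forall>y\<in>P \<beta>. dist x (v y) = c)" for \<beta>
  proof -
    have "finite (P \<beta>)" using S' by (auto simp: P_def)
    moreover have "unsep (stab Q) x y" if "x \<in> P \<beta>" "y \<in> P \<beta>" for x y
      using Pun that unsep_trans unsep_sym H by (metis H_def)
    ultimately show ?thesis using move_class_apart[OF Q, of "P \<beta>"] by (metis H_def)
  qed
  then obtain v c where v: "\<And>\<beta>. v \<beta> \<in> H" "\<And>\<beta> x y. x \<in> P \<beta> \<Longrightarrow> y \<in> P \<beta> \<Longrightarrow> dist x (v \<beta> y) = c \<beta>"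
    by metis
  define M where "M x = A x \<circ> v (b x) \<circ> iv (A x)" for x
  have MH: "M x \<in> H" for x using A[of x] v(1) by (auto simp: M_def N_def normalizes_def)
  have MI: "M x \<in> Isom" for x using MH H by blast
  \<comment> \<open>Points of one class share the isometry \<open>M x\<close>; distances of
    separated points are not affected by elements of \<open>H\<close>.\<close>
  have dM: "dist (M x x) (M y y) = dist x y" for x y
  proof (cases "unsep H x y")
    case True
    then have "M x = M y" using un_eq by (simp add: M_def)
    then show ?thesis using MI by simp
  next
    case False
    then show ?thesis using dist_separated[of Q x y "M x" "M y"] MH by (simp add: H_def)
  qed
  obtain w where w: "w \<in> Isom" "\<And>x m. (x, m) \<in> (\<lambda>x. (x, M x)) ` S' \<Longrightarrow> w x = m x"
    by (rule extend_Isom[of "(\<lambda>x. (x, M x)) ` S'"]) (use S' MI dM in \<open>auto simp del: dist_Isom\<close>)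
  have wM: "w x = M x x" if "x \<in> S'" for x using w(2)[of x "M x"] that by blast
  have wQ: "w \<in> stab Q"
  proof (rule stabI[OF w(1)])
    fix q r assume "(q, r) \<in> Q"
    then show "dist (w q) q < r" using wM[of q] S'(3) stab_dist[of "M q" Q q r] MH by (simp add: H_def)
  qed
  have wc: "dist x (w y) = c (b x)" if "x \<in> S" "y \<in> S" "unsep H x y" for x y
  proof -
    have Pb: "iv (A z) z \<in> P (b z)" if "z \<in> S" for z
      using that S'(2) unfolding P_def by (intro imageI) auto
    have "iv (A x) x \<in> P (b x)" "iv (A x) y \<in> P (b x)"
      using Pb[of x] Pb[of y] that un_eq[of x y] by simp_all
    then have "dist (iv (A x) x) (v (b x) (iv (A x) y)) = c (b x)" by (rule v(2))
    then show ?thesis using wM[of y] that S' un_eq[of x y] AI[of x] AI[of y] by (auto simp: M_def dist_inv_left)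
  qed
  have weq: "dist x (w y) = dist x' (w y')" if "x \<in> S" "y \<in> S" "x' \<in> S" "y' \<in> S" "unsep H x y" "unsep H x' y'"
      "a \<in> Isom" "normalizes a H" "unsep H (a x) x'" for x y x' y' a
  proof -
    have "R x x'" using that by (auto simp: R_def N_def)
    then show ?thesis using wc that beq by metis
  qed
  show ?thesis by (rule that[OF wQ weq[unfolded H_def]])
qed

text \<open>Thus \<open>f\<close> is close to \<open>h\<close>, while its conjugate by the inverse
  of \<open>w\<close> is close to \<open>k\<close>.\<close>

lemma amalgamation:
  assumes Q: "bfam Q" "extr (stab Q)" and R: "finite (R :: 'a set)"
    and h: "\<And>i. i \<in> I \<Longrightarrow> h i \<in> Isom \<and> normalizes (h i) (stab Q)" and I: "finite I"
    and k: "\<And>i. i \<in> I \<Longrightarrow> k i \<in> Isom \<and> iv (h i) \<circ> k i \<in> stab Q"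
  obtains w f where "w \<in> stab Q" "\<And>i. i \<in> I \<Longrightarrow> f i \<in> Isom \<and> iv (h i) \<circ> f i \<in> stab Q"
    "\<And>i x. i \<in> I \<Longrightarrow> x \<in> R \<Longrightarrow> f i x = h i x" "\<And>i y. i \<in> I \<Longrightarrow> y \<in> R \<Longrightarrow> f i (w y) = w (k i y)"
proof -
  define H where "H = stab Q"
  have H: "H \<subseteq> Isom" by (simp add: H_def stab_subset_Isom)
  define R' where "R' = R \<union> fst ` Q"
  have R': "finite R'" "R \<subseteq> R'" "\<And>q r. (q, r) \<in> Q \<Longrightarrow> q \<in> R'"
    using R Q by (force simp: R'_def bfam_def)+
  \<comment> \<open>The images are included since the displacement at \<open>x\<close> is compared
    with the one at \<open>h i x\<close>.\<close>
  define S where "S = R' \<union> (\<Union>i\<in>I. h i ` R' \<union> k i ` R')"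
  have S: "finite S" using R' I by (simp add: S_def)
  obtain w where w: "w \<in> H"
    "\<And>x y x' y' a. \<lbrakk>x \<in> S; y \<in> S; x' \<in> S; y' \<in> S; unsep H x y; unsep H x' y';
      a \<in> Isom; normalizes a H; unsep H (a x) x'\<rbrakk> \<Longrightarrow> dist x (w y) = dist x' (w y')"
    using move_apart[OF Q S] unfolding H_def by metis
  have wI: "w \<in> Isom" using w H by blast
  have "\<exists>f. f \<in> Isom \<and> (\<forall>x\<in>R'. f x = h i x) \<and> (\<forall>y\<in>R'. f (w y) = w (k i y))" if i: "i \<in> I" for i
  proof -
    define u where "u = iv (h i) \<circ> k i"
    have u: "u \<in> H" using k[OF i] by (simp add: u_def H_def)
    have hI: "h i \<in> Isom" "normalizes (h i) H" "k i \<in> Isom" using h k i by (auto simp: H_def)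
    have ku: "k i y = h i (u y)" for y using hI by (simp add: u_def)
    \<comment> \<open>If \<open>x\<close> and \<open>y\<close> are unseparated, so are
      \<open>h i x\<close> and \<open>k i y\<close>, as \<open>k i y = h i (u y)\<close>; then
      \<open>h i\<close> takes one class to the other and both are displaced alike. If they are
      separated, both sides equal \<open>dist x y\<close>.\<close>
    have cross: "dist (h i x) (w (k i y)) = dist x (w y)" if xy: "x \<in> R'" "y \<in> R'" for x y
    proof (cases "unsep H x y")
      case True
      have "unsep H x (u y)" using True unsep_stab[of u Q y] u unsep_trans H by (metis H_def)
      then have "unsep H (h i x) (k i y)" unfolding ku using unsep_normalizes[OF hI(1,2) H] by blast
      then have "dist x (w y) = dist (h i x) (w (k i y))"
        by (intro w(2)[where a = "h i"]) (use True xy i hI in \<open>auto simp: S_def\<close>)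
      then show ?thesis by simp
    next
      case False
      then have 1: "dist x (w y) = dist x y"
        using dist_separated[of Q x y id w] w(1) stab_id[OF Q(1)] by (simp add: H_def)
      have 2: "dist x (u y) = dist x y"
        using False dist_separated[of Q x y id u] u stab_id[OF Q(1)] by (simp add: H_def)
      have "\<not> unsep H x (u y)"
        using False unsep_stab[of u Q y] u unsep_trans[of H x "u y" y] H unsep_sym[of H y "u y"] by (auto simp: H_def)
      then have "\<not> unsep H (h i x) (k i y)"
        unfolding ku
        using unsep_normalizes[OF inv_Isom[OF hI(1)] normalizes_iv[OF hI(1,2)] H, of "h i x" "h i (u y)"] hI by auto
      then have "dist (h i x) (w (k i y)) = dist (h i x) (k i y)"
        using dist_separated[of Q "h i x" "k i y" id w] w(1) stab_id[OF Q(1)] by (simp add: H_def)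
      then show ?thesis using 1 2 hI by (simp add: ku)
    qed
    define J where "J = (\<lambda>x. (x, h i)) ` R' \<union> (\<lambda>y. (w y, w \<circ> k i \<circ> iv w)) ` R'"
    obtain f where f: "f \<in> Isom" "\<And>x m. (x, m) \<in> J \<Longrightarrow> f x = m x"
    proof (rule extend_Isom[of J])
      show "finite J" using R' by (simp add: J_def)
      show "m \<in> Isom" if "(x, m) \<in> J" for x m using that hI wI by (auto simp: J_def)
      show "dist (m x) (m' y) = dist x y" if "(x, m) \<in> J" "(y, m') \<in> J" for x m y m'
        using that hI wI cross by (auto simp: J_def) (metis dist_commute)
    qed blast
    have "f x = h i x" if "x \<in> R'" for x using f(2)[of x "h i"] that by (auto simp: J_def)
    moreover have "f (w y) = w (k i y)" if "y \<in> R'" for y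
      using f(2)[of "w y" "w \<circ> k i \<circ> iv w"] that wI by (auto simp: J_def)
    ultimately show ?thesis using f(1) by blast
  qed
  then obtain f where f: "\<And>i. i \<in> I \<Longrightarrow> f i \<in> Isom" "\<And>i x. i \<in> I \<Longrightarrow> x \<in> R' \<Longrightarrow> f i x = h i x"
    "\<And>i y. i \<in> I \<Longrightarrow> y \<in> R' \<Longrightarrow> f i (w y) = w (k i y)" by metis
  have "iv (h i) \<circ> f i \<in> stab Q" if i: "i \<in> I" for i
  proof (rule stabI)
    show "iv (h i) \<circ> f i \<in> Isom" using h f i by simp
    fix q r assume q: "(q, r) \<in> Q"
    then have "r > 0" using Q by (auto simp: bfam_def)
    then show "dist ((iv (h i) \<circ> f i) q) q < r" using f(2)[OF i R'(3)[OF q]] h[OF i] by simp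
  qed
  then have *: "\<And>i. i \<in> I \<Longrightarrow> f i \<in> Isom \<and> iv (h i) \<circ> f i \<in> stab Q" using f(1) by blast
  show ?thesis
    by (rule that[OF w(1)[unfolded H_def] *]) (use f R'(2) in auto)
qed

end

section \<open>Density of the tuples that normalize an extremal stabilizer\<close>

definition translate :: "('a \<Rightarrow> 'a) \<Rightarrow> ('a \<times> real) set \<Rightarrow> ('a \<times> real) set" where
  "translate g P = (\<lambda>(x, r). (g x, r)) ` P"

lemma bfam_translate: "bfam P \<Longrightarrow> bfam (translate g P)"
  by (auto simp: bfam_def translate_def)

lemma stab_translate:
  assumes "g \<in> Isom" "h \<in> Isom"
  shows "h \<in> stab (translate g P) \<longleftrightarrow> iv g \<circ> h \<circ> g \<in> stab P"
proof -
  have "dist (iv g (h (g x))) x = dist (h (g x)) (g x)" for x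
    using assms by (simp add: dist_inv_left)
  then show ?thesis using assms by (auto simp: stab_def translate_def)
qed

lemma extr_translate:
  assumes g: "g \<in> Isom" and P: "extr (stab P)"
  shows "extr (stab (translate g P))"
  unfolding extr_def
proof (intro allI impI, elim conjE)
  fix x and r :: real
  assume r: "0 < r" and "finite_orbit (stab (translate g P)) x r"
  then obtain W where W: "finite W" "\<And>h. h \<in> stab (translate g P) \<Longrightarrow> \<exists>w\<in>W. dist (h x) w < r"
    by (auto simp: finite_orbit_def)
  have conj: "g \<circ> h \<circ> iv g \<in> stab (translate g P)" if "h \<in> stab P" for h
  proof -
    have "iv g \<circ> (g \<circ> h \<circ> iv g) \<circ> g = h" using g by (auto simp: fun_eq_iff)
    then show ?thesis using that g stab_translate[of g "g \<circ> h \<circ> iv g" P] by (simp add: stab_Isom)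
  qed
  have "finite_orbit (stab P) (iv g x) r"
    unfolding finite_orbit_def
  proof (intro exI[of _ "iv g ` W"] conjI ballI)
    fix h assume h: "h \<in> stab P"
    then obtain w where w: "w \<in> W" "dist ((g \<circ> h \<circ> iv g) x) w < r" using W(2)[OF conj] by blast
    then have "dist (h (iv g x)) (iv g w) < r" using g by (simp add: dist_inv_right)
    then show "\<exists>w\<in>iv g ` W. dist (h (iv g x)) w < r" using w by blast
  qed (use W in simp)
  then have "fixes_ball (stab P) (iv g x) r" using P r by (simp add: extr_def)
  then show "fixes_ball (stab (translate g P)) x r"
    unfolding fixes_ball_def
  proof (intro ballI)
    fix h assume f: "\<forall>g'\<in>stab P. dist (g' (iv g x)) (iv g x) < r" and h: "h \<in> stab (translate g P)"
    then have "iv g \<circ> h \<circ> g \<in> stab P" using g stab_translate stab_Isom by blast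
    then have "dist ((iv g \<circ> h \<circ> g) (iv g x)) (iv g x) < r" using f by blast
    then show "dist (h x) x < r" using g by (simp add: dist_inv_left)
  qed
qed

context ultrametric_type
begin

text \<open>\<open>Q\<close> is the union of the translates of \<open>P'\<close> under the group
  \<open>\<Gamma>\<close> of isometries preserving the finite set \<open>Z'\<close>. Its centers lie
  in \<open>Z'\<close>, so it is finite; each of its balls belongs to an extremal translate, so
  \<open>extr_Union\<close> applies; and \<open>\<Gamma>\<close>, which contains the modified tuple,
  permutes \<open>Q\<close> and hence normalizes its stabilizer.\<close>

lemma normalized_extremal_dense:
  assumes ex: "\<And>P :: ('a \<times> real) set. bfam P \<Longrightarrow> \<exists>P'. bfam P' \<and> stab P' \<subseteq> stab P \<and> extr (stab P')"
    and P: "bfam (P :: ('a \<times> real) set)" and I: "finite I" and g: "\<And>i. i \<in> I \<Longrightarrow> g i \<in> Isom"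
  obtains Q g' where "bfam Q" "extr (stab Q)" "stab Q \<subseteq> stab P"
    "\<And>i. i \<in> I \<Longrightarrow> g' i \<in> Isom \<and> normalizes (g' i) (stab Q)"
    "\<And>i x. i \<in> I \<Longrightarrow> x \<in> fst ` P \<Longrightarrow> g' i x = g i x"
proof -
  obtain P' where P': "bfam P'" "stab P' \<subseteq> stab P" "extr (stab P')" using ex[OF P] by blast
  define F where "F = fst ` (P \<union> P')"
  define Z where "Z = F \<union> (\<Union>i\<in>I. g i ` F)"
  have "finite F" using P P' by (simp add: F_def bfam_def)
  then have "finite Z" using I by (simp add: Z_def)
  then obtain Z' where Z': "finite Z'" "Z \<subseteq> Z'"
    "\<And>p F. \<lbrakk>p \<in> Isom; F \<subseteq> Z; p ` F \<subseteq> Z\<rbrakk> \<Longrightarrow> \<exists>g\<in>Isom. (\<forall>x\<in>F. g x = p x) \<and> g ` Z' = Z'"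
    using finite_extension_property[of Z] by (metis (no_types, lifting))
  have "\<exists>h\<in>Isom. (\<forall>x\<in>F. h x = g i x) \<and> h ` Z' = Z'" if "i \<in> I" for i
    by (rule Z'(3)[OF g[OF that]]) (use that in \<open>auto simp: Z_def\<close>)
  then obtain g' where g': "\<And>i. i \<in> I \<Longrightarrow> g' i \<in> Isom" "\<And>i x. i \<in> I \<Longrightarrow> x \<in> F \<Longrightarrow> g' i x = g i x"
    "\<And>i. i \<in> I \<Longrightarrow> g' i ` Z' = Z'" by metis
  define \<Gamma> where "\<Gamma> = {\<gamma> \<in> Isom. \<gamma> ` Z' = Z'}"
  have \<Gamma>id: "id \<in> \<Gamma>" by (simp add: \<Gamma>_def)
  have \<Gamma>c: "\<gamma> \<circ> \<gamma>' \<in> \<Gamma>" if "\<gamma> \<in> \<Gamma>" "\<gamma>' \<in> \<Gamma>" for \<gamma> \<gamma>'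
    using that unfolding \<Gamma>_def mem_Collect_eq by (metis comp_Isom image_comp)
  have \<Gamma>i: "iv \<gamma> \<in> \<Gamma>" if "\<gamma> \<in> \<Gamma>" for \<gamma>
  proof -
    have "\<gamma> \<in> Isom" "\<gamma> ` Z' = Z'" using that by (auto simp: \<Gamma>_def)
    then show ?thesis using image_inv_f_f[OF bij_is_inj[OF bij_Isom[of \<gamma>]], of Z'] by (simp add: \<Gamma>_def)
  qed
  define Q where "Q = (\<Union>\<gamma>\<in>\<Gamma>. translate \<gamma> P')"
  have "Q \<subseteq> Z' \<times> snd ` P'"
  proof -
    have "translate \<gamma> P' \<subseteq> Z' \<times> snd ` P'" if "\<gamma> \<in> \<Gamma>" for \<gamma>
    proof -
      have "x \<in> Z'" if "(x, r) \<in> P'" for x r using that Z'(2) by (force simp: Z_def F_def)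
      moreover have "\<gamma> x \<in> Z'" if "x \<in> Z'" for x using that \<open>\<gamma> \<in> \<Gamma>\<close> by (auto simp: \<Gamma>_def)
      ultimately show ?thesis by (force simp: translate_def)
    qed
    then show ?thesis by (auto simp: Q_def)
  qed
  then have finQ: "finite Q" by (rule finite_subset) (use Z' P' in \<open>auto simp: bfam_def\<close>)
  have Q: "bfam Q" using finQ P' by (auto simp: bfam_def Q_def translate_def)
  have sub: "P' \<subseteq> Q"
  proof -
    have "translate id P' = P'" by (auto simp: translate_def)
    then show ?thesis using \<Gamma>id by (auto simp: Q_def)
  qed
  have eQ: "extr (stab Q)"
  proof (cases "Q = {}")
    case True
    then show ?thesis using sub P' by simp
  next
    case False
    have "\<exists>A. p \<in> A \<and> A \<subseteq> Q \<and> extr (stab A)" if p: "p \<in> Q" for p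
    proof -
      obtain \<gamma> where "\<gamma> \<in> \<Gamma>" "p \<in> translate \<gamma> P'" using p by (auto simp: Q_def)
      then show ?thesis using extr_translate[of \<gamma> P'] P'(3) by (auto simp: Q_def \<Gamma>_def)
    qed
    then obtain A where "\<And>p. p \<in> Q \<Longrightarrow> p \<in> A p \<and> A p \<subseteq> Q \<and> extr (stab (A p))" by metis
    then show ?thesis by (rule extr_Union[OF Q False])
  qed
  have inQ: "(\<gamma> x, r) \<in> Q" if xr: "(x, r) \<in> Q" and \<gamma>: "\<gamma> \<in> \<Gamma>" for x r \<gamma>
  proof -
    obtain \<gamma>' where \<gamma>': "\<gamma>' \<in> \<Gamma>" "(x, r) \<in> translate \<gamma>' P'" using xr by (auto simp: Q_def)
    then have "(\<gamma> x, r) \<in> translate (\<gamma> \<circ> \<gamma>') P'" by (force simp: translate_def)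
    then show ?thesis using \<Gamma>c[OF \<gamma> \<gamma>'(1)] by (auto simp: Q_def)
  qed
  have conj: "\<gamma> \<circ> h \<circ> iv \<gamma> \<in> stab Q" if \<gamma>: "\<gamma> \<in> \<Gamma>" and h: "h \<in> stab Q" for \<gamma> h
  proof (rule stabI)
    have \<gamma>I: "\<gamma> \<in> Isom" using \<gamma> by (simp add: \<Gamma>_def)
    then show "\<gamma> \<circ> h \<circ> iv \<gamma> \<in> Isom" using stab_Isom[OF h] by simp
    fix x r assume "(x, r) \<in> Q"
    then have "dist (h (iv \<gamma> x)) (iv \<gamma> x) < r" using stab_dist[OF h] inQ \<Gamma>i[OF \<gamma>] by blast
    then show "dist ((\<gamma> \<circ> h \<circ> iv \<gamma>) x) x < r" using \<gamma>I by (simp add: dist_inv_right)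
  qed
  show ?thesis
  proof (rule that[OF Q eQ])
    show "stab Q \<subseteq> stab P" using stab_antimono[OF sub] P' by blast
    show "g' i \<in> Isom \<and> normalizes (g' i) (stab Q)" if "i \<in> I" for i
    proof -
      have "g' i \<in> \<Gamma>" using g' that by (simp add: \<Gamma>_def)
      then show ?thesis using conj[of "g' i"] conj[OF \<Gamma>i, of "g' i"] g'(1)[OF that] by (auto simp: normalizes_def)
    qed
    show "g' i x = g i x" if "i \<in> I" "x \<in> fst ` P" for i x
      using g'(2)[OF that(1), of x] that(2) by (auto simp: F_def)
  qed
qed

subsection \<open>Families of balls as sets of pairs\<close>

lemma ball_eq_iff: "0 < r \<Longrightarrow> ball (x::'a) r = ball y r \<longleftrightarrow> dist x y < r"
proof
  show "dist x y < r" if "ball x r = ball y r" "0 < r"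
    using that by (metis centre_in_ball dist_commute mem_ball)
  show "ball x r = ball y r" if "dist x y < r"
    using that ultra_less[of x y r] ultra_less[of y x r] by (auto simp: dist_commute)
qed

lemma ball_image_eq_iff:
  "g \<in> Isom \<Longrightarrow> h \<in> Isom \<Longrightarrow> 0 < r \<Longrightarrow>
    ball_image g (ball (x::'a) r, r) = ball_image h (ball x r, r) \<longleftrightarrow> dist (g x) (h x) < r"
  using ball_eq_iff[of r "g x" "h x"] by (simp only: ball_image_def fst_conv snd_conv image_ball_Isom prod.inject simp_thms)

lemma tau_eq_stab:
  assumes "bfam (P :: ('a \<times> real) set)"
  shows "\<tau> id ((\<lambda>(x, r). (ball x r, r)) ` P) = stab P"
proof -
  have "ball_image g (ball x r, r) = ball_image id (ball x r, r) \<longleftrightarrow> dist (g x) x < r"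
    if "g \<in> Isom" "(x, r) \<in> P" for g x r
    using that assms ball_image_eq_iff[of g id r x] by (auto simp: bfam_def)
  then show ?thesis by (auto simp: \<tau>_def stab_def)
qed

lemma FD_family_stab:
  assumes "FD_family (\<B> :: 'a rball set)"
  obtains P where "bfam P" "\<tau> id \<B> = stab P"
proof -
  have "\<forall>B\<in>\<B>. \<exists>x. B = (ball x (snd B), snd B) \<and> 0 < snd B"
    using assms by (force simp: FD_family_def rballs_def)
  then obtain c where c: "\<And>B. B \<in> \<B> \<Longrightarrow> B = (ball (c B) (snd B), snd B) \<and> 0 < snd B" by metis
  define P where "P = (\<lambda>B. (c B, snd B)) ` \<B>"
  have P: "bfam P" using assms c by (auto simp: bfam_def P_def FD_family_def)
  have "(\<lambda>(x, r). (ball x r, r)) ` P = \<B>"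
    unfolding P_def image_comp using c by (auto simp: image_iff)
  then show ?thesis using that[OF P] tau_eq_stab[OF P] by simp
qed

text \<open>A subfamily that is minimal with a given stabilizer is disjoint, since a ball is
  redundant in the presence of a smaller one inside it.\<close>

lemma stab_FD_family:
  assumes "bfam (P :: ('a \<times> real) set)"
  obtains \<B> where "FD_family \<B>" "\<tau> id \<B> = stab P"
proof -
  define M where "M = arg_min card (\<lambda>A. A \<subseteq> P \<and> stab A = stab P)"
  have M: "M \<subseteq> P \<and> stab M = stab P" and
    min: "\<And>A. A \<subseteq> P \<Longrightarrow> stab A = stab P \<Longrightarrow> card M \<le> card A"
    using arg_min_nat_lemma[of "\<lambda>A. A \<subseteq> P \<and> stab A = stab P" P card] unfolding M_def by blast+
  have bM: "bfam M" using M assms finite_subset by (auto simp: bfam_def)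
  have disj: "r \<le> dist x y" if "(x, s) \<in> M" "(y, r) \<in> M" "(x, s) \<noteq> (y, r)" "s \<le> r" for x y s r
  proof (rule ccontr)
    assume "\<not> r \<le> dist x y"
    then have d: "dist x y < r" by simp
    define A where "A = M - {(y, r)}"
    have "stab A \<subseteq> stab M"
    proof
      fix g assume g: "g \<in> stab A"
      have gI: "g \<in> Isom" by (rule stab_Isom[OF g])
      have "dist (g x) x < s" using g that by (auto simp: stab_def A_def)
      then have "dist (g x) x < r" using that by simp
      then have "dist (g x) y < r" using d by (rule ultra_less)
      then have "dist (g y) y < r" using ultra_less[of "g y" "g x" r y] d gI by (simp add: dist_commute)
      then show "g \<in> stab M" using g by (auto simp: stab_def A_def)
    qed
    then have "stab A = stab P" using M stab_antimono[of A M] by (auto simp: A_def)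
    then have "card M \<le> card A" using M by (intro min) (auto simp: A_def)
    moreover have "card A < card M" unfolding A_def
      using bM that by (intro card_Diff1_less) (auto simp: bfam_def)
    ultimately show False by simp
  qed
  define \<B> where "\<B> = (\<lambda>(x, r). (ball x r, r)) ` M"
  have dj: "disjnt (ball x s) (ball y r)" if "(x, s) \<in> M" "(y, r) \<in> M" "(x, s) \<noteq> (y, r)" for x y s r
  proof -
    have *: "disjnt (ball x s) (ball y r)" if "(x, s) \<in> M" "(y, r) \<in> M" "(x, s) \<noteq> (y, r)" "s \<le> r" for x y s r
      using disj[OF that] ultra_less[of x _ r y] that(4) by (force simp: disjnt_iff dist_commute)
    show ?thesis using *[OF that] *[of y r x s] that by (metis disjnt_sym linear)
  qed
  have "pairwise (\<lambda>B C. disjnt (fst B) (fst C)) \<B>"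
  proof (rule pairwiseI)
    fix B C assume "B \<in> \<B>" "C \<in> \<B>" "B \<noteq> C"
    then obtain x s y r where "(x, s) \<in> M" "(y, r) \<in> M" "B = (ball x s, s)" "C = (ball y r, r)" "(x, s) \<noteq> (y, r)"
      by (auto simp: \<B>_def)
    then show "disjnt (fst B) (fst C)" using dj by simp
  qed
  then have "FD_family \<B>"
    using bM by (auto simp: FD_family_def \<B>_def bfam_def rballs_def)
  moreover have "\<tau> id \<B> = stab P" unfolding \<B>_def using tau_eq_stab[OF bM] M by simp
  ultimately show ?thesis by (rule that)
qed

lemma extremality_iff:
  assumes "FD_family (\<B> :: 'a rball set)"
  shows "extremality \<B> \<longleftrightarrow> extr (\<tau> id \<B>)"
proof -
  define H where "H = \<tau> id \<B>"
  have H: "id \<in> H" "H \<subseteq> Isom" by (auto simp: H_def \<tau>_def)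
  define \<beta> where "\<beta> x r g = (ball (g x) r, r)" for x r and g :: "'a \<Rightarrow> 'a"
  have \<beta>_eq: "\<beta> x r g = \<beta> x r h \<longleftrightarrow> dist (g x) (h x) < r" if "0 < r" for x r g h
    using ball_eq_iff[OF that] by (simp add: \<beta>_def)
  have orb: "ball_orbit \<B> (ball x r, r) = \<beta> x r ` H" for x r
  proof -
    have im: "ball_image g (ball x r, r) = \<beta> x r g" if "g \<in> H" for g
      using subsetD[OF H(2) that] by (simp add: ball_image_def image_ball_Isom \<beta>_def)
    have "ball_orbit \<B> (ball x r, r) = (\<lambda>g. ball_image g (ball x r, r)) ` H"
      unfolding ball_orbit_def H_def by blast
    also have "\<dots> = \<beta> x r ` H" using im by (rule image_cong[OF refl])
    finally show ?thesis .
  qed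
  have fin: "finite (ball_orbit \<B> (ball x r, r)) \<longleftrightarrow> finite_orbit H x r" if r: "0 < r" for x r
  proof
    assume "finite (ball_orbit \<B> (ball x r, r))"
    then have "finite (\<beta> x r ` H)" by (simp only: orb)
    from finite_subset_image[OF this subset_refl]
    obtain T where T: "T \<subseteq> H" "finite T" "\<beta> x r ` H = \<beta> x r ` T" by blast
    show "finite_orbit H x r"
      unfolding finite_orbit_def
    proof (intro exI[of _ "(\<lambda>g. g x) ` T"] conjI ballI)
      fix g assume "g \<in> H"
      then obtain t where "t \<in> T" "\<beta> x r g = \<beta> x r t" using T(3) by blast
      then show "\<exists>w\<in>(\<lambda>g. g x) ` T. dist (g x) w < r" using \<beta>_eq[OF r] by blast
    qed (use T in simp)
  next
    assume "finite_orbit H x r"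
    then obtain W where W: "finite W" "\<And>g. g \<in> H \<Longrightarrow> \<exists>w\<in>W. dist (g x) w < r" by (auto simp: finite_orbit_def)
    have "\<beta> x r ` H \<subseteq> (\<lambda>w. (ball w r, r)) ` W"
    proof
      fix B assume "B \<in> \<beta> x r ` H"
      then obtain g where g: "g \<in> H" "B = (ball (g x) r, r)" by (auto simp: \<beta>_def)
      then obtain w where "w \<in> W" "dist (g x) w < r" using W(2) by blast
      then show "B \<in> (\<lambda>w. (ball w r, r)) ` W" using g ball_eq_iff[OF r] by simp
    qed
    then show "finite (ball_orbit \<B> (ball x r, r))" unfolding orb using W finite_subset by blast
  qed
  have sing: "is_singleton (ball_orbit \<B> (ball x r, r)) \<longleftrightarrow> fixes_ball H x r" if r: "0 < r" for x r
  proof -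
    have "is_singleton (\<beta> x r ` H) \<longleftrightarrow> (\<forall>g\<in>H. \<beta> x r g = \<beta> x r id)"
    proof
      assume "is_singleton (\<beta> x r ` H)"
      then obtain B where "\<beta> x r ` H = {B}" by (auto simp: is_singleton_def)
      then have "\<beta> x r g = B" if "g \<in> H" for g using imageI[OF that, of "\<beta> x r"] by simp
      then show "\<forall>g\<in>H. \<beta> x r g = \<beta> x r id" using H(1) by simp
    next
      assume "\<forall>g\<in>H. \<beta> x r g = \<beta> x r id"
      then have "\<beta> x r ` H = (\<lambda>_. \<beta> x r id) ` H" by (intro image_cong) auto
      then have "\<beta> x r ` H = {\<beta> x r id}" using H(1) by (simp add: image_constant)
      then show "is_singleton (\<beta> x r ` H)" by (simp add: is_singleton_def)
    qed
    then show ?thesis by (simp add: fixes_ball_def \<beta>_eq[OF r] orb)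
  qed
  have "extremality \<B> \<longleftrightarrow> (\<forall>x r. 0 < r \<longrightarrow>
      infinite (ball_orbit \<B> (ball x r, r)) \<or> is_singleton (ball_orbit \<B> (ball x r, r)))"
    by (auto simp: extremality_def rballs_def)
  also have "\<dots> \<longleftrightarrow> extr H" by (auto simp: extr_def fin sing)
  finally show ?thesis by (simp add: H_def)
qed

end

section \<open>The topology of the isometry group\<close>

definition nbhd :: "('a::metric_space \<Rightarrow> 'a) \<Rightarrow> ('a \<times> real) set \<Rightarrow> ('a \<Rightarrow> 'a) set" where
  "nbhd g P = {h. \<forall>(x, r)\<in>P. dist (h x) (g x) < r}"

lemma nbhd_refl: "bfam P \<Longrightarrow> g \<in> nbhd g P"
  by (auto simp: nbhd_def bfam_def)

lemma nbhd_Un: "nbhd g (P \<union> P') = nbhd g P \<inter> nbhd g P'"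
  by (auto simp: nbhd_def)

lemma open_nbhd:
  assumes "bfam P"
  shows "open (nbhd g P)"
proof -
  have "open {h. dist (h x) (g x) < r}" for x and r :: real
    by (intro open_Collect_less continuous_intros continuous_on_product_coordinates)
  then have "open (\<Inter>p\<in>P. {h. dist (h (fst p)) (g (fst p)) < snd p})"
    using assms by (intro open_INT) (auto simp: bfam_def)
  moreover have "nbhd g P = (\<Inter>p\<in>P. {h. dist (h (fst p)) (g (fst p)) < snd p})"
    by (force simp: nbhd_def)
  ultimately show ?thesis by simp
qed

lemma open_fun_contains_nbhd:
  fixes g :: "'a::metric_space \<Rightarrow> 'a"
  assumes "open T" "g \<in> T"
  obtains P where "bfam P" "nbhd g P \<subseteq> T"
proof -
  have "openin (product_topology (\<lambda>i. euclidean) UNIV) T" using assms by (simp add: open_fun_def)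
  from product_topology_open_contains_basis[OF this assms(2)]
  obtain X where X: "g \<in> Pi\<^sub>E UNIV X" "\<And>i. open (X i)" "finite {i. X i \<noteq> UNIV}" "Pi\<^sub>E UNIV X \<subseteq> T"
    by auto
  have "\<exists>r>0. ball (g x) r \<subseteq> X x" for x
    using X(1,2) open_contains_ball by (metis PiE_mem UNIV_I)
  then obtain r where r: "\<And>x. r x > 0" "\<And>x. ball (g x) (r x) \<subseteq> X x" by metis
  define P where "P = (\<lambda>x. (x, r x)) ` {i. X i \<noteq> UNIV}"
  have "bfam P" using X(3) r by (auto simp: bfam_def P_def)
  moreover have "nbhd g P \<subseteq> T"
  proof
    fix h assume h: "h \<in> nbhd g P"
    have "h x \<in> X x" for x
    proof (cases "X x = UNIV")
      case False
      then have "dist (h x) (g x) < r x" using h by (auto simp: nbhd_def P_def)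
      then have "h x \<in> ball (g x) (r x)" by (simp add: dist_commute)
      then show ?thesis using r(2) by blast
    qed simp
    then show "h \<in> T" using X(4) by auto
  qed
  ultimately show ?thesis by (rule that)
qed

lemma topspace_Isom_topology [simp]: "topspace Isom_topology = Isom"
  by (simp add: Isom_topology_def)

lemma openin_subtopology_Isom:
  assumes V: "V \<subseteq> (Isom :: ('a::metric_space \<Rightarrow> 'a) set)"
  shows "openin (subtopology Isom_topology V) U \<longleftrightarrow>
    U \<subseteq> V \<and> (\<forall>g\<in>U. \<exists>P. bfam P \<and> nbhd g P \<inter> V \<subseteq> U)"
proof -
  have sub: "subtopology Isom_topology V = top_of_set V"
    using V by (simp add: Isom_topology_def subtopology_subtopology inf.absorb2)
  show ?thesis
  proof
    assume "openin (subtopology Isom_topology V) U"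
    then obtain T where T: "open T" "U = T \<inter> V" unfolding sub openin_open by (metis inf_commute)
    have "\<exists>P. bfam P \<and> nbhd g P \<inter> V \<subseteq> U" if "g \<in> U" for g
    proof -
      obtain P where "bfam P" "nbhd g P \<subseteq> T" using open_fun_contains_nbhd[OF T(1), of g] \<open>g \<in> U\<close> T by blast
      then show ?thesis using T(2) by blast
    qed
    then show "U \<subseteq> V \<and> (\<forall>g\<in>U. \<exists>P. bfam P \<and> nbhd g P \<inter> V \<subseteq> U)" using T by blast
  next
    assume U: "U \<subseteq> V \<and> (\<forall>g\<in>U. \<exists>P. bfam P \<and> nbhd g P \<inter> V \<subseteq> U)"
    then obtain P where P: "\<And>g. g \<in> U \<Longrightarrow> bfam (P g) \<and> nbhd g (P g) \<inter> V \<subseteq> U" by metis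
    have "U = V \<inter> (\<Union>g\<in>U. nbhd g (P g))"
      using U P nbhd_refl by blast
    moreover have "open (\<Union>g\<in>U. nbhd g (P g))" using P open_nbhd by blast
    ultimately show "openin (subtopology Isom_topology V) U" unfolding sub openin_open by blast
  qed
qed

lemma openin_Isom_topology:
  "openin Isom_topology U \<longleftrightarrow> U \<subseteq> Isom \<and> (\<forall>g\<in>U. \<exists>P. bfam P \<and> nbhd g P \<inter> Isom \<subseteq> U)"
  using openin_subtopology_Isom[OF subset_refl, of U] by (simp add: Isom_topology_def subtopology_subtopology)

lemma openin_product_Isom:
  assumes V: "V \<subseteq> (Isom :: ('a::metric_space \<Rightarrow> 'a) set)" and I: "finite I"
  shows "openin (product_topology (\<lambda>_. subtopology Isom_topology V) I) U \<longleftrightarrow>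
    U \<subseteq> (I \<rightarrow>\<^sub>E V) \<and> (\<forall>y\<in>U. \<exists>P. bfam P \<and> {z \<in> I \<rightarrow>\<^sub>E V. \<forall>i\<in>I. z i \<in> nbhd (y i) P} \<subseteq> U)"
    (is "?L \<longleftrightarrow> ?R")
proof
  have ts: "topspace (subtopology Isom_topology V) = V" using V by auto
  assume L: ?L
  have "\<exists>P. bfam P \<and> {z \<in> I \<rightarrow>\<^sub>E V. \<forall>i\<in>I. z i \<in> nbhd (y i) P} \<subseteq> U" if y: "y \<in> U" for y
  proof -
    obtain X where X: "\<And>i. i \<in> I \<Longrightarrow> openin (subtopology Isom_topology V) (X i)" "y \<in> Pi\<^sub>E I X" "Pi\<^sub>E I X \<subseteq> U"
      using L y unfolding openin_product_topology_alt by metis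
    have "\<exists>P. bfam P \<and> nbhd (y i) P \<inter> V \<subseteq> X i" if "i \<in> I" for i
      using X(1)[OF that] X(2) that unfolding openin_subtopology_Isom[OF V] by (metis PiE_mem)
    then obtain P where P: "\<And>i. i \<in> I \<Longrightarrow> bfam (P i) \<and> nbhd (y i) (P i) \<inter> V \<subseteq> X i" by metis
    \<comment> \<open>One family serves all coordinates, since there are finitely many of
      them.\<close>
    have b: "bfam (\<Union>i\<in>I. P i)" using P I by (auto simp: bfam_def)
    have s: "{z \<in> I \<rightarrow>\<^sub>E V. \<forall>i\<in>I. z i \<in> nbhd (y i) (\<Union>i\<in>I. P i)} \<subseteq> Pi\<^sub>E I X"
    proof
      fix z assume z: "z \<in> {z \<in> I \<rightarrow>\<^sub>E V. \<forall>i\<in>I. z i \<in> nbhd (y i) (\<Union>i\<in>I. P i)}"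
      have "z i \<in> X i" if "i \<in> I" for i
      proof -
        have "z i \<in> nbhd (y i) (P i)" "z i \<in> V" using z that by (auto simp: nbhd_def)
        then show ?thesis using P[OF that] by blast
      qed
      then show "z \<in> Pi\<^sub>E I X" using z by (auto simp: PiE_iff)
    qed
    show ?thesis by (intro exI[of _ "\<Union>i\<in>I. P i"] conjI b order_trans[OF s X(3)])
  qed
  moreover have "U \<subseteq> (I \<rightarrow>\<^sub>E V)" using openin_subset[OF L] ts by simp
  ultimately show ?R by blast
next
  have ts: "topspace (subtopology Isom_topology V) = V" using V by auto
  assume R: ?R
  show ?L
    unfolding openin_product_topology_alt
  proof
    fix y assume y: "y \<in> U"
    then obtain P where P: "bfam P" "{z \<in> I \<rightarrow>\<^sub>E V. \<forall>i\<in>I. z i \<in> nbhd (y i) P} \<subseteq> U" using R by blast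
    have "openin (subtopology Isom_topology V) (nbhd (y i) P \<inter> V)" for i
    proof -
      have "openin (top_of_set V) (V \<inter> nbhd (y i) P)" using open_nbhd[OF P(1)] by (rule openin_open_Int)
      then show ?thesis using V by (simp add: Isom_topology_def subtopology_subtopology inf.absorb2 inf_commute)
    qed
    moreover have "y \<in> (\<Pi>\<^sub>E i\<in>I. nbhd (y i) P \<inter> V)" using R y nbhd_refl[OF P(1)] by (auto simp: PiE_iff)
    moreover have "(\<Pi>\<^sub>E i\<in>I. nbhd (y i) P \<inter> V) \<subseteq> U" using P(2) by (auto simp: PiE_iff)
    ultimately show "\<exists>U'. finite {i \<in> I. U' i \<noteq> topspace (subtopology Isom_topology V)} \<and>
        (\<forall>i\<in>I. openin (subtopology Isom_topology V) (U' i)) \<and> y \<in> Pi\<^sub>E I U' \<and> Pi\<^sub>E I U' \<subseteq> U"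
      using I by (intro exI[of _ "\<lambda>i. nbhd (y i) P \<inter> V"]) auto
  qed
qed

section \<open>Limits of isometries and complete metrizability of the isometry group\<close>

definition denseq :: "nat \<Rightarrow> 'a::polish_space" where
  "denseq = (SOME q. \<forall>x. \<forall>e>0. \<exists>j. dist (q j) x < e)"

lemma denseq: "0 < e \<Longrightarrow> \<exists>j. dist (denseq j) (x :: 'a::polish_space) < e"
proof -
  obtain D :: "'a set" where D: "countable D" "\<And>X. open X \<Longrightarrow> X \<noteq> {} \<Longrightarrow> \<exists>d\<in>D. d \<in> X"
    using countable_dense_exists by blast
  have "D \<noteq> {}" using D(2)[of UNIV] by auto
  have "\<exists>j. dist (from_nat_into D j) x < e" if "0 < e" for x :: 'a and e
  proof -
    obtain d where "d \<in> D" "d \<in> ball x e" using D(2)[OF open_ball, of x e] \<open>0 < e\<close> by (metis ball_eq_empty not_le)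
    then show ?thesis using from_nat_into_surj[OF D(1)] by (metis mem_ball dist_commute)
  qed
  then have "\<exists>q :: nat \<Rightarrow> 'a. \<forall>x. \<forall>e>0. \<exists>j. dist (q j) x < e" by blast
  from someI_ex[OF this] show "0 < e \<Longrightarrow> ?thesis" unfolding denseq_def by blast
qed

lemma Isom_Cauchy_from_dense:
  fixes g :: "nat \<Rightarrow> 'a::polish_space \<Rightarrow> 'a"
  assumes g: "\<And>k. g k \<in> Isom" and C: "\<And>j. Cauchy (\<lambda>k. g k (denseq j))"
  shows "Cauchy (\<lambda>k. g k x)"
proof (rule metric_CauchyI)
  fix e :: real assume e: "0 < e"
  obtain j where j: "dist (denseq j) x < e / 3" using denseq[of "e / 3"] e by auto
  obtain M where M: "\<And>m n. m \<ge> M \<Longrightarrow> n \<ge> M \<Longrightarrow> dist (g m (denseq j)) (g n (denseq j)) < e / 3"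
    using metric_CauchyD[OF C, of "e / 3" j] e by auto
  have "dist (g m x) (g n x) < e" if "m \<ge> M" "n \<ge> M" for m n
  proof -
    have "dist (g m x) (g n x) \<le> dist (g m x) (g m (denseq j)) + dist (g m (denseq j)) (g n (denseq j))
        + dist (g n (denseq j)) (g n x)"
      by (smt (verit) dist_triangle)
    then show ?thesis using M[OF that] j g by (simp add: dist_commute)
  qed
  then show "\<exists>M. \<forall>m\<ge>M. \<forall>n\<ge>M. dist (g m x) (g n x) < e" by blast
qed

text \<open>The error of \<open>iv (g k)\<close> at \<open>x\<close> is the error of
  \<open>g k\<close> at \<open>iv h x\<close>.\<close>

lemma Isom_tendsto_iv:
  assumes g: "\<And>k. g k \<in> Isom" "h \<in> Isom" and lim: "\<And>x. (\<lambda>k. g k x) \<longlonglongrightarrow> h x"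
  shows "(\<lambda>k. iv (g k) x) \<longlonglongrightarrow> iv h x"
proof -
  have "(\<lambda>k. dist (g k (iv h x)) x) \<longlonglongrightarrow> 0"
    using tendsto_dist[OF lim[of "iv h x"] tendsto_const[of x]] g by simp
  moreover have "dist (g k (iv h x)) x = dist (iv (g k) x) (iv h x)" for k
    using dist_inv_left[OF g(1)] dist_commute by metis
  ultimately have "(\<lambda>k. dist (iv (g k) x) (iv h x)) \<longlonglongrightarrow> 0" by simp
  then show ?thesis by (subst tendsto_dist_iff)
qed

text \<open>A pointwise limit of isometries preserves distances but may fail to be onto; convergence
  of the inverses supplies the preimage of \<open>y\<close> as the limit of
  \<open>iv (g k) y\<close>.\<close>

lemma Isom_limit:
  fixes g :: "nat \<Rightarrow> 'a::polish_space \<Rightarrow> 'a"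
  assumes g: "\<And>k. g k \<in> Isom"
    and C: "\<And>j. Cauchy (\<lambda>k. g k (denseq j))" "\<And>j. Cauchy (\<lambda>k. iv (g k) (denseq j))"
  obtains h where "h \<in> Isom" "\<And>x. (\<lambda>k. g k x) \<longlonglongrightarrow> h x"
proof -
  have "\<exists>l. (\<lambda>k. g k x) \<longlonglongrightarrow> l" for x
    using Isom_Cauchy_from_dense[OF g C(1)] Cauchy_convergent convergent_def by blast
  then obtain h where h: "\<And>x. (\<lambda>k. g k x) \<longlonglongrightarrow> h x" by metis
  have "h \<in> Isom"
  proof (rule Isom_I)
    fix x y
    have "(\<lambda>k. dist (g k x) (g k y)) \<longlonglongrightarrow> dist (h x) (h y)" by (intro tendsto_dist h)
    then show "dist (h x) (h y) = dist x y" using g by (simp add: LIMSEQ_const_iff)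
    have "Cauchy (\<lambda>k. iv (g k) y)" by (rule Isom_Cauchy_from_dense) (use g C in auto)
    then obtain z where z: "(\<lambda>k. iv (g k) y) \<longlonglongrightarrow> z" using Cauchy_convergent convergent_def by blast
    have "(\<lambda>k. dist (iv (g k) y) z) \<longlonglongrightarrow> 0" using z by (subst (asm) tendsto_dist_iff)
    moreover have "dist (iv (g k) y) z = dist (g k z) y" for k
      using dist_inv_left[OF g] dist_commute by metis
    ultimately have "(\<lambda>k. dist (g k z) y) \<longlonglongrightarrow> 0" by simp
    then have "(\<lambda>k. g k z) \<longlonglongrightarrow> y" by (subst tendsto_dist_iff)
    then have "h z = y" using h LIMSEQ_unique by blast
    then show "\<exists>x. h x = y" by blast
  qed
  then show ?thesis using that h by blast
qed

text \<open>An isometry is encoded by its values and those of its inverse on a dense sequence.\<close>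

lemma completely_metrizable_Isom:
  "completely_metrizable_space (Isom_topology :: ('a::polish_space \<Rightarrow> 'a) topology)"
proof -
  define \<Phi> where "\<Phi> g = (\<lambda>j. g (denseq j), \<lambda>j. iv g (denseq j))" for g :: "'a \<Rightarrow> 'a"
  define C where "C = \<Phi> ` (Isom :: ('a \<Rightarrow> 'a) set)"
  have coord: "continuous_on UNIV (\<lambda>p :: (nat \<Rightarrow> 'a) \<times> (nat \<Rightarrow> 'a). fst p j)"
    "continuous_on UNIV (\<lambda>p :: (nat \<Rightarrow> 'a) \<times> (nat \<Rightarrow> 'a). snd p j)" for j
    by (rule continuous_on_compose2[OF continuous_on_product_coordinates continuous_on_fst[OF continuous_on_id] subset_UNIV],
        rule continuous_on_compose2[OF continuous_on_product_coordinates continuous_on_snd[OF continuous_on_id] subset_UNIV])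
  have "closed C"
    unfolding closed_sequential_limits
  proof (intro allI impI, elim conjE)
    fix s l assume s: "\<forall>n. s n \<in> C" and l: "s \<longlonglongrightarrow> l"
    then obtain g where g: "\<And>n. g n \<in> Isom" "\<And>n. s n = \<Phi> (g n)" unfolding C_def image_iff by metis
    have l1: "(\<lambda>n. fst (s n) j) \<longlonglongrightarrow> fst l j" and l2: "(\<lambda>n. snd (s n) j) \<longlonglongrightarrow> snd l j" for j
      using continuous_on_tendsto_compose[OF coord(1) l] continuous_on_tendsto_compose[OF coord(2) l] by auto
    have 1: "(\<lambda>n. g n (denseq j)) \<longlonglongrightarrow> fst l j" and 2: "(\<lambda>n. iv (g n) (denseq j)) \<longlonglongrightarrow> snd l j" for j
      using l1[of j] l2[of j] by (simp_all add: g(2) \<Phi>_def)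
    obtain h where h: "h \<in> Isom" "\<And>x. (\<lambda>k. g k x) \<longlonglongrightarrow> h x"
      using Isom_limit[OF g(1) LIMSEQ_imp_Cauchy[OF 1] LIMSEQ_imp_Cauchy[OF 2]] by blast
    have "fst l j = h (denseq j)" for j using LIMSEQ_unique[OF 1 h(2)] .
    moreover have "snd l j = iv h (denseq j)" for j
      using LIMSEQ_unique[OF 2 Isom_tendsto_iv[OF g(1) h]] .
    ultimately have "l = \<Phi> h" by (simp add: \<Phi>_def prod_eq_iff fun_eq_iff)
    then show "l \<in> C" using h by (simp add: C_def)
  qed
  then have "completely_metrizable_space (top_of_set C)"
    by (intro completely_metrizable_space_closedin completely_metrizable_space_euclidean) simp
  moreover have "homeomorphic_map Isom_topology (top_of_set C) \<Phi>"
  proof (rule bijective_open_imp_homeomorphic_map)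
    have ev: "continuous_on Isom (\<lambda>g :: 'a \<Rightarrow> 'a. g x)" for x
      by (rule continuous_on_subset[OF continuous_on_product_coordinates]) simp
    have "continuous_on Isom (\<lambda>g :: 'a \<Rightarrow> 'a. iv g x)" for x
      unfolding continuous_on_def
    proof
      fix g :: "'a \<Rightarrow> 'a" assume g: "g \<in> Isom"
      have "((\<lambda>h. dist (h (iv g x)) x) \<longlongrightarrow> dist (g (iv g x)) x) (at g within Isom)"
        using ev[of "iv g x"] g unfolding continuous_on_def by (intro tendsto_dist tendsto_const) blast
      then have "((\<lambda>h. dist (h (iv g x)) x) \<longlongrightarrow> 0) (at g within Isom)" using g by simp
      moreover have "\<forall>\<^sub>F h in at g within Isom. dist (h (iv g x)) x = dist (iv h x) (iv g x)"
        unfolding eventually_at_filter by (rule always_eventually) (metis dist_inv_left dist_commute)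
      ultimately have "((\<lambda>h. dist (iv h x) (iv g x)) \<longlongrightarrow> 0) (at g within Isom)"
        by (rule Lim_transform_eventually)
      then show "((\<lambda>h. iv h x) \<longlongrightarrow> iv g x) (at g within Isom)" by (subst tendsto_dist_iff)
    qed
    then have "continuous_on Isom \<Phi>"
      unfolding \<Phi>_def using ev by (intro continuous_on_Pair continuous_on_coordinatewise_then_product)
    then show "continuous_map Isom_topology (top_of_set C) \<Phi>"
      by (simp add: Isom_topology_def C_def continuous_map_in_subtopology continuous_map_iff_continuous)
    show "\<Phi> ` topspace Isom_topology = topspace (top_of_set C)" by (simp add: C_def)
    have ext: "g x = h x" if gh: "\<Phi> g = \<Phi> h" "g \<in> Isom" "h \<in> Isom" for g h :: "'a \<Rightarrow> 'a" and x
    proof (rule ccontr)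
      assume "g x \<noteq> h x"
      then obtain j where j: "dist (denseq j) x < dist (g x) (h x) / 2" using denseq[of "dist (g x) (h x) / 2" x] by auto
      have "g (denseq j) = h (denseq j)" using gh(1) by (simp add: \<Phi>_def fun_eq_iff)
      then have "dist (g x) (h x) \<le> dist (g (denseq j)) (g x) + dist (h (denseq j)) (h x)"
        by (metis dist_commute dist_triangle)
      then show False using j gh by simp
    qed
    then show "inj_on \<Phi> (topspace Isom_topology)" by (auto simp: inj_on_def)
    show "open_map Isom_topology (top_of_set C) \<Phi>"
      unfolding open_map_def
    proof (intro allI impI)
      fix U :: "('a \<Rightarrow> 'a) set" assume U: "openin Isom_topology U"
      then have UI: "U \<subseteq> Isom" by (simp add: openin_Isom_topology)
      have "\<exists>T. openin (top_of_set C) T \<and> \<Phi> g \<in> T \<and> T \<subseteq> \<Phi> ` U" if g: "g \<in> U" for g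
      proof -
        obtain P where P: "bfam P" "nbhd g P \<inter> Isom \<subseteq> U" using U g by (auto simp: openin_Isom_topology)
        \<comment> \<open>A condition at \<open>x\<close> of radius \<open>r\<close> follows from
          one of radius \<open>r / 3\<close> at a term of the sequence within \<open>r / 3\<close>
          of \<open>x\<close>, as three errors below \<open>r / 3\<close> are added.\<close>
        have "\<exists>j. dist (denseq j) (fst p) < snd p / 3" if "p \<in> P" for p
          using denseq[of "snd p / 3" "fst p"] that P(1) by (auto simp: bfam_def)
        then obtain j where j: "\<And>p. p \<in> P \<Longrightarrow> dist (denseq (j p)) (fst p) < snd p / 3" by metis
        define T where "T = (\<Inter>p\<in>P. {a :: (nat \<Rightarrow> 'a) \<times> (nat \<Rightarrow> 'a). dist (fst a (j p)) (g (denseq (j p))) < snd p / 3})"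
        have "open T"
          unfolding T_def using P(1)
          by (intro open_INT) (auto simp: bfam_def intro!: open_Collect_less continuous_intros coord)
        moreover have "\<Phi> g \<in> T" using P(1) by (auto simp: T_def \<Phi>_def bfam_def)
        moreover have "C \<inter> T \<subseteq> \<Phi> ` U"
        proof
          fix a assume a: "a \<in> C \<inter> T"
          then obtain h where h: "h \<in> Isom" "a = \<Phi> h" by (auto simp: C_def)
          have "h \<in> nbhd g P"
            unfolding nbhd_def
          proof (intro CollectI ballI, clarify)
            fix x r assume xr: "(x, r) \<in> P"
            define y :: 'a where "y = denseq (j (x, r))"
            have "dist (h y) (g y) < r / 3" using a xr by (force simp: T_def h \<Phi>_def y_def)
            moreover have "dist y x < r / 3" using j[OF xr] by (simp add: y_def)
            moreover have "dist (h x) (g x) \<le> dist (h x) (h y) + dist (h y) (g y) + dist (g y) (g x)"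
              by (smt (verit) dist_triangle)
            ultimately show "dist (h x) (g x) < r" using h g UI by (simp add: dist_commute subset_iff)
          qed
          then show "a \<in> \<Phi> ` U" using P(2) h by blast
        qed
        ultimately show ?thesis using g UI by (intro exI[of _ "C \<inter> T"]) (auto simp: C_def openin_open_Int)
      qed
      then show "openin (top_of_set C) (\<Phi> ` U)" by (subst openin_subopen) auto
    qed
  qed
  ultimately show ?thesis
    using homeomorphic_completely_metrizable_space homeomorphic_map_imp_homeomorphic_space by blast
qed

section \<open>Nowhere dense sets and the Baire category theorem\<close>

lemma nowhere_dense_inI:
  assumes "S \<subseteq> topspace T" and "\<And>U. openin T U \<Longrightarrow> U \<noteq> {} \<Longrightarrow> \<exists>U'. openin T U' \<and> U' \<noteq> {} \<and> U' \<subseteq> U \<and> U' \<inter> S = {}"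
  shows "nowhere_dense_in T S"
  unfolding nowhere_dense_in_def
proof (intro conjI assms(1), rule ccontr)
  define W where "W = T interior_of (T closure_of S)"
  assume "T interior_of (T closure_of S) \<noteq> {}"
  then obtain U where U: "openin T U" "U \<noteq> {}" "U \<subseteq> W" "U \<inter> S = {}"
    using assms(2)[of W] by (auto simp: W_def)
  then have "U \<inter> T closure_of S = {}" by (simp add: openin_Int_closure_of_eq_empty)
  moreover have "W \<subseteq> T closure_of S" by (simp add: W_def interior_of_subset)
  ultimately show False using U by blast
qed

lemma nonempty_open_not_meager:
  assumes T: "completely_metrizable_space T" and U: "openin T U" "U \<noteq> {}"
  shows "\<not> meager_in T U"
proof
  assume "meager_in T U"
  then obtain \<N> where N: "countable \<N>" "\<And>N. N \<in> \<N> \<Longrightarrow> nowhere_dense_in T N" "U = \<Union>\<N>"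
    by (auto simp: meager_in_def)
  have "T interior_of \<Union>((closure_of) T ` \<N>) = {}"
    using T N by (intro Baire_category_alt) (auto simp: nowhere_dense_in_def)
  moreover have "U \<subseteq> \<Union>((closure_of) T ` \<N>)"
    using N closure_of_subset by (fastforce simp: nowhere_dense_in_def)
  then have "U \<subseteq> T interior_of \<Union>((closure_of) T ` \<N>)" using U by (simp add: interior_of_maximal)
  ultimately show False using U by simp
qed

section \<open>Generic tuples\<close>

lemma nbhd_iff_coset: "g \<in> Isom \<Longrightarrow> h \<in> Isom \<Longrightarrow> h \<in> nbhd g Q \<longleftrightarrow> iv g \<circ> h \<in> stab Q"
  by (auto simp: nbhd_def stab_def dist_inv_left)

lemma normalizes_comp:
  assumes "a \<in> Isom" "b \<in> Isom" "normalizes a H" "normalizes b H"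
  shows "normalizes (a \<circ> b) H"
  unfolding normalizes_def
proof
  fix g assume g: "g \<in> H"
  have "a \<circ> b \<circ> g \<circ> iv (a \<circ> b) = a \<circ> (b \<circ> g \<circ> iv b) \<circ> iv a"
    "iv (a \<circ> b) \<circ> g \<circ> (a \<circ> b) = iv b \<circ> (iv a \<circ> g \<circ> a) \<circ> b"
    using assms by (simp_all add: inv_comp_distrib_Isom comp_assoc)
  then show "a \<circ> b \<circ> g \<circ> iv (a \<circ> b) \<in> H \<and> iv (a \<circ> b) \<circ> g \<circ> (a \<circ> b) \<in> H"
    using assms g by (simp add: normalizes_def)
qed

lemma normalizes_stab: "ultrametric TYPE('a::metric_space) \<Longrightarrow> u \<in> stab (Q :: ('a \<times> real) set) \<Longrightarrow> normalizes u (stab Q)"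
proof -
  assume "ultrametric TYPE('a)" and u: "u \<in> stab Q"
  then interpret ultrametric_type "TYPE('a)" by unfold_locales
  show ?thesis using u by (auto simp: normalizes_def intro!: stab_comp stab_inv)
qed

locale extremal_group = ultrametric_type ty for ty :: "'a::polish_space itself" +
  fixes P0 :: "('a \<times> real) set" and I :: "nat set"
  assumes P0: "bfam P0" "extr (stab P0)" and I: "finite I"
    and ex: "\<And>P :: ('a \<times> real) set. bfam P \<Longrightarrow> \<exists>P'. bfam P' \<and> stab P' \<subseteq> stab P \<and> extr (stab P')"
begin

definition H0 :: "('a \<Rightarrow> 'a) set" where "H0 = stab P0"

definition Y :: "(nat \<Rightarrow> 'a \<Rightarrow> 'a) set" where "Y = (I \<rightarrow>\<^sub>E H0)"

definition T :: "(nat \<Rightarrow> 'a \<Rightarrow> 'a) topology" where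
  "T = product_topology (\<lambda>_. subtopology Isom_topology H0) I"

definition act :: "('a \<Rightarrow> 'a) \<Rightarrow> (nat \<Rightarrow> 'a \<Rightarrow> 'a) \<Rightarrow> nat \<Rightarrow> 'a \<Rightarrow> 'a" where
  "act v y = (\<lambda>i\<in>I. v \<circ> y i \<circ> iv v)"

text \<open>For \<open>y\<close> in \<open>Y\<close> these are the tuples of \<open>Y\<close> with
  entries in the left cosets of \<open>stab P\<close> given by \<open>y\<close>; they form a
  neighborhood basis of \<open>y\<close> in \<open>T\<close> as \<open>P\<close> varies.\<close>

definition NN :: "(nat \<Rightarrow> 'a \<Rightarrow> 'a) \<Rightarrow> ('a \<times> real) set \<Rightarrow> (nat \<Rightarrow> 'a \<Rightarrow> 'a) set" where
  "NN y P = {z \<in> Y. \<forall>i\<in>I. z i \<in> nbhd (y i) P}"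

text \<open>For finite \<open>F\<close> these are subgroups, and they form a neighborhood basis of
  the identity in \<open>H0\<close>.\<close>

definition VV :: "'a set \<Rightarrow> nat \<Rightarrow> ('a \<Rightarrow> 'a) set" where
  "VV F m = {g \<in> H0. \<forall>x\<in>F. dist (g x) x < 1 / Suc m}"

text \<open>The families over which \<open>y\<close> can be amalgamated with every tuple of
  \<open>NN y Q\<close>.\<close>

definition good :: "(nat \<Rightarrow> 'a \<Rightarrow> 'a) \<Rightarrow> ('a \<times> real) set \<Rightarrow> bool" where
  "good y Q \<longleftrightarrow> bfam Q \<and> extr (stab Q) \<and> stab Q \<subseteq> H0 \<and> (\<forall>i\<in>I. normalizes (y i) (stab Q))"

text \<open>The first condition provides arbitrarily small neighborhoods \<open>NN y Q\<close> of \<open>y\<close> to which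
  amalgamation applies, the second says that the orbit of \<open>y\<close> under \<open>VV F m\<close> is dense in \<open>NN y Q\<close>.\<close>

definition generic :: "(nat \<Rightarrow> 'a \<Rightarrow> 'a) \<Rightarrow> bool" where
  "generic y \<longleftrightarrow> y \<in> Y \<and> (\<forall>F m. finite F \<longrightarrow> (\<exists>Q. good y Q \<and> stab Q \<subseteq> VV F m)) \<and>
    (\<forall>F m Q k R. finite F \<and> good y Q \<and> stab Q \<subseteq> VV F m \<and> k \<in> NN y Q \<and> bfam R \<longrightarrow>
      (\<exists>w\<in>VV F m. act w y \<in> NN k R))"

lemma H0_Isom: "g \<in> H0 \<Longrightarrow> g \<in> Isom"
  by (simp add: H0_def stab_Isom)

lemma H0_comp: "g \<in> H0 \<Longrightarrow> h \<in> H0 \<Longrightarrow> g \<circ> h \<in> H0"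
  by (simp add: H0_def stab_comp)

lemma H0_iv: "g \<in> H0 \<Longrightarrow> iv g \<in> H0"
  by (simp add: H0_def stab_inv)

lemma H0_id: "id \<in> H0"
  by (simp add: H0_def stab_id P0)

lemma Y_H0: "y \<in> Y \<Longrightarrow> i \<in> I \<Longrightarrow> y i \<in> H0"
  by (auto simp: Y_def)

lemma Y_Isom: "y \<in> Y \<Longrightarrow> i \<in> I \<Longrightarrow> y i \<in> Isom"
  using Y_H0 H0_Isom by blast

lemma Y_eqI: "y \<in> Y \<Longrightarrow> z \<in> Y \<Longrightarrow> (\<And>i x. i \<in> I \<Longrightarrow> y i x = z i x) \<Longrightarrow> y = z"
  unfolding Y_def by (rule PiE_ext) auto

lemma openin_T: "openin T U \<longleftrightarrow> U \<subseteq> Y \<and> (\<forall>y\<in>U. \<exists>P. bfam P \<and> NN y P \<subseteq> U)"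
  unfolding T_def Y_def NN_def by (rule openin_product_Isom) (auto simp: H0_Isom I)

lemma topspace_T: "topspace T = Y"
  using H0_Isom by (auto simp: T_def Y_def PiE_iff)

lemma NN_Y: "z \<in> NN y P \<Longrightarrow> z \<in> Y"
  by (simp add: NN_def)

lemma NN_coset: "y \<in> Y \<Longrightarrow> z \<in> NN y P \<longleftrightarrow> z \<in> Y \<and> (\<forall>i\<in>I. iv (y i) \<circ> z i \<in> stab P)"
proof -
  assume y: "y \<in> Y"
  have "z i \<in> nbhd (y i) P \<longleftrightarrow> iv (y i) \<circ> z i \<in> stab P" if "z \<in> Y" "i \<in> I" for i
    using nbhd_iff_coset[OF Y_Isom[OF y that(2)] Y_Isom[OF that]] .
  then show ?thesis by (auto simp: NN_def)
qed

lemma NN_apply: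
  assumes "y \<in> Y" "z \<in> NN y Q" "stab Q \<subseteq> VV F m" "x \<in> F" "i \<in> I"
  shows "dist (z i x) (y i x) < 1 / Suc m"
proof -
  have "iv (y i) \<circ> z i \<in> VV F m" using assms NN_coset by blast
  then have "dist ((iv (y i) \<circ> z i) x) x < 1 / Suc m" using assms unfolding VV_def by blast
  then show ?thesis using Y_Isom[OF assms(1,5)] by (simp add: dist_inv_left)
qed

lemma act_Y: "v \<in> H0 \<Longrightarrow> y \<in> Y \<Longrightarrow> act v y \<in> Y"
  by (auto simp: act_def Y_def intro!: H0_comp H0_iv)

lemma act_apply: "i \<in> I \<Longrightarrow> act v y i x = v (y i (iv v x))"
  by (simp add: act_def)

lemma act_comp: "v \<in> H0 \<Longrightarrow> w \<in> H0 \<Longrightarrow> y \<in> Y \<Longrightarrow> act w (act v y) = act (w \<circ> v) y"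
  by (rule Y_eqI) (auto simp: act_Y H0_comp act_apply inv_comp_distrib_Isom H0_Isom)

lemma act_id: "y \<in> Y \<Longrightarrow> act id y = y"
  by (rule Y_eqI) (auto simp: act_Y H0_id act_apply inv_id[unfolded id_def[symmetric]])

lemma act_iv: "v \<in> H0 \<Longrightarrow> y \<in> Y \<Longrightarrow> act (iv v) (act v y) = y"
  by (simp add: act_comp H0_iv act_id H0_Isom)

lemma act_NN:
  assumes v: "v \<in> H0" and z: "z \<in> NN y P"
  shows "act v z \<in> NN (act v y) (translate v P)"
  using assms H0_Isom[OF v] unfolding NN_def nbhd_def translate_def
  by (auto simp: act_apply act_Y) blast

lemma act_good:
  assumes v: "v \<in> H0" and y: "y \<in> Y" and Q: "good y Q"
  shows "good (act v y) (translate v Q)"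
proof -
  have vI: "v \<in> Isom" using v by (rule H0_Isom)
  have st: "h \<in> stab (translate v Q) \<longleftrightarrow> h \<in> Isom \<and> iv v \<circ> h \<circ> v \<in> stab Q" for h
    using stab_translate[OF vI] stab_Isom by blast
  have "h \<in> H0" if h: "h \<in> stab (translate v Q)" for h
  proof -
    have "iv v \<circ> h \<circ> v \<in> H0" using h st Q by (auto simp: good_def)
    from H0_comp[OF H0_comp[OF v this] H0_iv[OF v]] have "v \<circ> (iv v \<circ> h \<circ> v) \<circ> iv v \<in> H0" .
    moreover have "v \<circ> (iv v \<circ> h \<circ> v) \<circ> iv v = h" using vI by (auto simp: fun_eq_iff)
    ultimately show ?thesis by simp
  qed
  moreover have "normalizes (act v y i) (stab (translate v Q))" if i: "i \<in> I" for i
    unfolding normalizes_def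
  proof
    fix h assume h: "h \<in> stab (translate v Q)"
    have yI: "y i \<in> Isom" using y i by (rule Y_Isom)
    have n: "normalizes (y i) (stab Q)" using Q i by (simp add: good_def)
    define k where "k = iv v \<circ> h \<circ> v"
    have k: "k \<in> stab Q" "h \<in> Isom" using h st by (auto simp: k_def)
    have iva: "iv (v \<circ> y i \<circ> iv v) = v \<circ> iv (y i) \<circ> iv v"
      using vI yI by (simp add: inv_comp_distrib_Isom comp_assoc)
    have "iv v \<circ> (act v y i \<circ> h \<circ> iv (act v y i)) \<circ> v = y i \<circ> k \<circ> iv (y i)"
      "iv v \<circ> (iv (act v y i) \<circ> h \<circ> act v y i) \<circ> v = iv (y i) \<circ> k \<circ> y i"
      using vI i by (simp_all add: act_def iva k_def fun_eq_iff)
    then show "act v y i \<circ> h \<circ> iv (act v y i) \<in> stab (translate v Q) \<and>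
        iv (act v y i) \<circ> h \<circ> act v y i \<in> stab (translate v Q)"
      using n k vI yI i by (simp add: st normalizes_def act_def)
  qed
  ultimately show ?thesis
    using Q bfam_translate[of Q v] extr_translate[OF vI, of Q] by (auto simp: good_def)
qed

lemma translate_iv: "v \<in> Isom \<Longrightarrow> translate v (translate (iv v) P) = P" "v \<in> Isom \<Longrightarrow> translate (iv v) (translate v P) = P"
  by (force simp: translate_def)+

text \<open>The entries of \<open>z\<close> differ from those of \<open>y\<close> by elements of
  \<open>stab Q\<close>, which normalize \<open>stab Q\<close>. Consequently the set
  \<open>U1\<close> below is open.\<close>

lemma good_NN:
  assumes "y \<in> Y" "good y Q" "z \<in> NN y Q"
  shows "good z Q"
proof -
  have "normalizes (z i) (stab Q)" if i: "i \<in> I" for i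
  proof -
    define u where "u = iv (y i) \<circ> z i"
    have u: "u \<in> stab Q" using NN_coset assms i by (simp add: u_def)
    have yI: "y i \<in> Isom" using assms i Y_Isom by blast
    have "z i = y i \<circ> u" using yI by (auto simp: u_def fun_eq_iff)
    moreover have "normalizes (y i) (stab Q)" using assms i by (simp add: good_def)
    ultimately show ?thesis
      using normalizes_comp[OF yI stab_Isom[OF u]] normalizes_stab[OF ultra u] by simp
  qed
  then show ?thesis using assms by (simp add: good_def)
qed

lemma VV_stab: "VV F m = stab (P0 \<union> (\<lambda>x. (x, 1 / Suc m)) ` F)"
  by (auto simp: VV_def H0_def stab_def)

lemma bfam_VV: "finite F \<Longrightarrow> bfam (P0 \<union> (\<lambda>x. (x, 1 / Suc m)) ` F)"
  using P0 by (auto simp: bfam_def)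

lemma VV_iv: "g \<in> VV F m \<Longrightarrow> iv g \<in> VV F m"
  unfolding VV_stab by (rule stab_inv)

lemma VV_H0: "g \<in> VV F m \<Longrightarrow> g \<in> H0"
  by (simp add: VV_def)

text \<open>Only the balls of radius \<open>1 / Suc m\<close> around the points of \<open>F\<close>
  matter, and any point of such a ball is a center of it. So countably many sets \<open>F\<close>
  suffice.\<close>

lemma VV_denseq:
  assumes "finite F"
  obtains N where "finite N" "VV (denseq ` N) m = VV F m"
proof -
  obtain c where c: "\<And>x :: 'a. dist (denseq (c x)) x < 1 / Suc m" using denseq[of "1 / Suc m"] by (metis of_nat_0_less_iff zero_less_Suc zero_less_divide_1_iff)
  have "dist (g (denseq (c x))) (denseq (c x)) < 1 / Suc m \<longleftrightarrow> dist (g x) x < 1 / Suc m" if "g \<in> H0" for g x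
    using fixes_ball_cong[OF c[of x], of "{g}"] H0_Isom[OF that] by (simp add: fixes_ball_def)
  then have "VV (denseq ` c ` F) m = VV F m" by (auto simp: VV_def)
  then show ?thesis using that[of "c ` F"] assms by simp
qed

lemma VV_conj:
  assumes v: "v \<in> H0" and g: "g \<in> VV (iv v ` F) m"
  shows "v \<circ> g \<circ> iv v \<in> VV F m"
  using assms H0_Isom[OF v] unfolding VV_def by (auto intro!: H0_comp H0_iv simp: dist_inv_right)

lemma VV_conj':
  assumes v: "v \<in> H0" and g: "g \<in> VV F m"
  shows "iv v \<circ> g \<circ> v \<in> VV (iv v ` F) m"
  using assms H0_Isom[OF v] unfolding VV_def by (auto intro!: H0_comp H0_iv)

text \<open>Conjugation by \<open>v\<close> carries the whole definition along, with
  \<open>F\<close> replaced by its preimage under \<open>v\<close>.\<close>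

lemma generic_act:
  assumes y: "generic y" and v: "v \<in> H0"
  shows "generic (act v y)"
  unfolding generic_def
proof (intro conjI allI impI)
  have vI: "v \<in> Isom" using v by (rule H0_Isom)
  have yY: "y \<in> Y" using y by (simp add: generic_def)
  show "act v y \<in> Y" using v yY by (rule act_Y)
  fix F :: "'a set" and m
  show "\<exists>Q. good (act v y) Q \<and> stab Q \<subseteq> VV F m" if F: "finite F"
  proof -
    obtain Q where Q: "good y Q" "stab Q \<subseteq> VV (iv v ` F) m" using y F unfolding generic_def by blast
    have "stab (translate v Q) \<subseteq> VV F m"
    proof
      fix h assume h: "h \<in> stab (translate v Q)"
      then have "iv v \<circ> h \<circ> v \<in> VV (iv v ` F) m" using stab_translate[OF vI stab_Isom[OF h]] Q by blast
      then have "v \<circ> (iv v \<circ> h \<circ> v) \<circ> iv v \<in> VV F m" by (rule VV_conj[OF v])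
      moreover have "v \<circ> (iv v \<circ> h \<circ> v) \<circ> iv v = h" using vI by (auto simp: fun_eq_iff)
      ultimately show "h \<in> VV F m" by simp
    qed
    then show ?thesis using act_good[OF v yY Q(1)] by blast
  qed
  fix Q R :: "('a \<times> real) set" and k
  assume *: "finite F \<and> good (act v y) Q \<and> stab Q \<subseteq> VV F m \<and> k \<in> NN (act v y) Q \<and> bfam R"
  define Q1 where "Q1 = translate (iv v) Q"
  have vi: "iv v \<in> H0" by (rule H0_iv[OF v])
  have "good y Q1" using act_good[OF vi act_Y[OF v yY], of Q] * by (simp add: act_iv[OF v yY] Q1_def)
  moreover have "stab Q1 \<subseteq> VV (iv v ` F) m"
  proof
    fix h assume h: "h \<in> stab Q1"
    then have "v \<circ> h \<circ> iv v \<in> stab Q"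
      using stab_translate[OF inv_Isom[OF vI] stab_Isom[OF h], of Q] vI by (simp add: Q1_def)
    then have "iv v \<circ> (v \<circ> h \<circ> iv v) \<circ> v \<in> VV (iv v ` F) m" using * by (intro VV_conj'[OF v]) blast
    moreover have "iv v \<circ> (v \<circ> h \<circ> iv v) \<circ> v = h" using vI by (auto simp: fun_eq_iff)
    ultimately show "h \<in> VV (iv v ` F) m" by simp
  qed
  moreover have "act (iv v) k \<in> NN y Q1"
    using act_NN[OF vi, of k "act v y" Q] * by (simp add: act_iv[OF v yY] Q1_def)
  moreover have "bfam (translate (iv v) R)" using * by (simp add: bfam_translate)
  moreover have "finite (iv v ` F)" using * by simp
  ultimately obtain w where w: "w \<in> VV (iv v ` F) m" "act w y \<in> NN (act (iv v) k) (translate (iv v) R)"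
    using y unfolding generic_def by blast
  have kY: "k \<in> Y" using * NN_Y by blast
  have wH: "w \<in> H0" using w VV_H0 by blast
  have "act v (act w y) \<in> NN k R"
    using act_NN[OF v w(2)] act_iv[OF vi kY] vI by (simp add: translate_iv)
  moreover have "act (v \<circ> w \<circ> iv v) (act v y) = act v (act w y)"
  proof -
    have "v \<circ> w \<circ> iv v \<circ> v = v \<circ> w" using vI by (auto simp: fun_eq_iff)
    then show ?thesis using v wH vi yY by (simp add: act_comp H0_comp)
  qed
  ultimately show "\<exists>w\<in>VV F m. act w (act v y) \<in> NN k R" using VV_conj[OF v w(1)] by metis
qed

subsection \<open>Generic tuples are conjugate\<close>

text \<open>In an ultrametric space it is enough that the steps tend to zero; they need not be
  summable.\<close>

lemma Cauchy_ultra: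
  assumes "\<And>k. k \<ge> j \<Longrightarrow> dist (s (Suc k)) (s k :: 'a) < 1 / Suc k"
  shows "Cauchy s"
proof (rule metric_CauchyI)
  fix e :: real assume "0 < e"
  then obtain M where M: "1 / Suc M < e" using nat_approx_posE by blast
  define K where "K = max M j"
  have K: "1 / Suc k < e" if "k \<ge> K" for k
  proof -
    have "1 / Suc k \<le> 1 / Suc M" using that by (intro divide_left_mono) (auto simp: K_def)
    then show ?thesis using M by linarith
  qed
  have near: "dist (s k) (s K) < e" if "k \<ge> K" for k
    using that
  proof (induction k rule: dec_induct)
    case base then show ?case using \<open>0 < e\<close> by simp
  next
    case (step k)
    then have "dist (s (Suc k)) (s k) < e" using assms[of k] K[of k] by (simp add: K_def)
    then show ?case using step by (rule_tac ultra_less) auto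
  qed
  show "\<exists>M. \<forall>m\<ge>M. \<forall>n\<ge>M. dist (s m) (s n) < e"
    using near ultra_less[of _ "s K" e] by (metis dist_commute)
qed

lemma H0_limit:
  assumes g: "\<And>k. g k \<in> H0" and d: "\<And>k j. j \<le> k \<Longrightarrow> dist (g (Suc k) (denseq j)) (g k (denseq j)) < 1 / Suc k"
    "\<And>k j. j \<le> k \<Longrightarrow> dist (iv (g (Suc k)) (denseq j)) (iv (g k) (denseq j)) < 1 / Suc k"
  obtains h where "h \<in> H0" "\<And>x. (\<lambda>k. g k x) \<longlonglongrightarrow> h x"
proof -
  have gI: "g k \<in> Isom" for k using g H0_Isom by blast
  obtain h where h: "h \<in> Isom" "\<And>x. (\<lambda>k. g k x) \<longlonglongrightarrow> h x"
  proof (rule Isom_limit[OF gI])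
    show "Cauchy (\<lambda>k. g k (denseq j))" for j by (rule Cauchy_ultra[of j]) (rule d(1))
    show "Cauchy (\<lambda>k. iv (g k) (denseq j))" for j by (rule Cauchy_ultra[of j]) (rule d(2))
  qed blast
  have "h \<in> stab P0"
  proof (rule stabI[OF h(1)])
    fix x r assume x: "(x, r) \<in> P0"
    then have "r > 0" using P0 by (auto simp: bfam_def)
    then obtain k where "dist (g k x) (h x) < r" using metric_LIMSEQ_D[OF h(2)[of x]] by blast
    moreover have "dist (g k x) x < r" using g[of k] x by (auto simp: H0_def stab_dist)
    ultimately show "dist (h x) x < r" using ultra_less[of "h x" "g k x" r x] by (simp add: dist_commute)
  qed
  then show ?thesis using that h by (simp add: H0_def)
qed

lemma act_tendsto:
  assumes a: "\<And>k. a k \<in> H0" "\<alpha> \<in> H0" and lim: "\<And>x. (\<lambda>k. a k x) \<longlonglongrightarrow> \<alpha> x" and y: "y \<in> Y" and i: "i \<in> I"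
  shows "(\<lambda>k. act (a k) y i x) \<longlonglongrightarrow> act \<alpha> y i x"
proof -
  have aI: "a k \<in> Isom" "\<alpha> \<in> Isom" for k using a H0_Isom by blast+
  have yI: "y i \<in> Isom" using y i by (rule Y_Isom)
  have 1: "(\<lambda>k. dist (iv (a k) x) (iv \<alpha> x)) \<longlonglongrightarrow> 0"
    using Isom_tendsto_iv[OF aI lim] by (subst (asm) tendsto_dist_iff)
  have 2: "(\<lambda>k. dist (a k (y i (iv \<alpha> x))) (\<alpha> (y i (iv \<alpha> x)))) \<longlonglongrightarrow> 0"
    using lim by (subst (asm) tendsto_dist_iff)
  have "(\<lambda>k. dist (iv (a k) x) (iv \<alpha> x) + dist (a k (y i (iv \<alpha> x))) (\<alpha> (y i (iv \<alpha> x)))) \<longlonglongrightarrow> 0"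
    using tendsto_add[OF 1 2] by simp
  then have "(\<lambda>k. dist (act (a k) y i x) (act \<alpha> y i x)) \<longlonglongrightarrow> 0"
  proof (rule Lim_null_comparison[rotated])
    show "\<forall>\<^sub>F k in sequentially. norm (dist (act (a k) y i x) (act \<alpha> y i x))
        \<le> dist (iv (a k) x) (iv \<alpha> x) + dist (a k (y i (iv \<alpha> x))) (\<alpha> (y i (iv \<alpha> x)))"
    proof (rule always_eventually, rule allI)
      fix k
      have "dist (a k (y i (iv (a k) x))) (\<alpha> (y i (iv \<alpha> x)))
          \<le> dist (a k (y i (iv (a k) x))) (a k (y i (iv \<alpha> x))) + dist (a k (y i (iv \<alpha> x))) (\<alpha> (y i (iv \<alpha> x)))"
        by (rule dist_triangle)
      also have "dist (a k (y i (iv (a k) x))) (a k (y i (iv \<alpha> x))) = dist (iv (a k) x) (iv \<alpha> x)"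
        by (simp only: dist_Isom[OF aI(1)] dist_Isom[OF yI])
      finally show "norm (dist (act (a k) y i x) (act \<alpha> y i x))
        \<le> dist (iv (a k) x) (iv \<alpha> x) + dist (a k (y i (iv \<alpha> x))) (\<alpha> (y i (iv \<alpha> x)))"
        by (simp only: act_apply[OF i] norm_zero real_norm_def abs_of_nonneg[OF zero_le_dist])
    qed
  qed
  then show ?thesis by (subst tendsto_dist_iff)
qed

text \<open>Back and forth: in turn the tuple \<open>y\<close> and the tuple \<open>z\<close> are moved close to the other one. The
  next move is by an element that fixes the images of more and more points under the current
  conjugator, so both sequences of conjugators converge.\<close>

lemma generic_conjugate:
  assumes y: "generic y" and z: "generic z"
  obtains v where "v \<in> H0" "act v y = z"
proof -
  have Y: "y \<in> Y" "z \<in> Y" using y z by (auto simp: generic_def)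
  \<comment> \<open>If \<open>c' = w \<circ> c\<close>, then \<open>iv c'\<close> and
    \<open>iv c\<close> differ at \<open>denseq j\<close> by the displacement of
    \<open>denseq j\<close> under \<open>w\<close>, while \<open>c'\<close> and \<open>c\<close>
    differ there by the displacement of \<open>c (denseq j)\<close>. The two parts of the set
    control these errors.\<close>
  define D where "D k a = denseq ` {..k} \<union> (\<lambda>j. a (denseq j)) ` {..k}" for k :: nat and a :: "'a \<Rightarrow> 'a"
  have finD: "finite (D k a)" for k a by (simp add: D_def)
  define S where "S k = (\<lambda>(a, b, Q). a \<in> H0 \<and> b \<in> H0 \<and> good (act a y) Q \<and> act b z \<in> NN (act a y) Q \<and>
    stab Q \<subseteq> VV (D k a) k)" for k
  define near where "near k a a' \<longleftrightarrow> (\<exists>w\<in>VV (D k a) k. a' = w \<circ> a)" for k a a'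
  have gen: "generic (act a y)" "generic (act a z)" if "a \<in> H0" for a using generic_act y z that by blast+
  have genQ: "\<exists>Q. good u Q \<and> stab Q \<subseteq> VV F m" if "generic u" "finite F" for u F m
    using that by (simp add: generic_def)
  have genw: "\<exists>w\<in>VV F m. act w u \<in> NN k R"
    if "generic u" "finite F" "good u Q" "stab Q \<subseteq> VV F m" "k \<in> NN u Q" "bfam R" for u F m Q k R
    using that unfolding generic_def by blast
  have bfQ: "bfam Q" if "good u Q" for u Q using that by (simp add: good_def)
  have init: "\<exists>s. S 0 s"
  proof -
    obtain Q where Q: "good y Q" "stab Q \<subseteq> VV (D 0 id) 0" using genQ[OF y finD] by blast
    \<comment> \<open>No closeness is required at the start: every tuple of \<open>Y\<close> lies in
      \<open>NN z P0\<close>, so \<open>z\<close> can be moved near \<open>y\<close> by an element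
      of \<open>H0\<close>.\<close>
    have g0: "good z P0"
      using Y P0 normalizes_stab[OF ultra, of _ P0] Y_H0[OF Y(2)] by (auto simp: good_def H0_def)
    have "y \<in> NN z P0"
      using Y NN_coset[OF Y(2), of y P0] H0_comp[OF H0_iv[OF Y_H0[OF Y(2)]] Y_H0[OF Y(1)]] by (simp add: H0_def)
    then obtain w where w: "w \<in> VV {} 0" "act w z \<in> NN y Q"
      using genw[OF z _ g0 _ _ bfQ[OF Q(1)], of "{}" 0 y] by (auto simp: VV_def H0_def)
    then have "S 0 (id, w, Q)" using Q H0_id VV_H0 by (simp add: S_def act_id[OF Y(1)])
    then show ?thesis by blast
  qed
  have step: "\<exists>s'. S (Suc k) s' \<and> near k (fst s) (fst s') \<and> near k (fst (snd s)) (fst (snd s'))" if s: "S k s" for k s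
  proof -
    obtain a b Q where abQ: "s = (a, b, Q)" by (cases s)
    then have a: "a \<in> H0" "b \<in> H0" "good (act a y) Q" "act b z \<in> NN (act a y) Q" "stab Q \<subseteq> VV (D k a) k"
      using s by (auto simp: S_def)
    obtain Q' where Q': "good (act b z) Q'" "stab Q' \<subseteq> VV (D k b) k" using genQ[OF gen(2)[OF a(2)] finD] by blast
    \<comment> \<open>Forth: the conjugate of \<open>z\<close> lies where the orbit of the conjugate
      of \<open>y\<close> is dense, so a small \<open>w\<close> brings the latter into a smaller
      neighborhood of the former.\<close>
    obtain w where w: "w \<in> VV (D k a) k" "act w (act a y) \<in> NN (act b z) Q'"
      using genw[OF gen(1)[OF a(1)] finD a(3,5,4) bfQ[OF Q'(1)]] by blast
    define a' where "a' = w \<circ> a"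
    have a': "a' \<in> H0" using w a VV_H0 H0_comp by (simp add: a'_def)
    have wa: "act a' y \<in> NN (act b z) Q'" using w a VV_H0 Y by (simp add: a'_def act_comp)
    obtain Q'' where Q'': "good (act a' y) Q''" "stab Q'' \<subseteq> VV (D (Suc k) a') (Suc k)"
      using genQ[OF gen(1)[OF a'] finD] by blast
    \<comment> \<open>Back, with the roles exchanged; the position reached by \<open>w\<close> is
      the hypothesis of this move.\<close>
    obtain w' where w': "w' \<in> VV (D k b) k" "act w' (act b z) \<in> NN (act a' y) Q''"
      using genw[OF gen(2)[OF a(2)] finD Q' wa bfQ[OF Q''(1)]] by blast
    define b' where "b' = w' \<circ> b"
    have b': "b' \<in> H0" using w' a VV_H0 H0_comp by (simp add: b'_def)
    have "act b' z \<in> NN (act a' y) Q''" using w' a VV_H0 Y by (simp add: b'_def act_comp)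
    then have "S (Suc k) (a', b', Q'')" using a' b' Q'' by (simp add: S_def)
    moreover have "near k a a'" "near k b b'" using w w' by (auto simp: near_def a'_def b'_def)
    ultimately show ?thesis by (intro exI[of _ "(a', b', Q'')"]) (simp add: abQ)
  qed
  obtain s where s: "\<And>k. S k (s k)" "\<And>k. near k (fst (s k)) (fst (s (Suc k)))"
    "\<And>k. near k (fst (snd (s k))) (fst (snd (s (Suc k))))"
    using dependent_nat_choice[of S "\<lambda>k s s'. near k (fst s) (fst s') \<and> near k (fst (snd s)) (fst (snd s'))"]
      init step by (metis (no_types, lifting))
  define a where "a k = fst (s k)" for k
  define b where "b k = fst (snd (s k))" for k
  have S: "a k \<in> H0" "b k \<in> H0" "act (b k) z \<in> NN (act (a k) y) (snd (snd (s k)))"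
    "stab (snd (snd (s k))) \<subseteq> VV (D k (a k)) k" for k
    using s(1)[of k] by (auto simp: S_def a_def b_def split: prod.splits)
  have nearD: "dist (c' (denseq j)) (c (denseq j)) < 1 / Suc k \<and> dist (iv c' (denseq j)) (iv c (denseq j)) < 1 / Suc k"
    if n: "near k c c'" and c: "c \<in> H0" and j: "j \<le> k" for k c c' j
  proof -
    obtain w where w: "w \<in> VV (D k c) k" "c' = w \<circ> c" using n by (auto simp: near_def)
    have I: "w \<in> Isom" "c \<in> Isom" using w c VV_H0 H0_Isom by blast+
    have 1: "dist (w (c (denseq j))) (c (denseq j)) < 1 / Suc k" "dist (w (denseq j)) (denseq j) < 1 / Suc k"
      using w(1) j unfolding VV_def D_def by blast+
    have "dist (iv c' (denseq j)) (iv c (denseq j)) = dist (iv w (denseq j)) (denseq j)"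
      using I by (simp add: w(2) inv_comp_distrib_Isom)
    also have "\<dots> = dist (w (denseq j)) (denseq j)" using I dist_inv_left[of w] by (metis dist_commute)
    finally show ?thesis using 1 w(2) by simp
  qed
  obtain \<alpha> where \<alpha>: "\<alpha> \<in> H0" "\<And>x. (\<lambda>k. a k x) \<longlonglongrightarrow> \<alpha> x"
    by (rule H0_limit[of a]) (use S nearD s in \<open>auto simp: a_def\<close>)
  obtain \<beta> where \<beta>: "\<beta> \<in> H0" "\<And>x. (\<lambda>k. b k x) \<longlonglongrightarrow> \<beta> x"
    by (rule H0_limit[of b]) (use S nearD s in \<open>auto simp: b_def\<close>)
  have lim: "act \<alpha> y i (denseq j) = act \<beta> z i (denseq j)" if i: "i \<in> I" for i j
  proof -
    have "(\<lambda>k. dist (act (b k) z i (denseq j)) (act (a k) y i (denseq j))) \<longlonglongrightarrow> 0"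
    proof (rule Lim_null_comparison[OF _ LIMSEQ_inverse_real_of_nat])
      show "\<forall>\<^sub>F k in sequentially. norm (dist (act (b k) z i (denseq j)) (act (a k) y i (denseq j))) \<le> inverse (real (Suc k))"
        unfolding eventually_sequentially
      proof (intro exI[of _ j] allI impI)
        fix k assume "j \<le> k"
        then have "denseq j \<in> D k (a k)" by (auto simp: D_def)
        from NN_apply[OF act_Y[OF S(1) Y(1)] S(3) S(4) this i]
        show "norm (dist (act (b k) z i (denseq j)) (act (a k) y i (denseq j))) \<le> inverse (real (Suc k))"
          by (simp add: inverse_eq_divide)
      qed
    qed
    moreover have "(\<lambda>k. dist (act (b k) z i (denseq j)) (act (a k) y i (denseq j)))
        \<longlonglongrightarrow> dist (act \<beta> z i (denseq j)) (act \<alpha> y i (denseq j))"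
      by (intro tendsto_dist act_tendsto) (use \<alpha> \<beta> S Y i in auto)
    ultimately have "dist (act \<beta> z i (denseq j)) (act \<alpha> y i (denseq j)) = 0" using LIMSEQ_unique by blast
    then show ?thesis by simp
  qed
  have eq: "act \<alpha> y = act \<beta> z"
  proof (rule Y_eqI[OF act_Y[OF \<alpha>(1) Y(1)] act_Y[OF \<beta>(1) Y(2)]], rule ccontr)
    fix i x assume i: "i \<in> I" and ne: "act \<alpha> y i x \<noteq> act \<beta> z i x"
    have I: "act \<alpha> y i \<in> Isom" "act \<beta> z i \<in> Isom"
      using Y_Isom[OF act_Y[OF \<alpha>(1) Y(1)] i] Y_Isom[OF act_Y[OF \<beta>(1) Y(2)] i] .
    obtain j where j: "dist (denseq j) x < dist (act \<alpha> y i x) (act \<beta> z i x)" using denseq ne by (metis zero_less_dist_iff)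
    have "dist (act \<alpha> y i x) (act \<alpha> y i (denseq j)) < dist (act \<alpha> y i x) (act \<beta> z i x)"
      "dist (act \<beta> z i (denseq j)) (act \<beta> z i x) < dist (act \<alpha> y i x) (act \<beta> z i x)"
      using j by (simp_all only: dist_Isom[OF I(1)] dist_Isom[OF I(2)] dist_commute)
    then have "dist (act \<alpha> y i x) (act \<beta> z i x) < dist (act \<alpha> y i x) (act \<beta> z i x)"
      unfolding lim[OF i] by (rule ultra_less)
    then show False by simp
  qed
  have "act (iv \<beta> \<circ> \<alpha>) y = z"
    using act_comp[OF \<alpha>(1) H0_iv[OF \<beta>(1)] Y(1)] act_iv[OF \<beta>(1) Y(2)] eq by simp
  then show ?thesis using that H0_comp[OF H0_iv[OF \<beta>(1)] \<alpha>(1)] by blast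
qed

end

subsection \<open>Generic tuples are comeager\<close>

context extremal_group
begin

lemma amalgamate:
  assumes y: "y \<in> Y" "good y Q" and k: "k \<in> NN y Q" and R: "finite R"
  obtains w f where "w \<in> stab Q" "f \<in> Y" "\<And>i x. i \<in> I \<Longrightarrow> x \<in> R \<Longrightarrow> f i x = y i x"
    "\<And>i x. i \<in> I \<Longrightarrow> x \<in> R \<Longrightarrow> act (iv w) f i x = k i x"
proof -
  have Q: "bfam Q" "extr (stab Q)" "stab Q \<subseteq> H0" using y by (auto simp: good_def)
  have h: "y i \<in> Isom \<and> normalizes (y i) (stab Q)" if "i \<in> I" for i
    using y that Y_Isom by (simp add: good_def)
  have k': "k i \<in> Isom \<and> iv (y i) \<circ> k i \<in> stab Q" if "i \<in> I" for i
    using k NN_coset[OF y(1)] that Y_Isom by blast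
  obtain w f where wf: "w \<in> stab Q" "\<And>i. i \<in> I \<Longrightarrow> f i \<in> Isom \<and> iv (y i) \<circ> f i \<in> stab Q"
    "\<And>i x. i \<in> I \<Longrightarrow> x \<in> R \<Longrightarrow> f i x = y i x" "\<And>i x. i \<in> I \<Longrightarrow> x \<in> R \<Longrightarrow> f i (w x) = w (k i x)"
    by (rule amalgamation[where h = y and k = k and I = I, OF Q(1,2) R h I k']) (assumption | rule that)+
  have "f i \<in> H0" if i: "i \<in> I" for i
  proof -
    have "y i \<circ> (iv (y i) \<circ> f i) \<in> H0" using wf(2)[OF i] Q(3) by (intro H0_comp[OF Y_H0[OF y(1) i]]) blast
    moreover have "y i \<circ> (iv (y i) \<circ> f i) = f i" using h[OF i] by (auto simp: fun_eq_iff)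
    ultimately show ?thesis by simp
  qed
  then have fY: "restrict f I \<in> Y" by (simp add: Y_def)
  have wI: "w \<in> Isom" using wf(1) by (rule stab_Isom)
  show ?thesis
    by (rule that[OF wf(1) fY]) (use wf wI in \<open>auto simp: act_apply\<close>)
qed

text \<open>\<open>U1\<close> expresses the first condition of \<open>generic\<close>, and
  \<open>AA\<close> the second; restricted to finite sets of dense points and finite
  \<open>J\<close>, they have countably many parameters.\<close>

definition U1 :: "'a set \<Rightarrow> nat \<Rightarrow> (nat \<Rightarrow> 'a \<Rightarrow> 'a) set" where
  "U1 F m = {y \<in> Y. \<exists>Q. good y Q \<and> stab Q \<subseteq> VV F m}"

text \<open>Serves as a countable basis of \<open>T\<close>; triples with first entry outside
  \<open>I\<close> impose nothing, so \<open>J\<close> may range over all finite sets of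
  triples.\<close>

definition WW :: "(nat \<times> nat \<times> nat) set \<Rightarrow> nat \<Rightarrow> (nat \<Rightarrow> 'a \<Rightarrow> 'a) set" where
  "WW J m = {y \<in> Y. \<forall>(i, j, l)\<in>J. i \<in> I \<longrightarrow> dist (y i (denseq j)) (denseq l) < 1 / Suc m}"

definition AA :: "'a set \<Rightarrow> nat \<Rightarrow> (nat \<times> nat \<times> nat) set \<Rightarrow> nat \<Rightarrow> (nat \<Rightarrow> 'a \<Rightarrow> 'a) set" where
  "AA F m J m' = {y \<in> Y. \<exists>w\<in>VV F m. act w y \<in> WW J m'}"

lemma openin_U1: "openin T (U1 F m)"
  unfolding openin_T
proof (intro conjI ballI)
  show "U1 F m \<subseteq> Y" by (auto simp: U1_def)
  fix y assume "y \<in> U1 F m"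
  then obtain Q where Q: "y \<in> Y" "good y Q" "stab Q \<subseteq> VV F m" by (auto simp: U1_def)
  then have "NN y Q \<subseteq> U1 F m" using good_NN NN_Y by (fastforce simp: U1_def)
  then show "\<exists>P. bfam P \<and> NN y P \<subseteq> U1 F m" using Q by (auto simp: good_def)
qed

text \<open>The tuple is altered off the centers of a basic neighborhood until it normalizes a small
  extremal stabilizer. The balls of \<open>P0\<close> are added to \<open>P'\<close> so that the
  altered tuple stays in \<open>H0\<close>.\<close>

lemma U1_dense:
  assumes F: "finite F" and U: "openin T U" "U \<noteq> {}"
  shows "U \<inter> U1 F m \<noteq> {}"
proof -
  obtain y where y: "y \<in> U" using U by blast
  have P3: "y \<in> Y" using U(1) y by (auto simp: openin_T)
  obtain P where P: "bfam P" "NN y P \<subseteq> U" using U(1) y unfolding openin_T by blast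
  define P' where "P' = P \<union> (P0 \<union> (\<lambda>x. (x, 1 / Suc m)) ` F)"
  have P': "bfam P'" unfolding P'_def using P(1) bfam_VV[OF F] by (rule bfam_Un)
  obtain Q g where Q: "bfam Q" "extr (stab Q)" "stab Q \<subseteq> stab P'"
    "\<And>i. i \<in> I \<Longrightarrow> g i \<in> Isom \<and> normalizes (g i) (stab Q)"
    "\<And>i x. i \<in> I \<Longrightarrow> x \<in> fst ` P' \<Longrightarrow> g i x = y i x"
    by (rule normalized_extremal_dense[where g = y and I = I, OF ex P' I Y_Isom[OF P3]]) (assumption | rule that)+
  have QV: "stab Q \<subseteq> VV F m" using Q(3) by (auto simp: VV_stab P'_def stab_Un)
  have "g i \<in> H0" if i: "i \<in> I" for i
    unfolding H0_def
  proof (rule stabI)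
    show "g i \<in> Isom" using Q(4)[OF i] by simp
    fix x r assume "(x, r) \<in> P0"
    then have "g i x = y i x" "dist (y i x) x < r"
      using Q(5)[OF i, of x] Y_H0[OF P3 i] by (force simp: P'_def H0_def dest: stab_dist)+
    then show "dist (g i x) x < r" by simp
  qed
  then have gY: "restrict g I \<in> Y" by (simp add: Y_def)
  have "restrict g I \<in> NN y P"
    unfolding NN_def nbhd_def
  proof (intro CollectI conjI ballI gY, clarify)
    fix i x r assume i: "i \<in> I" and x: "(x, r) \<in> P"
    then have "g i x = y i x" using Q(5)[OF i, of x] by (force simp: P'_def)
    then show "dist (restrict g I i x) (y i x) < r" using i x P(1) by (auto simp: bfam_def)
  qed
  moreover have "restrict g I \<in> U1 F m"
    using gY Q QV VV_H0 by (auto simp: U1_def good_def intro!: exI[of _ Q])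
  ultimately show ?thesis using P(2) by blast
qed

lemma openin_AA:
  assumes "finite J"
  shows "openin T (AA F m J m')"
  unfolding openin_T
proof (intro conjI ballI)
  show "AA F m J m' \<subseteq> Y" by (auto simp: AA_def)
  fix y assume "y \<in> AA F m J m'"
  then obtain w where w: "y \<in> Y" "w \<in> VV F m" "act w y \<in> WW J m'" by (auto simp: AA_def)
  have wI: "w \<in> Isom" "w \<in> H0" using w VV_H0 H0_Isom by blast+
  \<comment> \<open>The value at \<open>denseq j\<close> of the conjugate by \<open>w\<close> is
    determined by the value at \<open>iv w (denseq j)\<close>.\<close>
  define P where "P = (\<lambda>(i, j, l). (iv w (denseq j), 1 / Suc m')) ` J"
  have "bfam P" using assms by (auto simp: P_def bfam_def)
  moreover have "NN y P \<subseteq> AA F m J m'"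
  proof
    fix z assume z: "z \<in> NN y P"
    have "act w z \<in> WW J m'"
      unfolding WW_def
    proof (intro CollectI conjI ballI act_Y[OF wI(2) NN_Y[OF z]], clarify)
      fix i j l assume J: "(i, j, l) \<in> J" and i: "i \<in> I"
      have "(iv w (denseq j), 1 / Suc m') \<in> P" using J by (force simp: P_def)
      then have "dist (z i (iv w (denseq j))) (y i (iv w (denseq j))) < 1 / Suc m'"
        using z i by (auto simp: NN_def nbhd_def)
      then have "dist (act w z i (denseq j)) (act w y i (denseq j)) < 1 / Suc m'"
        using wI by (simp add: act_apply i)
      moreover have "dist (act w y i (denseq j)) (denseq l) < 1 / Suc m'"
        using w(3) J i by (auto simp: WW_def)
      ultimately show "dist (act w z i (denseq j)) (denseq l) < 1 / Suc m'" by (rule ultra_less)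
    qed
    then show "z \<in> AA F m J m'" using w NN_Y[OF z] by (auto simp: AA_def)
  qed
  ultimately show "\<exists>P. bfam P \<and> NN y P \<subseteq> AA F m J m'" by blast
qed

lemma WW_basis:
  assumes k: "k \<in> Y" and R: "bfam R"
  obtains J m where "finite J" "k \<in> WW J m" "WW J m \<subseteq> NN k R"
proof -
  have "Min (insert 1 (snd ` R)) > 0" using R by (auto simp: bfam_def)
  then obtain m where m: "1 / Suc m < Min (insert 1 (snd ` R))" using nat_approx_posE by blast
  have mR: "1 / Suc m < r" if "(x, r) \<in> R" for x r
  proof -
    have "Min (insert 1 (snd ` R)) \<le> r" using R that by (intro Min_le) (force simp: bfam_def)+
    then show ?thesis using m by linarith
  qed
  have "\<exists>j. dist (denseq j) x < 1 / Suc m" for x :: 'a by (rule denseq) simp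
  then obtain c where c: "\<And>x :: 'a. dist (denseq (c x)) x < 1 / Suc m" by metis
  \<comment> \<open>The last index approximates the value of \<open>k i\<close> at the dense point
    replacing \<open>x\<close>. All errors are below \<open>1 / Suc m\<close>, and the ultrametric
    inequality chains them without loss.\<close>
  define J where "J = (\<lambda>(i, p). (i, c (fst p), c (k i (denseq (c (fst p)))))) ` (I \<times> R)"
  have "finite J" using I R by (simp add: J_def bfam_def)
  moreover have "k \<in> WW J m" using k c by (auto simp: WW_def J_def dist_commute)
  moreover have "WW J m \<subseteq> NN k R"
  proof
    fix z assume z: "z \<in> WW J m"
    show "z \<in> NN k R"
      unfolding NN_def nbhd_def
    proof (intro CollectI conjI ballI, goal_cases)
      case 1 then show ?case using z by (simp add: WW_def)
    next
      case (2 i p)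
      obtain x r where p: "p = (x, r)" by fastforce
      define q :: 'a where "q = denseq (c x)"
      have I: "z i \<in> Isom" "k i \<in> Isom" using z k 2 Y_Isom by (auto simp: WW_def)
      have "(i, c x, c (k i q)) \<in> J" using 2 p by (force simp: J_def q_def)
      then have "dist (z i q) (denseq (c (k i q))) < 1 / Suc m" using z 2 by (auto simp: WW_def q_def)
      then have "dist (z i q) (k i q) < 1 / Suc m" using c by (rule ultra_less)
      moreover have "dist (z i x) (z i q) < 1 / Suc m" "dist (k i q) (k i x) < 1 / Suc m"
        using c[of x] I by (simp_all add: q_def dist_commute)
      ultimately have "dist (z i x) (k i x) < 1 / Suc m" by (meson ultra_less)
      then show ?case using mR[of x r] 2 p by simp
    qed
  qed
  ultimately show ?thesis by (rule that)
qed

text \<open>The second hypothesis is an alternative: either \<open>y\<close> itself can be moved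
  into the basic set, or no tuple near \<open>y\<close> can. If the basic set contains a tuple
  \<open>k\<close> of \<open>NN y Q\<close>, the latter is impossible, for amalgamation gives tuples
  arbitrarily close to \<open>y\<close> that can be moved to agree with \<open>k\<close> on a given
  finite set.\<close>

lemma genericI:
  assumes y: "y \<in> Y" and 1: "\<And>N m. finite N \<Longrightarrow> y \<in> U1 (denseq ` N) m"
    and 2: "\<And>N m J m'. finite N \<Longrightarrow> finite J \<Longrightarrow>
      y \<in> AA (denseq ` N) m J m' \<union> T interior_of (Y - AA (denseq ` N) m J m')"
  shows "generic y"
  unfolding generic_def
proof (intro conjI allI impI y)
  fix F :: "'a set" and m
  show "\<exists>Q. good y Q \<and> stab Q \<subseteq> VV F m" if F: "finite F"
  proof -
    obtain N where "finite N" "VV (denseq ` N) m = VV F m" using VV_denseq[OF F] by blast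
    then show ?thesis using 1[of N m] by (auto simp: U1_def)
  qed
  fix Q R :: "('a \<times> real) set" and k
  assume *: "finite F \<and> good y Q \<and> stab Q \<subseteq> VV F m \<and> k \<in> NN y Q \<and> bfam R"
  then obtain N where N: "finite N" "VV (denseq ` N) m = VV F m" using VV_denseq by blast
  have kY: "k \<in> Y" using * NN_Y by blast
  obtain J m' where J: "finite J" "k \<in> WW J m'" "WW J m' \<subseteq> NN k R" using WW_basis[OF kY, of R] * by blast
  have AA: "AA (denseq ` N) m J m' = AA F m J m'" by (simp add: AA_def N)
  have "y \<in> AA F m J m'"
  proof (rule ccontr)
    assume "y \<notin> AA F m J m'"
    then have "y \<in> T interior_of (Y - AA F m J m')" using 2[OF N(1) J(1), of m m'] by (simp add: AA)
    then obtain P where P: "bfam P" "NN y P \<subseteq> T interior_of (Y - AA F m J m')"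
      using openin_T openin_interior_of by metis
    then have P': "NN y P \<inter> AA F m J m' = {}" using interior_of_subset[of T "Y - AA F m J m'"] by blast
    define R' where "R' = fst ` P \<union> (\<lambda>(i, j, l). denseq j) ` J"
    have "finite R'" using P J by (simp add: R'_def bfam_def)
    then obtain w f where wf: "w \<in> stab Q" "f \<in> Y" "\<And>i x. i \<in> I \<Longrightarrow> x \<in> R' \<Longrightarrow> f i x = y i x"
      "\<And>i x. i \<in> I \<Longrightarrow> x \<in> R' \<Longrightarrow> act (iv w) f i x = k i x"
      using amalgamate[OF y, of Q k R'] * by metis
    have "f \<in> NN y P" using wf(2,3) P(1) by (force simp: NN_def nbhd_def R'_def bfam_def)
    moreover have wV: "iv w \<in> VV F m" using wf(1) * VV_iv by blast
    moreover have "act (iv w) f \<in> WW J m'"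
    proof -
      have "act (iv w) f i (denseq j) = k i (denseq j)" if "(i, j, l) \<in> J" "i \<in> I" for i j l
        using wf(4)[OF that(2), of "denseq j"] that(1) by (force simp: R'_def)
      then show ?thesis using J(2) act_Y[OF VV_H0[OF wV] wf(2)] by (auto simp: WW_def)
    qed
    ultimately have "f \<in> NN y P \<inter> AA F m J m'" using wf(2) by (auto simp: AA_def)
    then show False using P' by blast
  qed
  then show "\<exists>w\<in>VV F m. act w y \<in> NN k R" using J(3) by (auto simp: AA_def)
qed

lemma completely_metrizable_T: "completely_metrizable_space T"
proof -
  have "openin Isom_topology H0"
    unfolding openin_Isom_topology
  proof (intro conjI ballI)
    show "H0 \<subseteq> Isom" using H0_Isom by blast
    fix g assume g: "g \<in> H0"
    have "nbhd g P0 \<inter> Isom \<subseteq> H0"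
    proof
      fix h assume h: "h \<in> nbhd g P0 \<inter> Isom"
      then have "iv g \<circ> h \<in> H0" using nbhd_iff_coset[OF H0_Isom[OF g], of h P0] by (simp add: H0_def)
      from H0_comp[OF g this] have "g \<circ> (iv g \<circ> h) \<in> H0" .
      moreover have "g \<circ> (iv g \<circ> h) = h" using H0_Isom[OF g] by (auto simp: fun_eq_iff)
      ultimately show "h \<in> H0" by simp
    qed
    then show "\<exists>P. bfam P \<and> nbhd g P \<inter> Isom \<subseteq> H0" using P0 by blast
  qed
  then have "completely_metrizable_space (subtopology Isom_topology H0)"
    by (rule completely_metrizable_space_openin[OF completely_metrizable_Isom])
  moreover have "countable {i \<in> I. \<not> (\<exists>a. topspace (subtopology Isom_topology H0) \<subseteq> {a})}"
    using I by (intro countable_finite) simp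
  ultimately show ?thesis unfolding T_def completely_metrizable_space_product_topology by blast
qed

lemma generic_comeager:
  obtains \<U> where "countable \<U>" "\<And>U. U \<in> \<U> \<Longrightarrow> openin T U \<and> T closure_of U = topspace T"
    "\<And>y. y \<in> Y \<Longrightarrow> y \<in> \<Inter>\<U> \<Longrightarrow> generic y"
proof -
  define u1 where "u1 = (\<lambda>(N, m). U1 (denseq ` N) m)"
  \<comment> \<open>An open set together with the interior of its complement is open and
    dense.\<close>
  define u2 where "u2 = (\<lambda>(N, m, J, m'). AA (denseq ` N) m J m' \<union> T interior_of (Y - AA (denseq ` N) m J m'))"
  define \<U> where "\<U> = u1 ` (Collect finite \<times> UNIV) \<union> u2 ` (Collect finite \<times> UNIV \<times> Collect finite \<times> UNIV)"
  have "countable \<U>" unfolding \<U>_def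
    by (intro countable_Un countable_image countable_SIGMA countable_Collect_finite uncountable_infinite) auto
  moreover have "openin T U \<and> T closure_of U = topspace T" if "U \<in> \<U>" for U
  proof -
    have dense: "T closure_of U = topspace T" if "openin T U" "\<And>W. openin T W \<Longrightarrow> W \<noteq> {} \<Longrightarrow> W \<inter> U \<noteq> {}" for U
      using that by (simp add: dense_intersects_open Int_commute)
    consider N m where "finite N" "U = U1 (denseq ` N) m"
      | N m J m' where "finite N" "finite J" "U = AA (denseq ` N) m J m' \<union> T interior_of (Y - AA (denseq ` N) m J m')"
      using \<open>U \<in> \<U>\<close> by (auto simp: \<U>_def u1_def u2_def)
    then show ?thesis
    proof cases
      case 1
      then show ?thesis using dense openin_U1 U1_dense by auto
    next
      case 2
      then have o: "openin T U" by (simp add: openin_AA openin_Un)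
      have "W \<inter> U \<noteq> {}" if W: "openin T W" "W \<noteq> {}" for W
      proof (cases "W \<inter> AA (denseq ` N) m J m' = {}")
        case True
        then have "W \<subseteq> T interior_of (Y - AA (denseq ` N) m J m')"
          using W by (intro interior_of_maximal) (auto simp: openin_T)
        then show ?thesis using W 2 by blast
      next
        case False
        then show ?thesis using 2 by blast
      qed
      then show ?thesis using o dense by blast
    qed
  qed
  moreover have "generic y" if y: "y \<in> Y" "y \<in> \<Inter>\<U>" for y
  proof (rule genericI[OF y(1)])
    show "y \<in> U1 (denseq ` N) m" if "finite N" for N m
      using y(2) that by (force simp: \<U>_def u1_def)
    show "y \<in> AA (denseq ` N) m J m' \<union> T interior_of (Y - AA (denseq ` N) m J m')" if "finite N" "finite J" for N m J m'
    proof -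
      have "u2 (N, m, J, m') \<in> \<U>" using that by (auto simp: \<U>_def)
      then show ?thesis using y(2) unfolding u2_def by blast
    qed
  qed
  ultimately show ?thesis by (rule that)
qed

lemma comeager_act_orbit:
  obtains y where "y \<in> Y" "comeager_in T {act v y | v. v \<in> H0}"
proof -
  obtain \<U> where U: "countable \<U>" "\<And>U. U \<in> \<U> \<Longrightarrow> openin T U \<and> T closure_of U = topspace T"
    "\<And>y. y \<in> Y \<Longrightarrow> y \<in> \<Inter>\<U> \<Longrightarrow> generic y" using generic_comeager by metis
  have "restrict (\<lambda>_. id) I \<in> Y" by (simp add: Y_def H0_id)
  moreover have "T closure_of \<Inter>(insert Y \<U>) = topspace T"
  proof (rule Baire_category)
    show "openin T U \<and> T closure_of U = topspace T" if "U \<in> insert Y \<U>" for U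
      using that U(2) topspace_T openin_topspace[of T] closure_of_topspace[of T] by auto
  qed (use completely_metrizable_T U(1) in auto)
  ultimately have "\<Inter>(insert Y \<U>) \<noteq> {}" using topspace_T by (metis closure_of_empty empty_iff)
  then obtain y where y: "y \<in> Y" "y \<in> \<Inter>\<U>" by auto
  define S where "S = {act v y | v. v \<in> H0}"
  have SY: "S \<subseteq> Y" using act_Y y by (auto simp: S_def)
  have sub: "z \<in> S" if "z \<in> Y" "z \<in> \<Inter>\<U>" for z
    using generic_conjugate[OF U(3)[OF y] U(3)[OF that]] by (auto simp: S_def)
  have "meager_in T (topspace T - S)"
    unfolding meager_in_def
  \<comment> \<open>\<open>meager_in\<close> asks for an exact union, so \<open>S\<close> is removed
    from each complement.\<close>
  proof (intro exI[of _ "(\<lambda>U. Y - U - S) ` \<U>"] conjI ballI)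
    show "countable ((\<lambda>U. Y - U - S) ` \<U>)" using U(1) by simp
    show "topspace T - S = \<Union>((\<lambda>U. Y - U - S) ` \<U>)" using sub by (auto simp: topspace_T)
    fix N assume "N \<in> (\<lambda>U. Y - U - S) ` \<U>"
    then obtain U' where U': "U' \<in> \<U>" "N = Y - U' - S" by blast
    show "nowhere_dense_in T N"
    proof (rule nowhere_dense_inI)
      fix W assume W: "openin T W" "W \<noteq> {}"
      have "U' \<inter> W \<noteq> {}" using U(2)[OF U'(1)] W by (simp add: dense_intersects_open)
      then show "\<exists>W'. openin T W' \<and> W' \<noteq> {} \<and> W' \<subseteq> W \<and> W' \<inter> N = {}"
        using U(2)[OF U'(1)] W U' by (intro exI[of _ "U' \<inter> W"]) auto
    qed (auto simp: topspace_T U')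
  qed
  then have "comeager_in T S" using SY by (simp add: comeager_in_def topspace_T)
  then show ?thesis using that y by (simp add: S_def)
qed

end

section \<open>The isometry group as a group\<close>

lemma group_Isom: "group (Isom_group :: ('a::metric_space \<Rightarrow> 'a) monoid)"
proof (rule groupI)
  fix g :: "'a \<Rightarrow> 'a" assume "g \<in> carrier Isom_group"
  then show "\<exists>h\<in>carrier Isom_group. h \<otimes>\<^bsub>Isom_group\<^esub> g = \<one>\<^bsub>Isom_group\<^esub>"
    by (intro bexI[of _ "iv g"]) (auto simp: Isom_group_def)
qed (auto simp: Isom_group_def comp_assoc)

lemma subgroup_Isom_props:
  assumes "subgroup V Isom_group"
  shows "V \<subseteq> Isom" "id \<in> V" "\<And>g h. g \<in> V \<Longrightarrow> h \<in> V \<Longrightarrow> g \<circ> h \<in> V" "\<And>g. g \<in> V \<Longrightarrow> iv g \<in> V"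
    "\<And>g. g \<in> V \<Longrightarrow> inv\<^bsub>subgroup_group V\<^esub> g = iv g"
proof -
  show V: "V \<subseteq> Isom" using subgroup.subset[OF assms] by (simp add: Isom_group_def)
  show "id \<in> V" using subgroup.one_closed[OF assms] by (simp add: Isom_group_def)
  show "g \<circ> h \<in> V" if "g \<in> V" "h \<in> V" for g h
    using subgroup.m_closed[OF assms that] by (simp add: Isom_group_def)
  have iv: "inv\<^bsub>Isom_group\<^esub> g = iv g" if "g \<in> V" for g
    by (rule group.inv_equality[OF group_Isom]) (use that V in \<open>auto simp: Isom_group_def\<close>)
  show ivV: "iv g \<in> V" if "g \<in> V" for g
    using subgroup.m_inv_closed[OF assms that] iv[OF that] by simp
  show "inv\<^bsub>subgroup_group V\<^esub> g = iv g" if "g \<in> V" for g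
    using group.m_inv_consistent[OF group_Isom assms that] iv[OF that] by simp
qed

context ultrametric_type
begin

lemma open_subgroup_stab:
  assumes P: "bfam P"
  shows "open_subgroup (stab (P :: ('a \<times> real) set))"
  unfolding open_subgroup_def
proof
  show "subgroup (stab P) Isom_group"
  proof (rule group.subgroupI[OF group_Isom])
    show "stab P \<subseteq> carrier Isom_group" "stab P \<noteq> {}"
      using stab_id[OF P] stab_subset_Isom by (auto simp: Isom_group_def)
    fix g assume g: "g \<in> stab P"
    have "inv\<^bsub>Isom_group\<^esub> g = iv g"
      by (rule group.inv_equality[OF group_Isom]) (use stab_Isom[OF g] in \<open>auto simp: Isom_group_def\<close>)
    then show "inv\<^bsub>Isom_group\<^esub> g \<in> stab P" using stab_inv[OF g] by simp
    show "g \<otimes>\<^bsub>Isom_group\<^esub> h \<in> stab P" if "h \<in> stab P" for h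
      using stab_comp[OF g that] by (simp add: Isom_group_def)
  qed
  show "openin Isom_topology (stab P)"
    unfolding openin_Isom_topology
  proof (intro conjI ballI)
    show "stab P \<subseteq> Isom" by (rule stab_subset_Isom)
    fix g assume g: "g \<in> stab P"
    have "nbhd g P \<inter> Isom \<subseteq> stab P"
    proof (intro subsetI stabI)
      fix h x r assume "h \<in> nbhd g P \<inter> Isom" "(x, r) \<in> P"
      then have "dist (h x) (g x) < r" "dist (g x) x < r" using g by (auto simp: nbhd_def stab_dist)
      then show "dist (h x) x < r" by (rule ultra_less)
    qed blast
    then show "\<exists>P'. bfam P' \<and> nbhd g P' \<inter> Isom \<subseteq> stab P" using P by blast
  qed
qed

end

lemma ample_generics_stab:
  assumes ultra: "ultrametric TYPE('a::polish_space)" and P: "bfam (P :: ('a \<times> real) set)" "extr (stab P)"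
    and ex: "\<And>P :: ('a \<times> real) set. bfam P \<Longrightarrow> \<exists>P'. bfam P' \<and> stab P' \<subseteq> stab P \<and> extr (stab P')"
  shows "ample_generics (subgroup_group (stab P)) (subgroup_topology (stab P))"
  unfolding ample_generics_def
proof
  fix n
  interpret extremal_group "TYPE('a)" P "{..n}"
    by (intro_locales; unfold_locales) (rule ultra, rule P(1), rule P(2), simp, rule ex)
  have sg: "subgroup (stab P) Isom_group" using open_subgroup_stab[OF P(1)] by (simp add: open_subgroup_def)
  obtain y where y: "y \<in> Y" "comeager_in T {act v y | v. v \<in> H0}" using comeager_act_orbit by blast
  have dc: "diag_conj (subgroup_group (stab P)) n v y = act v y" if "v \<in> stab P" for v
    using subgroup_Isom_props(5)[OF sg that] by (simp add: diag_conj_def act_def Isom_group_def)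
  then have "orbit (subgroup_group (stab P)) (diag_conj (subgroup_group (stab P)) n) y = {act v y | v. v \<in> H0}"
    unfolding orbit_def H0_def Setcompr_eq_image by (intro image_cong) (auto intro: dc)
  then show "\<exists>x\<in>{..n} \<rightarrow>\<^sub>E carrier (subgroup_group (stab P)).
      comeager_in (product_topology (\<lambda>_. subgroup_topology (stab P)) {..n})
        (orbit (subgroup_group (stab P)) (diag_conj (subgroup_group (stab P)) n) x)"
    using y by (intro bexI[of _ y]) (auto simp: T_def Y_def H0_def)
qed

section \<open>Signs of finite orbits of balls\<close>

lemma finite_orbit_stab:
  assumes "(q, \<rho>) \<in> Q"
  shows "finite_orbit (stab Q) q \<rho>"
  unfolding finite_orbit_def by (rule exI[of _ "{q}"]) (use stab_dist[OF _ assms] in auto)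

lemma finite_orbit_mono: "finite_orbit H x r \<Longrightarrow> r \<le> s \<Longrightarrow> finite_orbit H x s"
  unfolding finite_orbit_def by (meson order_less_le_trans)

context ultrametric_type
begin

lemma finite_orbit_cong:
  assumes "finite_orbit H (x::'a) r" "dist x y < r" "H \<subseteq> Isom"
  shows "finite_orbit H y r"
proof -
  obtain W where W: "finite W" "\<And>g. g \<in> H \<Longrightarrow> \<exists>w\<in>W. dist (g x) w < r"
    using assms by (auto simp: finite_orbit_def)
  have "\<exists>w\<in>W. dist (g y) w < r" if g: "g \<in> H" for g
  proof -
    obtain w where "w \<in> W" "dist (g x) w < r" using W(2)[OF g] by blast
    moreover have "dist (g y) (g x) < r" using assms(2) subsetD[OF assms(3) g] by (simp add: dist_commute)
    ultimately show ?thesis using ultra_less by blast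
  qed
  then show ?thesis using W(1) by (auto simp: finite_orbit_def)
qed

lemma finite_orbit_move:
  assumes "finite_orbit (stab Q) (x::'a) r" "g \<in> stab Q"
  shows "finite_orbit (stab Q) (g x) r"
proof -
  obtain W where W: "finite W" "\<And>h. h \<in> stab Q \<Longrightarrow> \<exists>w\<in>W. dist (h x) w < r"
    using assms by (auto simp: finite_orbit_def)
  have "\<exists>w\<in>W. dist (h (g x)) w < r" if "h \<in> stab Q" for h
    using W(2)[OF stab_comp[OF that assms(2)]] by simp
  then show ?thesis using W(1) by (auto simp: finite_orbit_def)
qed

text \<open>Fixing finitely many balls with finite orbit defines a subgroup of finite index.\<close>

lemma finite_orbit_finite_index:
  assumes A: "bfam A" and fo: "\<And>a \<rho>. (a, \<rho>) \<in> A \<Longrightarrow> finite_orbit (stab Q) a \<rho>"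
    and x: "finite_orbit (stab A) (x::'a) r"
  shows "finite_orbit (stab Q) x r"
proof -
  have "\<forall>p\<in>A. \<exists>W. finite W \<and> (\<forall>g\<in>stab Q. \<exists>w\<in>W. dist (g (fst p)) w < snd p)"
    using fo by (auto simp: finite_orbit_def)
  then obtain W where W: "\<And>p. p \<in> A \<Longrightarrow> finite (W p)"
    "\<And>p g. p \<in> A \<Longrightarrow> g \<in> stab Q \<Longrightarrow> \<exists>w\<in>W p. dist (g (fst p)) w < snd p" by metis
  \<comment> \<open>The label of \<open>g\<close> records, for each ball in \<open>A\<close>, a
    point of \<open>W p\<close> near the image of its center. There are finitely many labels, and
    equal labels mean the same left coset of \<open>stab A\<close>.\<close>
  define \<kappa> where "\<kappa> g = (\<lambda>p\<in>A. SOME w. w \<in> W p \<and> dist (g (fst p)) w < snd p)" for g :: "'a \<Rightarrow> 'a"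
  have \<kappa>: "\<kappa> g p \<in> W p \<and> dist (g (fst p)) (\<kappa> g p) < snd p" if "g \<in> stab Q" "p \<in> A" for g p
  proof -
    have "\<exists>w. w \<in> W p \<and> dist (g (fst p)) w < snd p" using W(2)[OF that(2,1)] by blast
    from someI_ex[OF this] show ?thesis using that by (simp add: \<kappa>_def)
  qed
  have "\<kappa> ` stab Q \<subseteq> Pi\<^sub>E A W" using \<kappa> by (auto simp: PiE_iff \<kappa>_def)
  moreover have "finite (Pi\<^sub>E A W)" using A W(1) by (intro finite_PiE) (auto simp: bfam_def)
  ultimately have "finite (\<kappa> ` stab Q)" by (rule finite_subset)
  from finite_subset_image[OF this subset_refl]
  obtain C where C: "C \<subseteq> stab Q" "finite C" "\<kappa> ` stab Q = \<kappa> ` C" by blast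
  obtain W0 where W0: "finite W0" "\<And>g. g \<in> stab A \<Longrightarrow> \<exists>w\<in>W0. dist (g x) w < r"
    using x by (auto simp: finite_orbit_def)
  have "\<exists>w\<in>(\<Union>t\<in>C. t ` W0). dist (g x) w < r" if g: "g \<in> stab Q" for g
  proof -
    have "\<kappa> g \<in> \<kappa> ` C" using C(3) g by blast
    then obtain t where t: "t \<in> C" "\<kappa> g = \<kappa> t" by blast
    then have tQ: "t \<in> stab Q" using C by blast
    have I: "t \<in> Isom" "g \<in> Isom" using tQ g stab_Isom by blast+
    have "iv t \<circ> g \<in> stab A"
    proof (rule stabI)
      fix a \<rho> assume a: "(a, \<rho>) \<in> A"
      have "dist (g a) (\<kappa> g (a, \<rho>)) < \<rho>" "dist (\<kappa> g (a, \<rho>)) (t a) < \<rho>"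
        using \<kappa>[OF g a] \<kappa>[OF tQ a] t(2) by (simp_all add: dist_commute)
      then have "dist (g a) (t a) < \<rho>" by (rule ultra_less)
      then show "dist ((iv t \<circ> g) a) a < \<rho>" using I by (simp add: dist_inv_left)
    qed (use I in simp)
    then obtain w where w: "w \<in> W0" "dist ((iv t \<circ> g) x) w < r" using W0(2) by blast
    then have "dist (g x) (t w) < r" using I by (simp add: dist_inv_left)
    then show ?thesis using w t by blast
  qed
  then show ?thesis using W0 C unfolding finite_orbit_def by (intro exI[of _ "\<Union>t\<in>C. t ` W0"]) auto
qed

text \<open>Otherwise all balls with finite nontrivial orbit lie along the branches through \<open>S\<close>, so
  infinitely many of them lie along a single branch. Each of them makes this branch split, so the
  smallest of many such balls has more translates than \<open>S\<close> can meet.\<close>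

lemma finite_orbit_avoiding:
  assumes Q: "bfam (Q :: ('a \<times> real) set)"
    and no: "\<And>A. bfam A \<Longrightarrow> stab A \<subseteq> stab Q \<Longrightarrow> \<not> extr (stab A)" and S: "finite S"
  obtains x e g where "0 < e" "g \<in> stab Q" "dist x (g x) = e" "finite_orbit (stab Q) x e"
    "\<And>s. s \<in> S \<Longrightarrow> e \<le> dist x s \<and> e \<le> dist (g x) s"
proof (rule ccontr)
  note avoid = that
  assume neg: "\<not> thesis"
  have hit: "\<exists>s\<in>S. dist x s < e \<or> dist (g x) s < e"
    if "0 < e" "g \<in> stab Q" "dist x (g x) = e" "finite_orbit (stab Q) x e" for x e g
    using neg avoid[OF that] by (meson not_le)
  \<comment> \<open>The radii of the balls around \<open>s\<close> that have a finite orbit and a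
    translate at distance equal to the radius.\<close>
  define E where "E s = {e. 0 < e \<and> finite_orbit (stab Q) s e \<and> (\<exists>h\<in>stab Q. dist s (h s) = e)}" for s
  have "\<exists>s\<in>S. infinite (E s)"
  proof (rule ccontr)
    assume "\<not> (\<exists>s\<in>S. infinite (E s))"
    then have fE: "finite (E s)" if "s \<in> S" for s using that by blast
    \<comment> \<open>If all these radii were finite in number, fixing the corresponding balls would
      define a subgroup of finite index. As it is not extremal, it would move some ball with finite
      orbit by a distance \<open>e\<close>, and by \<open>hit\<close> it would also move a point
      \<open>s\<close> by \<open>e\<close> although \<open>(s, e)\<close> is in
      \<open>A\<close>.\<close>
    define A where "A = Q \<union> (\<Union>s\<in>S. Pair s ` E s)"
    have A: "bfam A" using Q S fE by (auto simp: bfam_def A_def E_def)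
    have AQ: "stab A \<subseteq> stab Q" by (rule stab_antimono) (simp add: A_def)
    have foA: "finite_orbit (stab Q) a \<rho>" if "(a, \<rho>) \<in> A" for a \<rho>
      using that finite_orbit_stab by (auto simp: A_def E_def)
    obtain x r where x: "0 < r" "finite_orbit (stab A) x r" "\<not> fixes_ball (stab A) x r"
      using no[OF A AQ] by (auto simp: extr_def)
    then obtain g where g: "g \<in> stab A" "r \<le> dist (g x) x" by (auto simp: fixes_ball_def not_less)
    have gI: "g \<in> Isom" and gQ: "g \<in> stab Q" using g AQ stab_Isom by blast+
    define e where "e = dist x (g x)"
    have e: "r \<le> e" using g(2) by (simp add: e_def dist_commute)
    have e0: "0 < e" using e x(1) by linarith
    have fo: "finite_orbit (stab Q) x e"
      using finite_orbit_mono[OF finite_orbit_finite_index[OF A foA x(2)] e] .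
    have "\<exists>s\<in>S. e \<in> E s \<and> dist s (g s) = e"
    proof -
      obtain s where s: "s \<in> S" "dist x s < e \<or> dist (g x) s < e" using hit[OF e0 gQ e_def[symmetric] fo] by blast
      show ?thesis
      proof (cases "dist x s < e")
        case True
        have "dist s (g s) = e" using ultra_eq2[of x s e "g x" "g s"] True gI by (simp add: e_def)
        moreover have "finite_orbit (stab Q) s e" using finite_orbit_cong[OF fo True stab_subset_Isom] .
        ultimately show ?thesis using s(1) e0 gQ by (auto simp: E_def)
      next
        case False
        then have gs: "dist (g x) s < e" using s(2) by blast
        define t where "t = iv g s"
        have st: "s = g t" using gI by (simp add: t_def)
        have "dist x t < e" using gs gI by (simp add: st)
        then have d: "dist t s = e" using ultra_eq2[of x t e "g x" s] gs by (simp add: e_def)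
        then have "dist s (iv g s) = e" by (simp add: t_def dist_commute)
        moreover have "dist s (g s) = e" using d gI st dist_Isom by metis
        moreover have "finite_orbit (stab Q) s e"
          using finite_orbit_cong[OF finite_orbit_move[OF fo gQ] gs stab_subset_Isom] .
        ultimately show ?thesis using s(1) e0 gQ by (auto simp: E_def)
      qed
    qed
    then obtain s where s: "s \<in> S" "e \<in> E s" "dist s (g s) = e" by blast
    then have "(s, e) \<in> A" by (auto simp: A_def)
    then show False using stab_dist[OF g(1), of s e] s by (simp add: dist_commute)
  qed
  then obtain s where s: "s \<in> S" "infinite (E s)" by blast
  obtain M where M: "M \<subseteq> E s" "finite M" "card M = card S + 2"
    using infinite_arbitrarily_large[OF s(2), of "card S + 2"] by blast
  define e0 where "e0 = Min M"
  have "M \<noteq> {}" using M by auto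
  then have e0: "e0 \<in> M" "\<And>e. e \<in> M \<Longrightarrow> e0 \<le> e" using M by (auto simp: e0_def)
  then obtain h0 where h0: "0 < e0" "finite_orbit (stab Q) s e0" "h0 \<in> stab Q" "dist s (h0 s) = e0"
    using M(1) by (auto simp: E_def)
  \<comment> \<open>For each radius \<open>e\<close> in \<open>M\<close> take a translate of
    \<open>s\<close> at distance \<open>e\<close>. Its \<open>e0\<close>-ball has a translate at
    distance \<open>e0\<close> as well, so \<open>hit\<close> gives a point of \<open>S\<close>
    within \<open>e0\<close>. Translates for different radii are more than \<open>e0\<close> apart,
    so these points are distinct and \<open>S\<close> is too small.\<close>
  have "\<exists>h \<sigma>. h \<in> stab Q \<and> dist s (h s) = e \<and> \<sigma> \<in> S \<and> dist (h s) \<sigma> \<le> e0" if e: "e \<in> M" for e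
  proof -
    obtain h where h: "h \<in> stab Q" "dist s (h s) = e" using e M(1) by (auto simp: E_def)
    have hI: "h \<in> Isom" using h stab_Isom by blast
    define k where "k = h \<circ> h0 \<circ> iv h"
    have k: "k \<in> stab Q" unfolding k_def by (intro stab_comp stab_inv h h0)
    have ks: "k (h s) = h (h0 s)" using hI by (simp add: k_def)
    obtain \<sigma> where \<sigma>: "\<sigma> \<in> S" "dist (h s) \<sigma> < e0 \<or> dist (h (h0 s)) \<sigma> < e0"
      using hit[of e0 k "h s"] h0 k ks hI finite_orbit_move[OF h0(2) h(1)] by auto
    have "dist (h s) \<sigma> \<le> e0"
      using \<sigma>(2) ultra_leI[of "h s" "h (h0 s)" e0 \<sigma>] hI h0 by auto
    then show ?thesis using h \<sigma> by blast
  qed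
  then obtain h \<sigma> where h: "\<And>e. e \<in> M \<Longrightarrow> h e \<in> stab Q \<and> dist s (h e s) = e \<and> \<sigma> e \<in> S \<and> dist (h e s) (\<sigma> e) \<le> e0"
    by metis
  have "\<sigma> e \<noteq> \<sigma> e'" if "e \<in> M" "e' \<in> M" "e < e'" for e e'
  proof
    assume "\<sigma> e = \<sigma> e'"
    then have "dist (h e s) (h e' s) \<le> e0"
      using h[OF that(1)] h[OF that(2)] ultra_leI[of "h e s" "\<sigma> e" e0 "h e' s"] by (simp add: dist_commute)
    moreover have "dist (h e s) (h e' s) = e'"
      using ultra_eq[of "h e s" s "h e' s"] h[OF that(1)] h[OF that(2)] that(3) by (simp add: dist_commute)
    ultimately show False using that e0(2)[OF that(1)] by simp
  qed
  then have "inj_on \<sigma> M" by (metis inj_onI linorder_neqE_linordered_idom)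
  then have "card M \<le> card S" using h S by (intro card_inj_on_le[of \<sigma>]) auto
  then show False using M by simp
qed

text \<open>\<open>\<epsilon>\<close> is the sign of the permutation induced on the finite orbit of
  the \<open>e\<close>-ball of \<open>x\<close>. It is determined by the images of the
  \<open>e\<close>-balls around the points of \<open>W\<close>, hence locally constant, and a swap
  of two balls of the orbit acts as a transposition.\<close>

lemma sign_character:
  assumes Q: "bfam (Q :: ('a \<times> real) set)" and fo: "finite_orbit (stab Q) x e" and e: "0 < e"
  obtains \<epsilon> :: "('a \<Rightarrow> 'a) \<Rightarrow> int" and P where
    "\<And>g h. g \<in> stab Q \<Longrightarrow> h \<in> stab Q \<Longrightarrow> \<epsilon> (g \<circ> h) = \<epsilon> g * \<epsilon> h" "\<And>g. \<epsilon> g \<noteq> 0"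
    "bfam P" "\<And>g h. g \<in> stab Q \<Longrightarrow> h \<in> stab Q \<Longrightarrow> h \<in> nbhd g P \<Longrightarrow> \<epsilon> h = \<epsilon> g"
    "\<And>g f. \<lbrakk>g \<in> stab Q; f \<in> stab Q; dist x (g x) = e; \<forall>y. dist x y < e \<longrightarrow> f y = g y;
      \<forall>y. dist (g x) y < e \<longrightarrow> f y = iv g y; \<forall>y. e \<le> dist x y \<and> e \<le> dist (g x) y \<longrightarrow> f y = y\<rbrakk>
      \<Longrightarrow> \<epsilon> f = - 1"
proof -
  define H where "H = stab Q"
  have HI: "g \<in> Isom" if "g \<in> H" for g using that stab_Isom by (simp add: H_def)
  have Hid: "id \<in> H" using stab_id[OF Q] by (simp add: H_def)
  have Hcomp: "g \<circ> h \<in> H" if "g \<in> H" "h \<in> H" for g h using that stab_comp by (simp add: H_def)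
  have Hiv: "iv g \<in> H" if "g \<in> H" for g using that stab_inv by (simp add: H_def)
  define \<O> where "\<O> = (\<lambda>g. ball (g x) e) ` H"
  obtain W where W: "finite W" "\<And>g. g \<in> H \<Longrightarrow> \<exists>w\<in>W. dist (g x) w < e"
    using fo by (auto simp: finite_orbit_def H_def)
  have OW: "\<exists>w\<in>W. B = ball w e" if "B \<in> \<O>" for B
  proof -
    obtain g where g: "g \<in> H" "B = ball (g x) e" using \<open>B \<in> \<O>\<close> by (auto simp: \<O>_def)
    then show ?thesis using W(2)[OF g(1)] ball_eq_iff[OF e] by blast
  qed
  then have "\<O> \<subseteq> (\<lambda>w. ball w e) ` W" by blast
  then have finO: "finite \<O>" using W(1) finite_subset by blast
  have OH: "g ` B \<in> \<O>" if "g \<in> H" "B \<in> \<O>" for g B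
  proof -
    obtain h where h: "h \<in> H" "B = ball (h x) e" using \<open>B \<in> \<O>\<close> by (auto simp: \<O>_def)
    have "g ` B = ball ((g \<circ> h) x) e" using image_ball_Isom[OF HI[OF that(1)]] h(2) by simp
    then show ?thesis using Hcomp[OF that(1) h(1)] unfolding \<O>_def by blast
  qed
  \<comment> \<open>Extended by the identity outside the orbit, since \<open>sign\<close> is taken
    of maps on the whole type.\<close>
  define \<pi> where "\<pi> g B = (if B \<in> \<O> then g ` B else B)" for g :: "'a \<Rightarrow> 'a" and B
  have \<pi>comp: "\<pi> (g \<circ> h) = \<pi> g \<circ> \<pi> h" if "g \<in> H" "h \<in> H" for g h
    using OH that by (auto simp: \<pi>_def fun_eq_iff image_comp)
  have \<pi>id: "\<pi> id = id" by (rule ext) (simp add: \<pi>_def)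
  have \<pi>perm: "permutation (\<pi> g)" if g: "g \<in> H" for g
  proof (rule permutes_imp_permutation[OF finO])
    have "\<pi> g \<circ> \<pi> (iv g) = id" "\<pi> (iv g) \<circ> \<pi> g = id"
      using \<pi>comp[OF g Hiv[OF g]] \<pi>comp[OF Hiv[OF g] g] \<pi>id HI[OF g] by simp_all
    then have "bij (\<pi> g)" using o_bij by blast
    then have "\<forall>y. \<exists>!B. \<pi> g B = y" by (rule iffD1[OF bij_iff])
    moreover have "\<forall>B. B \<notin> \<O> \<longrightarrow> \<pi> g B = B" by (simp add: \<pi>_def)
    ultimately show "\<pi> g permutes \<O>" unfolding permutes_def by (rule conjI[rotated])
  qed
  define P where "P = (\<lambda>w. (w, e)) ` W"
  have P: "bfam P" using W(1) e by (auto simp: P_def bfam_def)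
  have const: "sign (\<pi> h) = sign (\<pi> g)" if gh: "g \<in> stab Q" "h \<in> stab Q" "h \<in> nbhd g P" for g h
  proof -
    have "h ` B = g ` B" if B: "B \<in> \<O>" for B
    proof -
      obtain w where w: "w \<in> W" "B = ball w e" using OW[OF B] by blast
      have "dist (h w) (g w) < e" using gh(3) w(1) by (auto simp: nbhd_def P_def)
      then show ?thesis using image_ball_Isom gh stab_Isom w(2) ball_eq_iff[OF e] by metis
    qed
    then have "\<pi> h = \<pi> g" by (auto simp: \<pi>_def fun_eq_iff)
    then show ?thesis by simp
  qed
  have swap: "sign (\<pi> f) = - 1" if g: "g \<in> stab Q" and f: "f \<in> stab Q" and d: "dist x (g x) = e"
    and f1: "\<forall>y. dist x y < e \<longrightarrow> f y = g y" and f2: "\<forall>y. dist (g x) y < e \<longrightarrow> f y = iv g y"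
    and f3: "\<forall>y. e \<le> dist x y \<and> e \<le> dist (g x) y \<longrightarrow> f y = y" for g f
  proof -
    have I: "g \<in> Isom" "f \<in> Isom" using g f stab_Isom by blast+
    define B1 where "B1 = ball x e"
    define B2 where "B2 = ball (g x) e"
    have O: "B1 \<in> \<O>" "B2 \<in> \<O>"
      using imageI[OF Hid, of "\<lambda>g. ball (g x) e"] imageI[of g H "\<lambda>g. ball (g x) e"] g
      by (simp_all add: \<O>_def B1_def B2_def H_def)
    have ne: "B1 \<noteq> B2" using ball_eq_iff[OF e] d by (auto simp: B1_def B2_def)
    have fB1: "f ` B1 = B2" using image_ball_Isom[OF I(2), of x e] f1 e by (simp add: B1_def B2_def)
    have fB2: "f ` B2 = B1" using image_ball_Isom[OF I(2), of "g x" e] f2 e I by (simp add: B1_def B2_def)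
    have "\<pi> f B = Transposition.transpose B1 B2 B" for B
    proof (cases "B \<in> \<O>")
      case True
      then obtain y where y: "B = ball y e" by (auto simp: \<O>_def)
      consider "dist x y < e" | "dist (g x) y < e" | "e \<le> dist x y" "e \<le> dist (g x) y" by linarith
      then show ?thesis
      proof cases
        case 1
        then have "B = B1" using ball_eq_iff[OF e] by (auto simp: y B1_def dist_commute)
        then show ?thesis using O fB1 by (simp add: \<pi>_def)
      next
        case 2
        then have "B = B2" using ball_eq_iff[OF e] by (auto simp: y B2_def dist_commute)
        then show ?thesis using O fB2 by (simp add: \<pi>_def)
      next
        case 3
        then have "B \<noteq> B1" "B \<noteq> B2" using ball_eq_iff[OF e] by (auto simp: y B1_def B2_def not_less[symmetric] dist_commute)
        moreover have "f ` B = B" using image_ball_Isom[OF I(2), of y e] f3 3 by (simp add: y)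
        ultimately show ?thesis by (simp add: \<pi>_def)
      qed
    next
      case False
      then have "B \<noteq> B1" "B \<noteq> B2" using O by auto
      then show ?thesis using False by (simp add: \<pi>_def)
    qed
    then have "\<pi> f = Transposition.transpose B1 B2" by blast
    then show ?thesis using ne by (simp add: sign_swap_id)
  qed
  have mult: "sign (\<pi> (g \<circ> h)) = sign (\<pi> g) * sign (\<pi> h)" if "g \<in> stab Q" "h \<in> stab Q" for g h
    using \<pi>comp[of g h] \<pi>perm that sign_compose by (metis H_def)
  show ?thesis
    by (rule that[of "\<lambda>g. sign (\<pi> g)" P, OF mult _ P const swap]) (auto simp: sign_def)
qed

section \<open>Meager conjugacy classes\<close>

lemma openin_nbhd:
  assumes "V \<subseteq> (Isom :: ('a \<Rightarrow> 'a) set)" "bfam P"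
  shows "openin (subtopology Isom_topology V) (nbhd g P \<inter> V)"
proof -
  have "openin (top_of_set V) (V \<inter> nbhd g P)" using open_nbhd[OF assms(2)] by (rule openin_open_Int)
  then show ?thesis using assms(1) by (simp add: Isom_topology_def subtopology_subtopology inf.absorb2 inf_commute)
qed

text \<open>Given a basic neighborhood of an element of \<open>stab Q\<close>, take a sign coming
  from balls away from its centers. Multiplying by a swap of two such balls stays in the
  neighborhood and changes the sign, whereas the sign is constant on \<open>M\<close>. So a value
  not taken on \<open>M\<close> occurs, and it persists on an open set.\<close>

lemma conjugate_set_nowhere_dense:
  assumes Q: "bfam (Q :: ('a \<times> real) set)"
    and no: "\<And>A. bfam A \<Longrightarrow> stab A \<subseteq> stab Q \<Longrightarrow> \<not> extr (stab A)"
    and V: "stab Q \<subseteq> V" "V \<subseteq> Isom" and M: "M \<subseteq> stab Q"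
    and conj: "\<And>a b. a \<in> M \<Longrightarrow> b \<in> M \<Longrightarrow> \<exists>u\<in>stab Q. b = u \<circ> a \<circ> iv u"
  shows "nowhere_dense_in (subtopology Isom_topology V) M"
proof (rule nowhere_dense_inI)
  show "M \<subseteq> topspace (subtopology Isom_topology V)" using M V by auto
  fix U assume U: "openin (subtopology Isom_topology V) U" "U \<noteq> {}"
  have HI: "g \<in> Isom" if "g \<in> stab Q" for g using that by (rule stab_Isom)
  obtain h0 where h0: "h0 \<in> U" using U by blast
  have h0V: "h0 \<in> V" using h0 U(1) openin_subtopology_Isom[OF V(2)] by blast
  \<comment> \<open>The neighborhood \<open>nbhd h Q\<close> stays in the left coset of
    \<open>h\<close>, so \<open>stab Q\<close> is closed as well as open.\<close>
  have coset: "k \<in> stab Q \<longleftrightarrow> h \<in> stab Q" if "k \<in> nbhd h Q" "h \<in> Isom" "k \<in> Isom" for h k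
  proof -
    have u: "iv h \<circ> k \<in> stab Q" using that nbhd_iff_coset by blast
    have "k = h \<circ> (iv h \<circ> k)" using that by (auto simp: fun_eq_iff)
    moreover have "h = k \<circ> iv (iv h \<circ> k)" using that by (auto simp: fun_eq_iff inv_comp_distrib_Isom)
    ultimately show ?thesis using stab_comp u stab_inv by metis
  qed
  show "\<exists>U'. openin (subtopology Isom_topology V) U' \<and> U' \<noteq> {} \<and> U' \<subseteq> U \<and> U' \<inter> M = {}"
  proof (cases "h0 \<in> stab Q")
    case False
    define U' where "U' = U \<inter> (nbhd h0 Q \<inter> V)"
    have "openin (subtopology Isom_topology V) U'" unfolding U'_def
      using U(1) openin_nbhd[OF V(2) Q] by (rule openin_Int)
    moreover have "h0 \<in> U'" using h0 h0V nbhd_refl[OF Q] by (simp add: U'_def)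
    moreover have "U' \<inter> M = {}"
      using False coset[of _ h0] h0V V M by (auto simp: U'_def)
    ultimately show ?thesis by (intro exI[of _ U']) (auto simp: U'_def)
  next
    case True
    obtain P where P: "bfam P" "nbhd h0 P \<inter> V \<subseteq> U" using U(1) h0 openin_subtopology_Isom[OF V(2)] by blast
    have "finite (fst ` P)" using P by (simp add: bfam_def)
    then obtain x e g where x: "0 < e" "g \<in> stab Q" "dist x (g x) = e" "finite_orbit (stab Q) x e"
      "\<And>s. s \<in> fst ` P \<Longrightarrow> e \<le> dist x s \<and> e \<le> dist (g x) s"
      using finite_orbit_avoiding[OF Q no, of "fst ` P"] by metis
    obtain \<epsilon> :: "('a \<Rightarrow> 'a) \<Rightarrow> int" and P' where \<epsilon>:
      "\<And>g h. g \<in> stab Q \<Longrightarrow> h \<in> stab Q \<Longrightarrow> \<epsilon> (g \<circ> h) = \<epsilon> g * \<epsilon> h" "\<And>g. \<epsilon> g \<noteq> 0"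
      "bfam P'" "\<And>g h. g \<in> stab Q \<Longrightarrow> h \<in> stab Q \<Longrightarrow> h \<in> nbhd g P' \<Longrightarrow> \<epsilon> h = \<epsilon> g"
      "\<And>g f. \<lbrakk>g \<in> stab Q; f \<in> stab Q; dist x (g x) = e; \<forall>y. dist x y < e \<longrightarrow> f y = g y;
        \<forall>y. dist (g x) y < e \<longrightarrow> f y = iv g y; \<forall>y. e \<le> dist x y \<and> e \<le> dist (g x) y \<longrightarrow> f y = y\<rbrakk>
        \<Longrightarrow> \<epsilon> f = - 1"
      by (rule sign_character[OF Q x(4,1)]) (rule that)
    obtain f where f: "f \<in> stab Q" "\<And>y. dist x y < e \<Longrightarrow> f y = g y"
      "\<And>y. dist (g x) y < e \<Longrightarrow> f y = iv g y" "\<And>y. e \<le> dist x y \<Longrightarrow> e \<le> dist (g x) y \<Longrightarrow> f y = y"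
      using swap_in_stab[OF x(2) x(3)[symmetric] Q] by blast
    have \<epsilon>f: "\<epsilon> f = - 1" by (rule \<epsilon>(5)[OF x(2) f(1) x(3)]) (use f(2,3,4) in auto)
    have h1: "h0 \<circ> f \<in> stab Q" by (rule stab_comp[OF True f(1)])
    have \<epsilon>1: "\<epsilon> (h0 \<circ> f) \<noteq> \<epsilon> h0" using \<epsilon>(1)[OF True f(1)] \<epsilon>f \<epsilon>(2)[of h0] by simp
    have "h0 \<circ> f \<in> nbhd h0 P"
      unfolding nbhd_def
    proof (intro CollectI ballI, clarify)
      fix s r assume s: "(s, r) \<in> P"
      then have "f s = s" using x(5)[of s] f(4)[of s] by force
      then show "dist ((h0 \<circ> f) s) (h0 s) < r" using s P(1) by (auto simp: bfam_def)
    qed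
    then have h1U: "h0 \<circ> f \<in> U" using P(2) h1 V by blast
    have \<epsilon>M: "\<epsilon> b = \<epsilon> a" if ab: "a \<in> M" "b \<in> M" for a b
    proof -
      obtain u where u: "u \<in> stab Q" "b = u \<circ> a \<circ> iv u" using conj[OF ab] by blast
      have a: "a \<in> stab Q" using ab M by blast
      have "\<epsilon> id * \<epsilon> id = \<epsilon> id" using \<epsilon>(1)[OF stab_id[OF Q] stab_id[OF Q]] by simp
      then have id: "\<epsilon> id = 1" using \<epsilon>(2)[of id] by simp
      have "\<epsilon> u * \<epsilon> (iv u) = 1" using \<epsilon>(1)[OF u(1) stab_inv[OF u(1)]] id HI[OF u(1)] by simp
      then show ?thesis
        using \<epsilon>(1)[OF stab_comp[OF u(1) a] stab_inv[OF u(1)]] \<epsilon>(1)[OF u(1) a] u(2)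
        by (simp add: mult.commute mult.left_commute)
    qed
    \<comment> \<open>\<open>\<epsilon>\<close> has at most one value on \<open>M\<close> and
      different values at \<open>h0\<close> and \<open>h0 \<circ> f\<close>, so one of these two
      will do.\<close>
    obtain h where h: "h \<in> stab Q" "h \<in> U" "\<And>a. a \<in> M \<Longrightarrow> \<epsilon> a \<noteq> \<epsilon> h"
    proof (cases "\<exists>a\<in>M. \<epsilon> a = \<epsilon> h0")
      case True
      then have "\<epsilon> a \<noteq> \<epsilon> (h0 \<circ> f)" if "a \<in> M" for a using \<epsilon>M \<epsilon>1 that by metis
      then show ?thesis using that h1 h1U by blast
    next
      case False
      then show ?thesis using that True h0 by blast
    qed
    define U' where "U' = U \<inter> (nbhd h (P' \<union> Q) \<inter> V)"
    have PQ: "bfam (P' \<union> Q)" using \<epsilon>(3) Q by (rule bfam_Un)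
    have "openin (subtopology Isom_topology V) U'" unfolding U'_def
      using U(1) openin_nbhd[OF V(2) PQ] by (rule openin_Int)
    moreover have "h \<in> U'" using h V nbhd_refl[OF PQ] by (auto simp: U'_def)
    moreover have "U' \<inter> M = {}"
    proof (rule ccontr)
      assume "U' \<inter> M \<noteq> {}"
      then obtain k where k: "k \<in> M" "k \<in> nbhd h P'" by (auto simp: U'_def nbhd_Un)
      then have "\<epsilon> k = \<epsilon> h" using \<epsilon>(4)[OF h(1)] M by blast
      then show False using h(3)[OF k(1)] by simp
    qed
    ultimately show ?thesis by (intro exI[of _ U']) (auto simp: U'_def)
  qed
qed

end

lemma nowhere_dense_in_subset:
  assumes "nowhere_dense_in T N" "M \<subseteq> N"
  shows "nowhere_dense_in T M"
proof -
  have "T interior_of (T closure_of M) \<subseteq> T interior_of (T closure_of N)"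
    using assms(2) by (intro interior_of_mono closure_of_mono)
  then show ?thesis using assms by (auto simp: nowhere_dense_in_def)
qed

text \<open>If the class of \<open>x\<close> were comeager, the open set \<open>stab Q\<close> would
  be meager: its part outside the class is, and its part inside is split according to the right
  coset of \<open>stab Q\<close> containing the conjugator. Each piece consists of elements
  conjugate under \<open>stab Q\<close>, and separability makes the cosets countable in
  number.\<close>

lemma no_comeager_conj_class:
  assumes ultra: "ultrametric TYPE('a::polish_space)" and Q: "bfam (Q :: ('a \<times> real) set)"
    and no: "\<And>A. bfam A \<Longrightarrow> stab A \<subseteq> stab Q \<Longrightarrow> \<not> extr (stab A)"
    and V: "open_subgroup V" "stab Q \<subseteq> V"
  shows "\<not> has_comeager_conj_class (subgroup_group V) (subgroup_topology V)"
proof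
  interpret ultrametric_type "TYPE('a)" by unfold_locales (rule ultra)
  assume "has_comeager_conj_class (subgroup_group V) (subgroup_topology V)"
  then obtain x where x: "x \<in> V" "comeager_in (subgroup_topology V) (conj_class (subgroup_group V) x)"
    by (auto simp: has_comeager_conj_class_def)
  have sg: "subgroup V Isom_group" and oV: "openin Isom_topology V" using V(1) by (simp_all add: open_subgroup_def)
  note Vp = subgroup_Isom_props[OF sg]
  have ts: "topspace (subgroup_topology V) = V" using Vp(1) by auto
  define C where "C = {v \<circ> x \<circ> iv v | v. v \<in> V}"
  have "conj_class (subgroup_group V) x = C"
    unfolding conj_class_def orbit_def C_def Setcompr_eq_image using Vp(5)
    by (intro image_cong) (auto simp: Isom_group_def)
  then have "meager_in (subgroup_topology V) (V - C)" using x(2) ts by (simp add: comeager_in_def)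
  then obtain \<N> where N: "countable \<N>" "\<And>N. N \<in> \<N> \<Longrightarrow> nowhere_dense_in (subgroup_topology V) N" "V - C = \<Union>\<N>"
    by (auto simp: meager_in_def)
  have finQ: "finite Q" using Q by (simp add: bfam_def)
  \<comment> \<open>A label for the right coset of \<open>v\<close>: indices of dense points near
    the preimages of the centers of \<open>Q\<close>. Equal labels for \<open>v\<close> and
    \<open>w\<close> put \<open>w \<circ> iv v\<close> into \<open>stab Q\<close>.\<close>
  define c where "c v = (\<lambda>p\<in>Q. SOME j. dist (denseq j) (iv v (fst p)) < snd p)" for v :: "'a \<Rightarrow> 'a"
  have c: "dist (denseq (c v (q, r))) (iv v q) < r" if "(q, r) \<in> Q" for v q r
  proof -
    have "\<exists>j. dist (denseq j) (iv v q) < r" using that Q by (intro denseq) (auto simp: bfam_def)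
    from someI_ex[OF this] show ?thesis using that by (simp add: c_def)
  qed
  define M where "M \<kappa> = {v \<circ> x \<circ> iv v | v. v \<in> V \<and> c v = \<kappa>} \<inter> stab Q" for \<kappa>
  have ndM: "nowhere_dense_in (subgroup_topology V) (M \<kappa>)" for \<kappa>
  proof (rule conjugate_set_nowhere_dense[OF Q no V(2) Vp(1)])
    show "M \<kappa> \<subseteq> stab Q" by (simp add: M_def)
    fix a b assume "a \<in> M \<kappa>" "b \<in> M \<kappa>"
    then obtain v w where v: "v \<in> V" "c v = \<kappa>" "a = v \<circ> x \<circ> iv v" and w: "w \<in> V" "c w = \<kappa>" "b = w \<circ> x \<circ> iv w"
      by (auto simp: M_def)
    have I: "v \<in> Isom" "w \<in> Isom" using v w Vp(1) by blast+
    have "w \<circ> iv v \<in> stab Q"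
    proof (rule stabI)
      fix q r assume q: "(q, r) \<in> Q"
      have "dist (iv v q) (iv w q) < r"
        using ultra_less[of "iv v q" "denseq (c v (q, r))" r "iv w q"] c[OF q, of v] c[OF q, of w] v(2) w(2)
        by (simp add: dist_commute)
      then show "dist ((w \<circ> iv v) q) q < r" using I dist_inv_right[of w] by simp
    qed (use I in simp)
    moreover have "b = (w \<circ> iv v) \<circ> a \<circ> iv (w \<circ> iv v)"
      using I by (auto simp: v(3) w(3) fun_eq_iff inv_comp_distrib_Isom)
    ultimately show "\<exists>u\<in>stab Q. b = u \<circ> a \<circ> iv u" by blast
  qed blast+
  define K where "K = (Q \<rightarrow>\<^sub>E (UNIV :: nat set))"
  have cK: "c v \<in> K" for v by (simp add: K_def c_def)
  have "meager_in (subgroup_topology V) (stab Q)"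
    unfolding meager_in_def
  proof (intro exI[of _ "(\<lambda>N. N \<inter> stab Q) ` \<N> \<union> M ` K"] conjI ballI)
    show "countable ((\<lambda>N. N \<inter> stab Q) ` \<N> \<union> M ` K)"
      using N(1) countable_PiE[OF finQ, of "\<lambda>_. UNIV :: nat set"] by (simp add: K_def)
    show "nowhere_dense_in (subgroup_topology V) S" if "S \<in> (\<lambda>N. N \<inter> stab Q) ` \<N> \<union> M ` K" for S
      using that ndM nowhere_dense_in_subset[OF N(2)] by auto
    show "stab Q = \<Union>((\<lambda>N. N \<inter> stab Q) ` \<N> \<union> M ` K)"
    proof
      show "stab Q \<subseteq> \<Union>((\<lambda>N. N \<inter> stab Q) ` \<N> \<union> M ` K)"
      proof
        fix h assume h: "h \<in> stab Q"
        show "h \<in> \<Union>((\<lambda>N. N \<inter> stab Q) ` \<N> \<union> M ` K)"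
        proof (cases "h \<in> C")
          case True
          then obtain v where "v \<in> V" "h = v \<circ> x \<circ> iv v" by (auto simp: C_def)
          then have "h \<in> M (c v)" using h by (auto simp: M_def)
          then show ?thesis using cK by blast
        next
          case False
          then have "h \<in> \<Union>\<N>" using h V(2) N(3) by blast
          then show ?thesis using h by blast
        qed
      qed
    qed (auto simp: M_def)
  qed
  moreover have "\<not> meager_in (subgroup_topology V) (stab Q)"
  proof (rule nonempty_open_not_meager)
    show "completely_metrizable_space (subgroup_topology V)"
      using completely_metrizable_space_openin[OF completely_metrizable_Isom oV] .
    have "openin Isom_topology (stab Q)" using open_subgroup_stab[OF Q] by (simp add: open_subgroup_def)
    then show "openin (subgroup_topology V) (stab Q)"
      using V(2) by (metis openin_subtopology inf.absorb1)
    show "stab Q \<noteq> {}" using stab_id[OF Q] by blast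
  qed
  ultimately show False by blast
qed

theorem theorem5p12:
  assumes ultra: "ultrametric TYPE('a::polish_space)"
  shows "((\<forall>\<B> :: 'a rball set. FD_family \<B> \<longrightarrow>
             (\<exists>\<B>'. FD_family \<B>' \<and> strengthens \<B>' \<B> \<and> extremality \<B>'))
          \<longrightarrow> neighbourhood_base_at id
                (\<lambda>V. open_subgroup V \<and> ample_generics (subgroup_group V) (subgroup_topology V))
                (Isom_topology :: ('a \<Rightarrow> 'a) topology))
       \<and> ((\<exists>\<B> :: 'a rball set. FD_family \<B> \<and>
             \<not> (\<exists>\<B>'. FD_family \<B>' \<and> strengthens \<B>' \<B> \<and> extremality \<B>'))
          \<longrightarrow> \<not> (\<exists>V :: ('a \<Rightarrow> 'a) set. open_subgroup V \<and>
                    has_comeager_conj_class (subgroup_group V) (subgroup_topology V)))"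
proof (intro conjI impI)
  interpret ultrametric_type "TYPE('a)" by unfold_locales (rule ultra)
  have nbhd_id: "nbhd id P \<inter> Isom = stab P" for P :: "('a \<times> real) set"
    by (auto simp: nbhd_def stab_def)
  {
    assume hyp: "\<forall>\<B> :: 'a rball set. FD_family \<B> \<longrightarrow>
      (\<exists>\<B>'. FD_family \<B>' \<and> strengthens \<B>' \<B> \<and> extremality \<B>')"
    have ex: "\<exists>P'. bfam P' \<and> stab P' \<subseteq> stab P \<and> extr (stab P')" if P: "bfam P" for P :: "('a \<times> real) set"
    proof -
      obtain \<B> where B: "FD_family \<B>" "\<tau> id \<B> = stab P" using stab_FD_family[OF P] by blast
      then obtain \<B>' where B': "FD_family \<B>'" "strengthens \<B>' \<B>" "extremality \<B>'" using hyp by blast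
      obtain P' where "bfam P'" "\<tau> id \<B>' = stab P'" using FD_family_stab[OF B'(1)] by blast
      then show ?thesis using B B' extremality_iff[OF B'(1)] by (auto simp: strengthens_def)
    qed
    show "neighbourhood_base_at id
        (\<lambda>V. open_subgroup V \<and> ample_generics (subgroup_group V) (subgroup_topology V))
        (Isom_topology :: ('a \<Rightarrow> 'a) topology)"
      unfolding neighbourhood_base_at_def
    proof (intro allI impI, elim conjE)
      fix W :: "('a \<Rightarrow> 'a) set" assume W: "openin Isom_topology W" "id \<in> W"
      then obtain P where P: "bfam P" "nbhd id P \<inter> Isom \<subseteq> W" unfolding openin_Isom_topology by blast
      obtain P' where P': "bfam P'" "stab P' \<subseteq> stab P" "extr (stab P')" using ex[OF P(1)] by blast
      have "open_subgroup (stab P')" by (rule open_subgroup_stab[OF P'(1)])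
      moreover have "ample_generics (subgroup_group (stab P')) (subgroup_topology (stab P'))"
        by (rule ample_generics_stab[OF ultra P'(1,3) ex])
      ultimately show "\<exists>U V. openin Isom_topology U \<and>
          (open_subgroup V \<and> ample_generics (subgroup_group V) (subgroup_topology V)) \<and> id \<in> U \<and> U \<subseteq> V \<and> V \<subseteq> W"
        using P(2) P'(2) nbhd_id stab_id[OF P'(1)]
        by (intro exI[of _ "stab P'"]) (auto simp: open_subgroup_def)
    qed
  next
    assume "\<exists>\<B> :: 'a rball set. FD_family \<B> \<and>
      \<not> (\<exists>\<B>'. FD_family \<B>' \<and> strengthens \<B>' \<B> \<and> extremality \<B>')"
    then obtain \<B> :: "'a rball set" where B: "FD_family \<B>"
      "\<And>\<B>'. FD_family \<B>' \<Longrightarrow> strengthens \<B>' \<B> \<Longrightarrow> \<not> extremality \<B>'" by blast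
    obtain P where P: "bfam P" "\<tau> id \<B> = stab P" using FD_family_stab[OF B(1)] by blast
    have "\<not> has_comeager_conj_class (subgroup_group V) (subgroup_topology V)" if V: "open_subgroup V" for V :: "('a \<Rightarrow> 'a) set"
    proof -
      have "id \<in> V" using V subgroup_Isom_props(2) by (auto simp: open_subgroup_def)
      then obtain P1 where P1: "bfam P1" "nbhd id P1 \<inter> Isom \<subseteq> V"
        using V unfolding open_subgroup_def openin_Isom_topology by blast
      \<comment> \<open>Passing below \<open>V\<close> keeps the obstruction: a family whose
        stabilizer is contained in \<open>stab Q\<close> strengthens \<open>\<B>\<close>, so it is
        not extremal.\<close>
      define Q where "Q = P \<union> P1"
      have Q: "bfam Q" unfolding Q_def using P(1) P1(1) by (rule bfam_Un)
      have QP: "stab Q \<subseteq> stab P" "stab Q \<subseteq> V" using P1(2) nbhd_id by (auto simp: Q_def stab_Un)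
      have "\<not> extr (stab A)" if A: "bfam A" "stab A \<subseteq> stab Q" for A
      proof -
        obtain \<B>' where B': "FD_family \<B>'" "\<tau> id \<B>' = stab A" using stab_FD_family[OF A(1)] by blast
        have "strengthens \<B>' \<B>" using A(2) QP(1) B'(2) P(2) by (simp add: strengthens_def)
        then show ?thesis using B(2)[OF B'(1)] extremality_iff[OF B'(1)] B'(2) by simp
      qed
      then show ?thesis by (rule no_comeager_conj_class[OF ultra Q _ V QP(2)])
    qed
    then show "\<not> (\<exists>V :: ('a \<Rightarrow> 'a) set. open_subgroup V \<and>
        has_comeager_conj_class (subgroup_group V) (subgroup_topology V))" by blast
  }
qed

end
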